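(* If $\Gamma\vdash t:Q$ is a well-formed (derivable) term judgement, then its interpretation $[\![\Gamma\vdash t:Q]\!]:[\![\Gamma]\!]\to[\![Q]\!]$ is an isometry, i.e. $[\![\Gamma\vdash t:Q]\!]^*\circ[\![\Gamma\vdash t:Q]\!]=\mathrm{id}_{[\![\Gamma]\!]}$.
   Context: **Syntax.** Ground quantum types: $Q::=I\mid Q\oplus Q\mid Q\otimes Q\mid\mathrm{qnat}$, with $\mathrm{qbit}:=I\oplus I$. Unitary types: $U(Q_1,Q_2)$. Let $x$ range over variables and $\alpha$ over complex scalars; all index sets are finite. Basis values: $b::=*\mid x\mid\mathrm{inl}\,b\mid\mathrm{inr}\,b\mid b\otimes b\mid 0\mid S\,b$. Expressions: $e::=*\mid x\mid\mathrm{inl}\,e\mid\mathrm{inr}\,e\mid e\otimes e\mid 0\mid S\,e\mid\sum_{i\in I}(\alpha_i\cdot e_i)$. Unitaries: $u::=\{b_1\mapsto e_1\mid\dots\mid b_n\mapsto e_n\}\mid u\otimes u\mid u\oplus u\mid u\circ u\mid u^*\mid\mathrm{ctrl}\,u$. Terms: $t::=*\mid x\mid\mathrm{inl}\,t\mid\mathrm{inr}\,t\mid t\otimes t\mid 0\mid S\,t\mid u\,t\mid\sum_{i\in I}(\alpha_i\cdot t_i)$. **Orthogonality** $\perp$ is the smallest symmetric relation on terms such that: $\mathrm{inl}\,t_1\perp\mathrm{inr}\,t_2$; $0\perp S\,t$; if $t_1\perp t_2$ then $S\,t_1\perp S\,t_2$, $\mathrm{inl}\,t_1\perp\mathrm{inl}\,t_2$,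 $\mathrm{inr}\,t_1\perp\mathrm{inr}\,t_2$, $u\,t_1\perp u\,t_2$, and, for all $t,t'$, $t\otimes t_1\perp t'\otimes t_2$ and $t_1\otimes t\perp t_2\otimes t'$; if $t\perp t_i$ for all $i\in I$ then $t\perp\sum_{i\in I}(\alpha_i\cdot t_i)$; if $t\perp t_i$ for all $i\in I$, $\alpha_\star=0$ and $t_\star=t$, then $t\perp\sum_{i\in I\cup\{\star\}}(\alpha_i\cdot t_i)$; if $t_i\perp t_j$ for all $i\ne j\in I$, $J,K\subseteq I$ and $\sum_{i\in J\cap K}\overline{\alpha_i}\beta_i=0$, then $\sum_{j\in J}(\alpha_j\cdot t_j)\perp\sum_{k\in K}(\beta_k\cdot t_k)$. **Orthonormal bases.** For a set $S$ of elements of the form $b\otimes b'$, $\pi_1(S),\pi_2(S)$ are the sets of first, resp. second, components, $S^1_b=\{b'\mid b\otimes b'\in S\}$ and $S^2_b=\{b'\mid b'\otimes b\in S\}$. $\mathrm{ONB}_Q$ is the smallest predicate on finite sets of basis values with: $\mathrm{ONB}_Q(\{x\})$; $\mathrm{ONB}_I(\{*\})$; if $\mathrm{ONB}_{Q_1}(S)$ and $\mathrm{ONB}_{Q_2}(T)$ then $\mathrm{ONB}_{Q_1\oplus Q_2}(\{\mathrm{inl}\,b\mid b\in S\}\cup\{\mathrm{inr}\,b\mid b\in T\})$; if $\mathrm{ONB}_{\mathrm{qnat}}(S)$ then $\mathrm{ONB}_{\mathrm{qnat}}(\{0\}\cup\{S\,b\mid b\in S\})$; $\mathrm{ONB}_{Q_1\otimes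 Q_2}(S)$ if $\mathrm{ONB}_{Q_2}(\pi_2(S))$ and $\mathrm{ONB}_{Q_1}(S^2_b)$ for all $b\in\pi_2(S)$; $\mathrm{ONB}_{Q_1\otimes Q_2}(S)$ if $\mathrm{ONB}_{Q_1}(\pi_1(S))$ and $\mathrm{ONB}_{Q_2}(S^1_b)$ for all $b\in\pi_1(S)$. $\mathrm{ONB}^e_Q$ is the predicate on finite sets of expressions generated by the same rules (for expressions) together with: if $\mathrm{ONB}^e_Q(S)$ and $(\alpha_{e,e'})_{(e,e')\in S\times S}$ is a unitary matrix then $\mathrm{ONB}^e_Q(\{\sum_{e'\in S}(\alpha_{e,e'}\cdot e')\mid e\in S\})$. **Typing** (contexts $\Gamma$ are finite sets of pairs $x:Q$, used strictly linearly; comma is disjoint union). $\vdash *:I$; $x:Q\vdash x:Q$; $\Gamma_1,\Gamma_2\vdash t_1\otimes t_2:Q_1\otimes Q_2$ if $\Gamma_i\vdash t_i:Q_i$; $\Gamma\vdash\mathrm{inl}\,t:Q_1\oplus Q_2$ if $\Gamma\vdash t:Q_1$; $\Gamma\vdash\mathrm{inr}\,t:Q_1\oplus Q_2$ if $\Gamma\vdash t:Q_2$; $\vdash 0:\mathrm{qnat}$; $\Gamma\vdash S\,t:\mathrm{qnat}$ if $\Gamma\vdash t:\mathrm{qnat}$; $\Gamma\vdash\sum_i(\alpha_i\cdot t_i):Q$ if $\Gamma\vdash t_i:Q$ for all $i$, $\sum_i|\alpha_i|^2=1$ and $t_i\perp t_j$ for $i\neq j$; $\Gamma\vdash u\,t:Q_2$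 if $\Vdash u:U(Q_1,Q_2)$ and $\Gamma\vdash t:Q_1$. Unitaries: $\Vdash\{b_1\mapsto e_1\mid\dots\mid b_n\mapsto e_n\}:U(Q_1,Q_2)$ if there are $\Gamma_i$ with $\Gamma_i\vdash b_i:Q_1$, $\Gamma_i\vdash e_i:Q_2$, $\mathrm{ONB}_{Q_1}(\{b_1,\dots,b_n\})$ and $\mathrm{ONB}^e_{Q_2}(\{e_1,\dots,e_n\})$ (the $b_i$ pairwise distinct, the $e_i$ pairwise distinct); $u^*:U(Q_2,Q_1)$ if $u:U(Q_1,Q_2)$; $u_2\circ u_1:U(Q_1,Q_3)$ if $u_1:U(Q_1,Q_2)$, $u_2:U(Q_2,Q_3)$; $u_1\otimes u_2:U(Q_1\otimes Q_3,Q_2\otimes Q_4)$ and $u_1\oplus u_2:U(Q_1\oplus Q_3,Q_2\oplus Q_4)$ if $u_1:U(Q_1,Q_2)$, $u_2:U(Q_3,Q_4)$; $\mathrm{ctrl}\,u:U(\mathrm{qbit}\otimes Q,\mathrm{qbit}\otimes Q)$ if $u:U(Q,Q)$. **Denotational semantics** in countably-dimensional complex Hilbert spaces. $[\![I]\!]=\mathbb C$, $[\![Q_1\oplus Q_2]\!]=[\![Q_1]\!]\oplus[\![Q_2]\!]$, $[\![Q_1\otimes Q_2]\!]=[\![Q_1]\!]\otimes[\![Q_2]\!]$, $[\![\mathrm{qnat}]\!]=\ell^2(\mathbb N)$; a context is interpreted as the tensor product of its types (up to canonical permutations). $[\![\Gamma\vdash t:Q]\!]:[\![\Gamma]\!]\to[\![Q]\!]$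 is: $[\![*]\!]=\mathrm{id}_{\mathbb C}$, $[\![x]\!]=\mathrm{id}$, $[\![\mathrm{inl}\,t]\!]=\iota_l\circ[\![t]\!]$, $[\![\mathrm{inr}\,t]\!]=\iota_r\circ[\![t]\!]$ (direct-sum injections), $[\![t\otimes t']\!]=[\![t]\!]\otimes[\![t']\!]$, $[\![0]\!]=|0\rangle$, $[\![S\,t]\!]=\mathrm{succ}\circ[\![t]\!]$ with $\mathrm{succ}|n\rangle=|n+1\rangle$, $[\![\sum_i(\alpha_i\cdot t_i)]\!]=\sum_i\alpha_i[\![t_i]\!]$, $[\![u\,t]\!]=[\![u]\!]\circ[\![t]\!]$. For unitaries: $[\![\{b_i\mapsto e_i\}_i]\!]=\sum_i[\![e_i]\!]\circ[\![b_i]\!]^*$; $\circ,\otimes,\oplus,(-)^*$ are interpreted by the same operations on operators; $[\![\mathrm{ctrl}\,u]\!]=|0\rangle\langle0|\otimes\mathrm{id}+|1\rangle\langle1|\otimes[\![u]\!]$. *)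

theory Defs
  imports "HOL-Analysis.Analysis" "HOL-Library.Multiset" "HOL-Library.FuncSet"
begin

section \<open>Syntax\<close>

datatype ty = One | Plus ty ty | Tensor ty ty | Qnat

abbreviation Qbit :: ty where "Qbit \<equiv> Plus One One"

type_synonym var = nat

text \<open>
  A finite family \<open>(\<alpha>\<^sub>i \<cdot> t\<^sub>i)\<close> with \<open>i \<in> I\<close>, taken up to reindexing, is a finite multiset of
  scalar-term pairs; \<open>LC I \<alpha> t\<close> below is the notation with an explicit index set.  The datatype does
  not restrict the clauses of \<open>UMatch\<close> to basis values and expressions; this is imposed by the
  typing rule for \<open>UMatch\<close>.
\<close>

datatype tm =
    TStar
  | TVar var
  | TInl tm
  | TInr tm
  | TPair tm tm
  | TZero
  | TSucc tm
  | TApp uni tm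
  | TSum "(complex \<times> tm) multiset"
and uni =
    UMatch "(tm \<times> tm) list"
  | UTensor uni uni
  | UPlus uni uni
  | UComp uni uni  \<comment> \<open>\<open>UComp u\<^sub>2 u\<^sub>1\<close> is \<open>u\<^sub>2 \<circ> u\<^sub>1\<close>\<close>
  | UAdj uni
  | UCtrl uni

abbreviation LC :: "'i set \<Rightarrow> ('i \<Rightarrow> complex) \<Rightarrow> ('i \<Rightarrow> tm) \<Rightarrow> tm" where
  "LC I \<alpha> t \<equiv> TSum (image_mset (\<lambda>i. (\<alpha> i, t i)) (mset_set I))"

inductive is_bval :: "tm \<Rightarrow> bool" where
  "is_bval TStar"
| "is_bval (TVar x)"
| "is_bval b \<Longrightarrow> is_bval (TInl b)"
| "is_bval b \<Longrightarrow> is_bval (TInr b)"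
| "is_bval b \<Longrightarrow> is_bval b' \<Longrightarrow> is_bval (TPair b b')"
| "is_bval TZero"
| "is_bval b \<Longrightarrow> is_bval (TSucc b)"

inductive is_expr :: "tm \<Rightarrow> bool" where
  "is_expr TStar"
| "is_expr (TVar x)"
| "is_expr e \<Longrightarrow> is_expr (TInl e)"
| "is_expr e \<Longrightarrow> is_expr (TInr e)"
| "is_expr e \<Longrightarrow> is_expr e' \<Longrightarrow> is_expr (TPair e e')"
| "is_expr TZero"
| "is_expr e \<Longrightarrow> is_expr (TSucc e)"
| "(\<And>\<alpha> e. (\<alpha>, e) \<in># M \<Longrightarrow> is_expr e) \<Longrightarrow> is_expr (TSum M)"


section \<open>Orthogonality\<close>

text \<open>Every finite family can be indexed by natural numbers, so index sets are of type
  \<^typ>\<open>nat set\<close> in the rules.\<close>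

inductive orth :: "tm \<Rightarrow> tm \<Rightarrow> bool"  (infix "\<bottom>\<bottom>" 50) where
  sym: "t \<bottom>\<bottom> s \<Longrightarrow> s \<bottom>\<bottom> t"
| inl_inr: "TInl t\<^sub>1 \<bottom>\<bottom> TInr t\<^sub>2"
| zero_succ: "TZero \<bottom>\<bottom> TSucc t"
| succ: "t\<^sub>1 \<bottom>\<bottom> t\<^sub>2 \<Longrightarrow> TSucc t\<^sub>1 \<bottom>\<bottom> TSucc t\<^sub>2"
| inl: "t\<^sub>1 \<bottom>\<bottom> t\<^sub>2 \<Longrightarrow> TInl t\<^sub>1 \<bottom>\<bottom> TInl t\<^sub>2"
| inr: "t\<^sub>1 \<bottom>\<bottom> t\<^sub>2 \<Longrightarrow> TInr t\<^sub>1 \<bottom>\<bottom> TInr t\<^sub>2"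
| app: "t\<^sub>1 \<bottom>\<bottom> t\<^sub>2 \<Longrightarrow> TApp u t\<^sub>1 \<bottom>\<bottom> TApp u t\<^sub>2"
| pair_right: "t\<^sub>1 \<bottom>\<bottom> t\<^sub>2 \<Longrightarrow> TPair t t\<^sub>1 \<bottom>\<bottom> TPair t' t\<^sub>2"
| pair_left: "t\<^sub>1 \<bottom>\<bottom> t\<^sub>2 \<Longrightarrow> TPair t\<^sub>1 t \<bottom>\<bottom> TPair t\<^sub>2 t'"
| sum: "finite (I :: nat set) \<Longrightarrow> (\<And>i. i \<in> I \<Longrightarrow> t \<bottom>\<bottom> s i) \<Longrightarrow> t \<bottom>\<bottom> LC I \<alpha> s"
| sum_zero:
    "finite (I :: nat set) \<Longrightarrow> k \<notin> I \<Longrightarrow> (\<And>i. i \<in> I \<Longrightarrow> t \<bottom>\<bottom> s i)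
      \<Longrightarrow> \<alpha> k = 0 \<Longrightarrow> s k = t \<Longrightarrow> t \<bottom>\<bottom> LC (insert k I) \<alpha> s"
| sum_sum:
    "finite (I :: nat set) \<Longrightarrow> (\<And>i j. i \<in> I \<Longrightarrow> j \<in> I \<Longrightarrow> i \<noteq> j \<Longrightarrow> t i \<bottom>\<bottom> t j)
      \<Longrightarrow> J \<subseteq> I \<Longrightarrow> K \<subseteq> I \<Longrightarrow> (\<Sum>i\<in>J \<inter> K. cnj (\<alpha> i) * \<beta> i) = 0
      \<Longrightarrow> LC J \<alpha> t \<bottom>\<bottom> LC K \<beta> t"


section \<open>Orthonormal bases\<close>

definition proj1 :: "tm set \<Rightarrow> tm set" where "proj1 S = {b. \<exists>b'. TPair b b' \<in> S}"
definition proj2 :: "tm set \<Rightarrow> tm set" where "proj2 S = {b'. \<exists>b. TPair b b' \<in> S}"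
definition fibre1 :: "tm set \<Rightarrow> tm \<Rightarrow> tm set" where "fibre1 S b = {b'. TPair b b' \<in> S}"
definition fibre2 :: "tm set \<Rightarrow> tm \<Rightarrow> tm set" where "fibre2 S b = {b'. TPair b' b \<in> S}"

definition pair_set :: "tm set \<Rightarrow> bool" where
  "pair_set S \<longleftrightarrow> (\<forall>t\<in>S. \<exists>b b'. t = TPair b b')"

definition unitary_matrix :: "'i set \<Rightarrow> ('i \<Rightarrow> 'i \<Rightarrow> complex) \<Rightarrow> bool" where
  "unitary_matrix S A \<longleftrightarrow>
     (\<forall>i\<in>S. \<forall>j\<in>S. (\<Sum>k\<in>S. A i k * cnj (A j k)) = (if i = j then 1 else 0)) \<and>
     (\<forall>i\<in>S. \<forall>j\<in>S. (\<Sum>k\<in>S. cnj (A k i) * A k j) = (if i = j then 1 else 0))"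

inductive ONB :: "ty \<Rightarrow> tm set \<Rightarrow> bool" where
  var: "ONB Q {TVar x}"
| star: "ONB One {TStar}"
| plus: "ONB Q\<^sub>1 S \<Longrightarrow> ONB Q\<^sub>2 T \<Longrightarrow> ONB (Plus Q\<^sub>1 Q\<^sub>2) (TInl ` S \<union> TInr ` T)"
| nat: "ONB Qnat S \<Longrightarrow> ONB Qnat ({TZero} \<union> TSucc ` S)"
| tensor2: "finite S \<Longrightarrow> pair_set S \<Longrightarrow> ONB Q\<^sub>2 (proj2 S)
    \<Longrightarrow> (\<And>b. b \<in> proj2 S \<Longrightarrow> ONB Q\<^sub>1 (fibre2 S b)) \<Longrightarrow> ONB (Tensor Q\<^sub>1 Q\<^sub>2) S"
| tensor1: "finite S \<Longrightarrow> pair_set S \<Longrightarrow> ONB Q\<^sub>1 (proj1 S)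
    \<Longrightarrow> (\<And>b. b \<in> proj1 S \<Longrightarrow> ONB Q\<^sub>2 (fibre1 S b)) \<Longrightarrow> ONB (Tensor Q\<^sub>1 Q\<^sub>2) S"

inductive ONBe :: "ty \<Rightarrow> tm set \<Rightarrow> bool" where
  var: "ONBe Q {TVar x}"
| star: "ONBe One {TStar}"
| plus: "ONBe Q\<^sub>1 S \<Longrightarrow> ONBe Q\<^sub>2 T \<Longrightarrow> ONBe (Plus Q\<^sub>1 Q\<^sub>2) (TInl ` S \<union> TInr ` T)"
| nat: "ONBe Qnat S \<Longrightarrow> ONBe Qnat ({TZero} \<union> TSucc ` S)"
| tensor2: "finite S \<Longrightarrow> pair_set S \<Longrightarrow> ONBe Q\<^sub>2 (proj2 S)
    \<Longrightarrow> (\<And>e. e \<in> proj2 S \<Longrightarrow> ONBe Q\<^sub>1 (fibre2 S e)) \<Longrightarrow> ONBe (Tensor Q\<^sub>1 Q\<^sub>2) S"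
| tensor1: "finite S \<Longrightarrow> pair_set S \<Longrightarrow> ONBe Q\<^sub>1 (proj1 S)
    \<Longrightarrow> (\<And>e. e \<in> proj1 S \<Longrightarrow> ONBe Q\<^sub>2 (fibre1 S e)) \<Longrightarrow> ONBe (Tensor Q\<^sub>1 Q\<^sub>2) S"
| unitary: "ONBe Q S \<Longrightarrow> unitary_matrix S A
    \<Longrightarrow> ONBe Q ((\<lambda>e. LC S (A e) (\<lambda>e'. e')) ` S)"


section \<open>Typing\<close>

text \<open>Contexts are partial maps; those occurring in derivable judgements have finite domain.
  The context \<open>\<Gamma>\<^sub>1, \<Gamma>\<^sub>2\<close> is \<open>\<Gamma>\<^sub>1 ++ \<Gamma>\<^sub>2\<close> for \<open>\<Gamma>\<^sub>1\<close>, \<open>\<Gamma>\<^sub>2\<close> with disjoint domains.\<close>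

type_synonym ctx = "var \<rightharpoonup> ty"

inductive typed :: "ctx \<Rightarrow> tm \<Rightarrow> ty \<Rightarrow> bool"
  and utyped :: "uni \<Rightarrow> ty \<Rightarrow> ty \<Rightarrow> bool" where
  star: "typed Map.empty TStar One"
| var: "typed [x \<mapsto> Q] (TVar x) Q"
| pair: "typed \<Gamma>\<^sub>1 t\<^sub>1 Q\<^sub>1 \<Longrightarrow> typed \<Gamma>\<^sub>2 t\<^sub>2 Q\<^sub>2 \<Longrightarrow> dom \<Gamma>\<^sub>1 \<inter> dom \<Gamma>\<^sub>2 = {}
    \<Longrightarrow> typed (\<Gamma>\<^sub>1 ++ \<Gamma>\<^sub>2) (TPair t\<^sub>1 t\<^sub>2) (Tensor Q\<^sub>1 Q\<^sub>2)"
| inl: "typed \<Gamma> t Q\<^sub>1 \<Longrightarrow> typed \<Gamma> (TInl t) (Plus Q\<^sub>1 Q\<^sub>2)"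
| inr: "typed \<Gamma> t Q\<^sub>2 \<Longrightarrow> typed \<Gamma> (TInr t) (Plus Q\<^sub>1 Q\<^sub>2)"
| zero: "typed Map.empty TZero Qnat"
| succ: "typed \<Gamma> t Qnat \<Longrightarrow> typed \<Gamma> (TSucc t) Qnat"
| sum: "finite (I :: nat set) \<Longrightarrow> (\<And>i. i \<in> I \<Longrightarrow> typed \<Gamma> (t i) Q)
    \<Longrightarrow> (\<Sum>i\<in>I. (cmod (\<alpha> i))\<^sup>2) = 1
    \<Longrightarrow> (\<And>i j. i \<in> I \<Longrightarrow> j \<in> I \<Longrightarrow> i \<noteq> j \<Longrightarrow> t i \<bottom>\<bottom> t j)
    \<Longrightarrow> typed \<Gamma> (LC I \<alpha> t) Q"
| app: "utyped u Q\<^sub>1 Q\<^sub>2 \<Longrightarrow> typed \<Gamma> t Q\<^sub>1 \<Longrightarrow> typed \<Gamma> (TApp u t) Q\<^sub>2"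
| umatch: "(\<And>b e. (b, e) \<in> set cs \<Longrightarrow> is_bval b \<and> is_expr e)
    \<Longrightarrow> (\<And>i. i < length cs \<Longrightarrow> typed (\<Gamma> i) (fst (cs ! i)) Q\<^sub>1)
    \<Longrightarrow> (\<And>i. i < length cs \<Longrightarrow> typed (\<Gamma> i) (snd (cs ! i)) Q\<^sub>2)
    \<Longrightarrow> distinct (map fst cs) \<Longrightarrow> distinct (map snd cs)
    \<Longrightarrow> ONB Q\<^sub>1 (fst ` set cs) \<Longrightarrow> ONBe Q\<^sub>2 (snd ` set cs)
    \<Longrightarrow> utyped (UMatch cs) Q\<^sub>1 Q\<^sub>2"
| uadj: "utyped u Q\<^sub>1 Q\<^sub>2 \<Longrightarrow> utyped (UAdj u) Q\<^sub>2 Q\<^sub>1"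
| ucomp: "utyped u\<^sub>1 Q\<^sub>1 Q\<^sub>2 \<Longrightarrow> utyped u\<^sub>2 Q\<^sub>2 Q\<^sub>3 \<Longrightarrow> utyped (UComp u\<^sub>2 u\<^sub>1) Q\<^sub>1 Q\<^sub>3"
| utensor: "utyped u\<^sub>1 Q\<^sub>1 Q\<^sub>2 \<Longrightarrow> utyped u\<^sub>2 Q\<^sub>3 Q\<^sub>4
    \<Longrightarrow> utyped (UTensor u\<^sub>1 u\<^sub>2) (Tensor Q\<^sub>1 Q\<^sub>3) (Tensor Q\<^sub>2 Q\<^sub>4)"
| uplus: "utyped u\<^sub>1 Q\<^sub>1 Q\<^sub>2 \<Longrightarrow> utyped u\<^sub>2 Q\<^sub>3 Q\<^sub>4
    \<Longrightarrow> utyped (UPlus u\<^sub>1 u\<^sub>2) (Plus Q\<^sub>1 Q\<^sub>3) (Plus Q\<^sub>2 Q\<^sub>4)"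
| uctrl: "utyped u Q Q \<Longrightarrow> utyped (UCtrl u) (Tensor Qbit Q) (Tensor Qbit Q)"


section \<open>Hilbert spaces and bounded operators\<close>

text \<open>
  \<open>ell2 B\<close> is the carrier of the Hilbert space of square-summable families indexed by \<open>B\<close>, extended
  by \<open>0\<close> outside \<open>B\<close>.  Operators are extensional functions on the carrier (\<open>undefined\<close> outside),
  so that \<open>compose\<close> and \<open>restrict\<close> from \<^theory>\<open>HOL-Library.FuncSet\<close> give composition and identity.
\<close>

definition ell2 :: "'a set \<Rightarrow> ('a \<Rightarrow> complex) set" where
  "ell2 B = {v. (\<forall>x. x \<notin> B \<longrightarrow> v x = 0) \<and> (\<lambda>x. (cmod (v x))\<^sup>2) summable_on UNIV}"

definition inner2 :: "('a \<Rightarrow> complex) \<Rightarrow> ('a \<Rightarrow> complex) \<Rightarrow> complex" where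
  "inner2 v w = (\<Sum>\<^sub>\<infinity>x. cnj (v x) * w x)"

definition norm2 :: "('a \<Rightarrow> complex) \<Rightarrow> real" where
  "norm2 v = sqrt (\<Sum>\<^sub>\<infinity>x. (cmod (v x))\<^sup>2)"

definition ket :: "'a \<Rightarrow> 'a \<Rightarrow> complex" where
  "ket b = (\<lambda>x. if x = b then 1 else 0)"

definition bop ::
  "('a \<Rightarrow> complex) set \<Rightarrow> ('b \<Rightarrow> complex) set \<Rightarrow> (('a \<Rightarrow> complex) \<Rightarrow> ('b \<Rightarrow> complex)) set" where
  "bop H K = {f \<in> H \<rightarrow>\<^sub>E K.
     (\<forall>v\<in>H. \<forall>w\<in>H. \<forall>a b. f (\<lambda>x. a * v x + b * w x) = (\<lambda>y. a * f v y + b * f w y)) \<and>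
     (\<exists>C. \<forall>v\<in>H. norm2 (f v) \<le> C * norm2 v)}"

definition adj ::
  "('a \<Rightarrow> complex) set \<Rightarrow> ('b \<Rightarrow> complex) set \<Rightarrow> (('a \<Rightarrow> complex) \<Rightarrow> ('b \<Rightarrow> complex))
    \<Rightarrow> ('b \<Rightarrow> complex) \<Rightarrow> ('a \<Rightarrow> complex)" where
  "adj H K f = (THE g. g \<in> bop K H \<and> (\<forall>v\<in>H. \<forall>w\<in>K. inner2 (f v) w = inner2 v (g w)))"


section \<open>Interpretation of types and contexts\<close>

text \<open>
  All types are interpreted over one type of labels for the canonical orthonormal bases.  Up to
  canonical isomorphism, the Hilbert direct sum and the (completed) Hilbert tensor product of
  \<open>\<ell>\<^sup>2(A)\<close> and \<open>\<ell>\<^sup>2(B)\<close> are \<open>\<ell>\<^sup>2\<close> of the disjoint union and of the Cartesian product, respectively.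
\<close>

datatype label = LStar | LInl label | LInr label | LPair label label | LNat nat

primrec basis :: "ty \<Rightarrow> label set" where
  "basis One = {LStar}"
| "basis (Plus Q\<^sub>1 Q\<^sub>2) = LInl ` basis Q\<^sub>1 \<union> LInr ` basis Q\<^sub>2"
| "basis (Tensor Q\<^sub>1 Q\<^sub>2) = {LPair a b | a b. a \<in> basis Q\<^sub>1 \<and> b \<in> basis Q\<^sub>2}"
| "basis Qnat = range LNat"

type_synonym vec = "label \<Rightarrow> complex"

definition hty :: "ty \<Rightarrow> vec set" where
  "hty Q = ell2 (basis Q)"

text \<open>A basis vector of the tensor product over a context is a choice of one basis label for each
  variable; for the empty context this gives \<open>\<ell>\<^sup>2\<close> of a singleton, i.e. the scalars.\<close>

type_synonym env = "var \<rightharpoonup> label"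
type_synonym evec = "env \<Rightarrow> complex"

definition basis_ctx :: "ctx \<Rightarrow> env set" where
  "basis_ctx \<Gamma> = {\<rho>. dom \<rho> = dom \<Gamma> \<and> (\<forall>x Q a. \<Gamma> x = Some Q \<longrightarrow> \<rho> x = Some a \<longrightarrow> a \<in> basis Q)}"

definition hctx :: "ctx \<Rightarrow> evec set" where
  "hctx \<Gamma> = ell2 (basis_ctx \<Gamma>)"

definition vtensor :: "vec \<Rightarrow> vec \<Rightarrow> vec" where
  "vtensor v w = (\<lambda>l. case l of LPair a b \<Rightarrow> v a * w b | _ \<Rightarrow> 0)"

text \<open>The elementary tensors in \<open>[\<Gamma>\<^sub>1, \<Gamma>\<^sub>2] = [\<Gamma>\<^sub>1] \<otimes> [\<Gamma>\<^sub>2]\<close>.\<close>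

definition etensor :: "ctx \<Rightarrow> ctx \<Rightarrow> evec \<Rightarrow> evec \<Rightarrow> evec" where
  "etensor \<Gamma>\<^sub>1 \<Gamma>\<^sub>2 v w = (\<lambda>\<rho>. if \<rho> \<in> basis_ctx (\<Gamma>\<^sub>1 ++ \<Gamma>\<^sub>2)
     then v (\<rho> |` dom \<Gamma>\<^sub>1) * w (\<rho> |` dom \<Gamma>\<^sub>2) else 0)"

text \<open>The bounded operator \<open>f \<otimes> g\<close> determined by \<open>(f \<otimes> g) (v \<otimes> w) = f v \<otimes> g w\<close>, where \<open>\<tau>\<close> is
  the map from \<open>H\<^sub>1 \<times> H\<^sub>2\<close> to elementary tensors in \<open>H\<close>.\<close>

definition op_tensor ::
  "(('a \<Rightarrow> complex) \<Rightarrow> ('a \<Rightarrow> complex) \<Rightarrow> ('a \<Rightarrow> complex))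
    \<Rightarrow> ('a \<Rightarrow> complex) set \<Rightarrow> ('a \<Rightarrow> complex) set \<Rightarrow> ('a \<Rightarrow> complex) set \<Rightarrow> vec set
    \<Rightarrow> (('a \<Rightarrow> complex) \<Rightarrow> vec) \<Rightarrow> (('a \<Rightarrow> complex) \<Rightarrow> vec) \<Rightarrow> ('a \<Rightarrow> complex) \<Rightarrow> vec" where
  "op_tensor \<tau> H\<^sub>1 H\<^sub>2 H K f g =
     (THE h. h \<in> bop H K \<and> (\<forall>v\<in>H\<^sub>1. \<forall>w\<in>H\<^sub>2. h (\<tau> v w) = vtensor (f v) (g w)))"

abbreviation op_tensor_ty :: "ty \<Rightarrow> ty \<Rightarrow> ty \<Rightarrow> ty \<Rightarrow> (vec \<Rightarrow> vec) \<Rightarrow> (vec \<Rightarrow> vec) \<Rightarrow> vec \<Rightarrow> vec" where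
  "op_tensor_ty Q\<^sub>1 Q\<^sub>2 Q\<^sub>3 Q\<^sub>4 \<equiv>
     op_tensor vtensor (hty Q\<^sub>1) (hty Q\<^sub>3) (hty (Tensor Q\<^sub>1 Q\<^sub>3)) (hty (Tensor Q\<^sub>2 Q\<^sub>4))"

abbreviation op_tensor_ctx ::
  "ctx \<Rightarrow> ty \<Rightarrow> ctx \<Rightarrow> ty \<Rightarrow> (evec \<Rightarrow> vec) \<Rightarrow> (evec \<Rightarrow> vec) \<Rightarrow> evec \<Rightarrow> vec" where
  "op_tensor_ctx \<Gamma>\<^sub>1 Q\<^sub>1 \<Gamma>\<^sub>2 Q\<^sub>2 \<equiv>
     op_tensor (etensor \<Gamma>\<^sub>1 \<Gamma>\<^sub>2) (hctx \<Gamma>\<^sub>1) (hctx \<Gamma>\<^sub>2) (hctx (\<Gamma>\<^sub>1 ++ \<Gamma>\<^sub>2)) (hty (Tensor Q\<^sub>1 Q\<^sub>2))"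

definition op_plus :: "ty \<Rightarrow> ty \<Rightarrow> (vec \<Rightarrow> vec) \<Rightarrow> (vec \<Rightarrow> vec) \<Rightarrow> vec \<Rightarrow> vec" where
  "op_plus Q\<^sub>1 Q\<^sub>3 f g = (\<lambda>v\<in>hty (Plus Q\<^sub>1 Q\<^sub>3). \<lambda>l. case l of
       LInl a \<Rightarrow> f (\<lambda>b. v (LInl b)) a
     | LInr a \<Rightarrow> g (\<lambda>b. v (LInr b)) a
     | _ \<Rightarrow> 0)"

definition inj_left :: "ty \<Rightarrow> vec \<Rightarrow> vec" where
  "inj_left Q = (\<lambda>v\<in>hty Q. \<lambda>l. case l of LInl a \<Rightarrow> v a | _ \<Rightarrow> 0)"

definition inj_right :: "ty \<Rightarrow> vec \<Rightarrow> vec" where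
  "inj_right Q = (\<lambda>v\<in>hty Q. \<lambda>l. case l of LInr a \<Rightarrow> v a | _ \<Rightarrow> 0)"

definition succ_op :: "vec \<Rightarrow> vec" where
  "succ_op = (\<lambda>v\<in>hty Qnat. \<lambda>l. case l of LNat (Suc n) \<Rightarrow> v (LNat n) | _ \<Rightarrow> 0)"

text \<open>The qubit basis vectors \<open>|0\<rangle>\<close> and \<open>|1\<rangle>\<close> are the left and right injection of the unit of the
  scalars; \<open>proj_ket Q b\<close> is \<open>|b\<rangle>\<langle>b|\<close> on \<open>hty Q\<close>.\<close>

definition proj_ket :: "ty \<Rightarrow> label \<Rightarrow> vec \<Rightarrow> vec" where
  "proj_ket Q b = (\<lambda>v\<in>hty Q. \<lambda>l. inner2 (ket b) v * ket b l)"

definition ctrl_op :: "ty \<Rightarrow> (vec \<Rightarrow> vec) \<Rightarrow> vec \<Rightarrow> vec" where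
  "ctrl_op Q f = (\<lambda>v\<in>hty (Tensor Qbit Q). \<lambda>l.
       op_tensor_ty Qbit Qbit Q Q (proj_ket Qbit (LInl LStar)) (\<lambda>w\<in>hty Q. w) v l
     + op_tensor_ty Qbit Qbit Q Q (proj_ket Qbit (LInr LStar)) f v l)"


section \<open>Interpretation of judgements\<close>

text \<open>
  The interpretation is defined by recursion on typing derivations: \<open>sem \<Gamma> t Q f\<close> says that some
  derivation of \<open>typed \<Gamma> t Q\<close> has interpretation \<open>f\<close>, and similarly for \<open>usem\<close>.  Each rule repeats
  the premises of the corresponding typing rule.
\<close>

inductive sem :: "ctx \<Rightarrow> tm \<Rightarrow> ty \<Rightarrow> (evec \<Rightarrow> vec) \<Rightarrow> bool"
  and usem :: "uni \<Rightarrow> ty \<Rightarrow> ty \<Rightarrow> (vec \<Rightarrow> vec) \<Rightarrow> bool" where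
  star: "sem Map.empty TStar One (\<lambda>v\<in>hctx Map.empty. \<lambda>l. v Map.empty * ket LStar l)"
| var: "sem [x \<mapsto> Q] (TVar x) Q (\<lambda>v\<in>hctx [x \<mapsto> Q]. \<lambda>l. v [x \<mapsto> l])"
| pair: "sem \<Gamma>\<^sub>1 t\<^sub>1 Q\<^sub>1 f\<^sub>1 \<Longrightarrow> sem \<Gamma>\<^sub>2 t\<^sub>2 Q\<^sub>2 f\<^sub>2 \<Longrightarrow> dom \<Gamma>\<^sub>1 \<inter> dom \<Gamma>\<^sub>2 = {}
    \<Longrightarrow> sem (\<Gamma>\<^sub>1 ++ \<Gamma>\<^sub>2) (TPair t\<^sub>1 t\<^sub>2) (Tensor Q\<^sub>1 Q\<^sub>2) (op_tensor_ctx \<Gamma>\<^sub>1 Q\<^sub>1 \<Gamma>\<^sub>2 Q\<^sub>2 f\<^sub>1 f\<^sub>2)"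
| inl: "sem \<Gamma> t Q\<^sub>1 f \<Longrightarrow> sem \<Gamma> (TInl t) (Plus Q\<^sub>1 Q\<^sub>2) (compose (hctx \<Gamma>) (inj_left Q\<^sub>1) f)"
| inr: "sem \<Gamma> t Q\<^sub>2 f \<Longrightarrow> sem \<Gamma> (TInr t) (Plus Q\<^sub>1 Q\<^sub>2) (compose (hctx \<Gamma>) (inj_right Q\<^sub>2) f)"
| zero: "sem Map.empty TZero Qnat (\<lambda>v\<in>hctx Map.empty. \<lambda>l. v Map.empty * ket (LNat 0) l)"
| succ: "sem \<Gamma> t Qnat f \<Longrightarrow> sem \<Gamma> (TSucc t) Qnat (compose (hctx \<Gamma>) succ_op f)"
| sum: "finite (I :: nat set) \<Longrightarrow> (\<And>i. i \<in> I \<Longrightarrow> sem \<Gamma> (t i) Q (f i))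
    \<Longrightarrow> (\<Sum>i\<in>I. (cmod (\<alpha> i))\<^sup>2) = 1
    \<Longrightarrow> (\<And>i j. i \<in> I \<Longrightarrow> j \<in> I \<Longrightarrow> i \<noteq> j \<Longrightarrow> t i \<bottom>\<bottom> t j)
    \<Longrightarrow> sem \<Gamma> (LC I \<alpha> t) Q (\<lambda>v\<in>hctx \<Gamma>. \<lambda>l. \<Sum>i\<in>I. \<alpha> i * f i v l)"
| app: "usem u Q\<^sub>1 Q\<^sub>2 g \<Longrightarrow> sem \<Gamma> t Q\<^sub>1 f \<Longrightarrow> sem \<Gamma> (TApp u t) Q\<^sub>2 (compose (hctx \<Gamma>) g f)"
| umatch: "(\<And>b e. (b, e) \<in> set cs \<Longrightarrow> is_bval b \<and> is_expr e)
    \<Longrightarrow> (\<And>i. i < length cs \<Longrightarrow> sem (\<Gamma> i) (fst (cs ! i)) Q\<^sub>1 (f i))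
    \<Longrightarrow> (\<And>i. i < length cs \<Longrightarrow> sem (\<Gamma> i) (snd (cs ! i)) Q\<^sub>2 (g i))
    \<Longrightarrow> distinct (map fst cs) \<Longrightarrow> distinct (map snd cs)
    \<Longrightarrow> ONB Q\<^sub>1 (fst ` set cs) \<Longrightarrow> ONBe Q\<^sub>2 (snd ` set cs)
    \<Longrightarrow> usem (UMatch cs) Q\<^sub>1 Q\<^sub>2
          (\<lambda>v\<in>hty Q\<^sub>1. \<lambda>l. \<Sum>i<length cs. g i (adj (hctx (\<Gamma> i)) (hty Q\<^sub>1) (f i) v) l)"
| uadj: "usem u Q\<^sub>1 Q\<^sub>2 f \<Longrightarrow> usem (UAdj u) Q\<^sub>2 Q\<^sub>1 (adj (hty Q\<^sub>1) (hty Q\<^sub>2) f)"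
| ucomp: "usem u\<^sub>1 Q\<^sub>1 Q\<^sub>2 f \<Longrightarrow> usem u\<^sub>2 Q\<^sub>2 Q\<^sub>3 g
    \<Longrightarrow> usem (UComp u\<^sub>2 u\<^sub>1) Q\<^sub>1 Q\<^sub>3 (compose (hty Q\<^sub>1) g f)"
| utensor: "usem u\<^sub>1 Q\<^sub>1 Q\<^sub>2 f \<Longrightarrow> usem u\<^sub>2 Q\<^sub>3 Q\<^sub>4 g
    \<Longrightarrow> usem (UTensor u\<^sub>1 u\<^sub>2) (Tensor Q\<^sub>1 Q\<^sub>3) (Tensor Q\<^sub>2 Q\<^sub>4) (op_tensor_ty Q\<^sub>1 Q\<^sub>2 Q\<^sub>3 Q\<^sub>4 f g)"
| uplus: "usem u\<^sub>1 Q\<^sub>1 Q\<^sub>2 f \<Longrightarrow> usem u\<^sub>2 Q\<^sub>3 Q\<^sub>4 g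
    \<Longrightarrow> usem (UPlus u\<^sub>1 u\<^sub>2) (Plus Q\<^sub>1 Q\<^sub>3) (Plus Q\<^sub>2 Q\<^sub>4) (op_plus Q\<^sub>1 Q\<^sub>3 f g)"
| uctrl: "usem u Q Q f \<Longrightarrow> usem (UCtrl u) (Tensor Qbit Q) (Tensor Qbit Q) (ctrl_op Q f)"

definition isometry_op ::
  "('a \<Rightarrow> complex) set \<Rightarrow> ('b \<Rightarrow> complex) set \<Rightarrow> (('a \<Rightarrow> complex) \<Rightarrow> ('b \<Rightarrow> complex)) \<Rightarrow> bool" where
  "isometry_op H K f \<longleftrightarrow> f \<in> bop H K \<and> compose H (adj H K f) f = (\<lambda>v\<in>H. v)"

end

(* Call the set of values [[t]] x, with x ranging over the space of the context, the range of t at Q.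
   Linear typing makes the context of a term and the intermediate types of a unitary unique, so the
   interpretation does not depend on the derivation. Orthogonal terms of the same type, possibly in
   different contexts, then have orthogonal ranges, provided smaller terms are isometries: in the rule
   for two linear combinations over one orthogonal family, the diagonal terms reduce by isometry to the
   scalar that vanishes by the side condition. The elements of an orthonormal basis are pairwise
   orthogonal terms whose ranges span the whole space, so a list of clauses maps one orthogonal
   decomposition of the space isometrically onto another one and is therefore unitary. Both facts enter
   a single induction on the size of terms and unitaries. *)

theory Submission
  imports Defs
begin

text \<open>The obstacle is a circle: orthogonality is an untyped syntactic relation, and its
  soundness for two linear combinations of one family needs the summands to be isometries, while the
  isometry of a linear combination needs that soundness. In rule \<open>sum_sum\<close> the index
  set \<open>I\<close> may carry arbitrarily large terms, but only terms indexed by \<open>J\<close>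
  and \<open>K\<close> are ever compared, so bounding the size of the compared terms breaks the
  circle.

  A list of clauses does not display its types, since \<open>{TVar x}\<close> is an orthonormal
  basis of every type. Source and target determine each other only through the contexts that the two
  sides of each clause share, so uniqueness of contexts and of unitary types has to be one
  simultaneous induction.

  Adjoints and tensor products are definite descriptions, so each requires an explicit operator:
  matrix entries for the adjoint, and application to rows and then to columns for the tensor
  product. The row and column formulas are also what carries orthogonality and completeness from the
  components of a pair to the pair.\<close>

section \<open>Square-summable families and their inner product\<close>

lemma ell2_summable: "v \<in> ell2 A \<Longrightarrow> (\<lambda>x. (cmod (v x))\<^sup>2) summable_on UNIV"
  by (simp add: ell2_def)

lemma ell2_outside: "v \<in> ell2 A \<Longrightarrow> x \<notin> A \<Longrightarrow> v x = 0"
  by (simp add: ell2_def)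

lemma ell2I: "(\<And>x. x \<notin> A \<Longrightarrow> v x = 0) \<Longrightarrow> (\<lambda>x. (cmod (v x))\<^sup>2) summable_on UNIV \<Longrightarrow> v \<in> ell2 A"
  by (simp add: ell2_def)

lemma ell2_zero: "(\<lambda>x. 0) \<in> ell2 A"
  by (simp add: ell2_def)

lemma ell2_scale: "v \<in> ell2 A \<Longrightarrow> (\<lambda>x. a * v x) \<in> ell2 A"
  by (auto simp: ell2_def norm_mult power_mult_distrib intro: summable_on_cmult_right)

text \<open>Coarse on purpose: it gives summability of a sum by comparison before any norm
  inequality is available.\<close>

lemma cmod_add_sq_le: "(cmod (x + y))\<^sup>2 \<le> 2 * (cmod x)\<^sup>2 + 2 * (cmod y)\<^sup>2"
proof -
  have "(cmod (x + y))\<^sup>2 \<le> (cmod x + cmod y)\<^sup>2"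
    by (intro power_mono norm_triangle_ineq) auto
  also have "\<dots> \<le> 2 * (cmod x)\<^sup>2 + 2 * (cmod y)\<^sup>2"
    using sum_squares_bound[of "cmod x" "cmod y"] by (simp add: power2_sum)
  finally show ?thesis .
qed

lemma ell2_add:
  assumes "v \<in> ell2 A" "w \<in> ell2 A" shows "(\<lambda>x. v x + w x) \<in> ell2 A"
proof (rule ell2I)
  show "(\<lambda>x. (cmod (v x + w x))\<^sup>2) summable_on UNIV"
  proof (rule summable_on_comparison_test)
    show "(\<lambda>x. 2 * (cmod (v x))\<^sup>2 + 2 * (cmod (w x))\<^sup>2) summable_on UNIV"
      by (intro summable_on_add summable_on_cmult_right ell2_summable[OF assms(1)]
          ell2_summable[OF assms(2)])
  qed (auto intro: cmod_add_sq_le)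
qed (use assms in \<open>auto simp: ell2_def\<close>)

lemma ell2_lin: "v \<in> ell2 A \<Longrightarrow> w \<in> ell2 A \<Longrightarrow> (\<lambda>x. a * v x + b * w x) \<in> ell2 A"
  by (intro ell2_add ell2_scale)

lemma ell2_diff: "v \<in> ell2 A \<Longrightarrow> w \<in> ell2 A \<Longrightarrow> (\<lambda>x. v x - w x) \<in> ell2 A"
  using ell2_lin[of v A w 1 "-1"] by simp

lemma ell2_sum:
  assumes "\<And>i. i \<in> I \<Longrightarrow> v i \<in> ell2 A" shows "(\<lambda>x. \<Sum>i\<in>I. v i x) \<in> ell2 A"
  using assms by (induction I rule: infinite_finite_induct) (auto intro: ell2_zero ell2_add)

lemma ell2_mono: "A \<subseteq> B \<Longrightarrow> v \<in> ell2 A \<Longrightarrow> v \<in> ell2 B"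
  by (auto simp: ell2_def)

lemma ell2_ket: "b \<in> A \<Longrightarrow> ket b \<in> ell2 A"
proof (rule ell2I)
  have "(\<lambda>x. (cmod (ket b x))\<^sup>2) summable_on {b}" by simp
  then show "(\<lambda>x. (cmod (ket b x))\<^sup>2) summable_on UNIV"
    by (rule summable_on_cong_neutral[THEN iffD1, rotated -1]) (auto simp: ket_def)
qed (auto simp: ket_def)

text \<open>Pointwise comparison by ab \<le> a^2 + b^2 makes the series of every inner product
  absolutely convergent.\<close>

lemma ell2_inner_abs_summable:
  assumes "v \<in> ell2 A" "w \<in> ell2 B"
  shows "(\<lambda>x. cmod (cnj (v x) * w x)) summable_on UNIV"
proof (rule summable_on_comparison_test)
  show "(\<lambda>x. (cmod (v x))\<^sup>2 + (cmod (w x))\<^sup>2) summable_on UNIV"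
    by (intro summable_on_add ell2_summable[OF assms(1)] ell2_summable[OF assms(2)])
next
  fix x show "cmod (cnj (v x) * w x) \<le> (cmod (v x))\<^sup>2 + (cmod (w x))\<^sup>2"
    using sum_squares_bound[of "cmod (v x)" "cmod (w x)"]
      mult_nonneg_nonneg[OF norm_ge_zero norm_ge_zero, of "v x" "w x"]
    by (simp add: norm_mult del: mult_nonneg_nonneg)
qed auto

lemma ell2_inner_summable:
  "v \<in> ell2 A \<Longrightarrow> w \<in> ell2 B \<Longrightarrow> (\<lambda>x. cnj (v x) * w x) summable_on UNIV"
  by (rule abs_summable_summable[OF ell2_inner_abs_summable])

lemma inner2_add_right:
  "u \<in> ell2 A \<Longrightarrow> v \<in> ell2 B \<Longrightarrow> w \<in> ell2 B
    \<Longrightarrow> inner2 u (\<lambda>x. v x + w x) = inner2 u v + inner2 u w"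
  by (simp add: inner2_def distrib_left infsum_add ell2_inner_summable)

lemma inner2_scale_right: "inner2 u (\<lambda>x. a * v x) = a * inner2 u v"
  by (simp add: inner2_def infsum_cmult_right' mult.left_commute)

lemma inner2_cnj: "inner2 w v = cnj (inner2 v w)"
  by (simp add: inner2_def infsum_cnj[symmetric] mult.commute del: infsum_cnj)

lemma inner2_zero_right [simp]: "inner2 u (\<lambda>x. 0) = 0"
  by (simp add: inner2_def)

lemma inner2_diff_right:
  "u \<in> ell2 A \<Longrightarrow> v \<in> ell2 B \<Longrightarrow> w \<in> ell2 B
    \<Longrightarrow> inner2 u (\<lambda>x. v x - w x) = inner2 u v - inner2 u w"
  using inner2_add_right[of u A v B "\<lambda>x. -1 * w x"] inner2_scale_right[of u "-1" w]
  by (simp add: ell2_scale[of w B "-1", simplified])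

lemma inner2_sum_right:
  assumes "u \<in> ell2 A" "\<And>i. i \<in> I \<Longrightarrow> v i \<in> ell2 B"
  shows "inner2 u (\<lambda>x. \<Sum>i\<in>I. v i x) = (\<Sum>i\<in>I. inner2 u (v i))"
  using assms(2)
proof (induction I rule: infinite_finite_induct)
  case (insert i I)
  then show ?case
    using inner2_add_right[OF assms(1), of "v i" B "\<lambda>x. \<Sum>i\<in>I. v i x"] by (simp add: ell2_sum)
qed auto

lemma inner2_sum_left:
  assumes "u \<in> ell2 A" "\<And>i. i \<in> I \<Longrightarrow> v i \<in> ell2 B"
  shows "inner2 (\<lambda>x. \<Sum>i\<in>I. v i x) u = (\<Sum>i\<in>I. inner2 (v i) u)"
proof -
  have "inner2 (\<lambda>x. \<Sum>i\<in>I. v i x) u = cnj (\<Sum>i\<in>I. inner2 u (v i))"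
    using inner2_sum_right[of u A I v B, OF assms] inner2_cnj[of "\<lambda>x. \<Sum>i\<in>I. v i x" u] by simp
  also have "\<dots> = (\<Sum>i\<in>I. inner2 (v i) u)"
    unfolding cnj_sum by (intro sum.cong refl inner2_cnj[symmetric])
  finally show ?thesis .
qed

lemma inner2_scale_left: "inner2 (\<lambda>x. a * v x) u = cnj a * inner2 v u"
  unfolding inner2_cnj[of _ u] inner2_scale_right complex_cnj_mult ..

lemma norm2_sq: "(norm2 v)\<^sup>2 = (\<Sum>\<^sub>\<infinity>x. (cmod (v x))\<^sup>2)"
  by (simp add: norm2_def infsum_nonneg)

lemma norm2_nonneg [simp]: "0 \<le> norm2 v"
  by (simp add: norm2_def infsum_nonneg)

lemma inner2_self:
  assumes "v \<in> ell2 A" shows "inner2 v v = of_real ((norm2 v)\<^sup>2)"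
proof -
  have "inner2 v v = (\<Sum>\<^sub>\<infinity>x. of_real ((cmod (v x))\<^sup>2))"
    unfolding inner2_def by (rule infsum_cong) (metis complex_norm_square mult.commute)
  also have "\<dots> = of_real (\<Sum>\<^sub>\<infinity>x. (cmod (v x))\<^sup>2)"
    using has_sum_bounded_linear[OF bounded_linear_of_real has_sum_infsum[OF ell2_summable[OF assms]]]
    by (intro infsumI) simp
  finally show ?thesis by (simp only: norm2_sq)
qed

lemma norm2_scale: "norm2 (\<lambda>x. a * v x) = cmod a * norm2 v"
proof -
  have "(norm2 (\<lambda>x. a * v x))\<^sup>2 = (cmod a * norm2 v)\<^sup>2"
    by (simp add: norm2_sq norm_mult power_mult_distrib infsum_cmult_right')
  then show ?thesis by (simp add: power2_eq_iff_nonneg)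
qed

lemma inner2_ket_left: "inner2 (ket x) w = w x"
proof -
  have "inner2 (ket x) w = (\<Sum>\<^sub>\<infinity>y\<in>{x}. w y)"
    unfolding inner2_def by (rule infsum_cong_neutral) (auto simp: ket_def)
  then show ?thesis by simp
qed

lemma norm2_ket [simp]: "norm2 (ket x) = 1"
proof -
  have "complex_of_real ((norm2 (ket x))\<^sup>2) = 1"
    by (simp only: inner2_self[OF ell2_ket[OF UNIV_I], symmetric] inner2_ket_left) (simp add: ket_def)
  then have "(norm2 (ket x))\<^sup>2 = 1"
    by (simp only: of_real_eq_1_iff)
  then show ?thesis
    using norm2_nonneg[of "ket x"] unfolding power2_eq_1_iff by linarith
qed

lemma norm2_eq_0:
  assumes "v \<in> ell2 A" "norm2 v = 0" shows "v = (\<lambda>x. 0)"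
proof -
  have "(\<Sum>\<^sub>\<infinity>x. (cmod (v x))\<^sup>2) = 0" using assms(2) norm2_sq[of v] by simp
  from nonneg_infsum_le_0D[OF _ ell2_summable[OF assms(1)]] this
  have "(cmod (v x))\<^sup>2 = 0" for x by simp
  then show ?thesis by auto
qed

text \<open>Subtracting from \<open>w\<close> its component along \<open>v\<close> leaves
  \<open>z\<close> orthogonal to \<open>v\<close>; the inequality is nonnegativity of the squared
  norm of \<open>z\<close>.\<close>

lemma inner2_Cauchy_Schwarz:
  assumes v: "v \<in> ell2 A" and w: "w \<in> ell2 A"
  shows "cmod (inner2 v w) \<le> norm2 v * norm2 w"
proof (cases "norm2 v = 0")
  case True
  then have "v = (\<lambda>x. 0)" by (rule norm2_eq_0[OF v])
  then show ?thesis by (simp add: inner2_def)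
next
  case False
  define c where "c = inner2 v w / (norm2 v)\<^sup>2"
  define z where "z = (\<lambda>x. w x - c * v x)"
  have z: "z \<in> ell2 A" unfolding z_def by (intro ell2_diff ell2_scale v w)
  have vz: "inner2 v z = 0"
    unfolding z_def inner2_diff_right[OF v w ell2_scale[OF v]] inner2_scale_right inner2_self[OF v] c_def
    using False by simp
  have "inner2 z z = inner2 z w"
    using inner2_diff_right[OF z w ell2_scale[OF v, of c]] vz inner2_cnj[of z v]
    by (simp add: z_def[symmetric] inner2_scale_right)
  also have "\<dots> = cnj (inner2 w z)" by (rule inner2_cnj)
  also have "inner2 w z = inner2 w w - c * inner2 w v"
    unfolding z_def inner2_diff_right[OF w w ell2_scale[OF v]] inner2_scale_right ..
  also have "inner2 w v = cnj (inner2 v w)" by (rule inner2_cnj)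
  finally have "inner2 z z = cnj (inner2 w w - c * cnj (inner2 v w))" .
  moreover have "c * cnj (inner2 v w) = of_real ((cmod (inner2 v w))\<^sup>2 / (norm2 v)\<^sup>2)"
    by (simp add: c_def complex_norm_square del: of_real_power) 
  ultimately have "complex_of_real ((norm2 z)\<^sup>2)
      = of_real ((norm2 w)\<^sup>2 - (cmod (inner2 v w))\<^sup>2 / (norm2 v)\<^sup>2)"
    by (simp add: inner2_self[OF z] inner2_self[OF w])
  then have "(norm2 z)\<^sup>2 = (norm2 w)\<^sup>2 - (cmod (inner2 v w))\<^sup>2 / (norm2 v)\<^sup>2"
    using of_real_eq_iff by blast
  then have "(cmod (inner2 v w))\<^sup>2 / (norm2 v)\<^sup>2 \<le> (norm2 w)\<^sup>2"
    by (smt (verit) zero_le_power2)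
  then have "(cmod (inner2 v w))\<^sup>2 \<le> (norm2 v * norm2 w)\<^sup>2"
    using False by (simp add: divide_le_eq power_mult_distrib mult.commute)
  then show ?thesis by (rule power2_le_imp_le) simp
qed

text \<open>A coordinate is the inner product with a unit vector. Thus evaluation at a point is a
  bounded functional, and equalities of operators can be checked one coordinate at a time.\<close>

lemma ell2_eval_le_norm2: "v \<in> ell2 A \<Longrightarrow> cmod (v x) \<le> norm2 v"
  using inner2_Cauchy_Schwarz[OF ell2_ket[OF UNIV_I] ell2_mono[OF subset_UNIV], of v A x]
  by (simp add: inner2_ket_left)

lemma ell2_eqI:
  assumes "v \<in> ell2 A" "w \<in> ell2 A"
    and "\<And>u. u \<in> ell2 A \<Longrightarrow> inner2 u v = inner2 u w"
  shows "v = w"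
proof
  fix x show "v x = w x"
    using ell2_outside[OF assms(1), of x] ell2_outside[OF assms(2), of x] assms(3)[OF ell2_ket, of x]
    by (cases "x \<in> A") (auto simp: inner2_ket_left)
qed


section \<open>Density of the basis vectors\<close>

text \<open>Truncations of \<open>v\<close> to finite sets are combinations of kets, and the
  remainders become arbitrarily small in norm. This density argument supports both the adjoint and
  the uniqueness of tensor products.\<close>

lemma ket_functional_zero:
  assumes v: "v \<in> ell2 A"
    and lin: "\<And>v w a b. v \<in> ell2 A \<Longrightarrow> w \<in> ell2 A
          \<Longrightarrow> \<phi> (\<lambda>x. a * v x + b * w x) = a * \<phi> v + b * (\<phi> w :: complex)"
    and bd: "\<And>v. v \<in> ell2 A \<Longrightarrow> cmod (\<phi> v) \<le> C * norm2 v"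
    and ket: "\<And>x. x \<in> A \<Longrightarrow> \<phi> (ket x) = 0"
  shows "\<phi> v = 0"
proof (rule ccontr)
  assume nz: "\<phi> v \<noteq> 0"
  define tr where "tr F = (\<lambda>x. if x \<in> F then v x else 0)" for F
  have tr_in: "tr F \<in> ell2 A" for F
  proof (rule ell2I)
    show "(\<lambda>x. (cmod (tr F x))\<^sup>2) summable_on UNIV"
      by (rule summable_on_comparison_test[OF ell2_summable[OF v]]) (auto simp: tr_def)
  qed (use ell2_outside[OF v] in \<open>auto simp: tr_def\<close>)
  have tr0: "\<phi> (tr F) = 0" if "finite F" for F
    using that
  proof (induction F)
    case empty
    then show ?case using lin[OF v v, of 0 0] by (simp add: tr_def)
  next
    case (insert x F)
    show ?case
    proof (cases "x \<in> A")
      case True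
      have "tr (insert x F) = (\<lambda>y. v x * ket x y + 1 * tr F y)"
        using insert.hyps by (auto simp: tr_def ket_def)
      then show ?thesis
        using lin[OF ell2_ket[OF True] tr_in, of "v x" 1 F] insert.IH ket[OF True] by simp
    next
      case False
      then have "tr (insert x F) = tr F"
        using ell2_outside[OF v] by (auto simp: tr_def)
      then show ?thesis using insert.IH by simp
    qed
  qed
  \<comment> \<open>\<open>C'\<close> is a positive bound, so it can be divided by. A remainder
    \<open>r\<close> with squared norm below \<open>e\<close> would satisfy C' * norm2 r < |\<phi>
    v|, although \<phi> takes the same value at \<open>r\<close> and at \<open>v\<close>.\<close>
  define C' where "C' = max C 1"
  have C': "C' > 0" "C \<le> C'" by (auto simp: C'_def)
  define e where "e = (cmod (\<phi> v) / C')\<^sup>2"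
  have e: "e > 0" using nz C' by (simp add: e_def)
  have "((\<lambda>F. \<Sum>x\<in>F. (cmod (v x))\<^sup>2) \<longlongrightarrow> (norm2 v)\<^sup>2) (finite_subsets_at_top UNIV)"
    using has_sum_infsum[OF ell2_summable[OF v]] by (simp add: has_sum_def norm2_sq)
  from tendstoD[OF this e]
  obtain F where F: "finite F" "dist (\<Sum>x\<in>F. (cmod (v x))\<^sup>2) ((norm2 v)\<^sup>2) < e"
    by (auto simp: eventually_finite_subsets_at_top)
  define r where "r = (\<lambda>x. v x - tr F x)"
  have r: "r \<in> ell2 A" unfolding r_def by (intro ell2_diff v tr_in)
  have "(norm2 v)\<^sup>2 = (\<Sum>\<^sub>\<infinity>x\<in>F. (cmod (v x))\<^sup>2) + (\<Sum>\<^sub>\<infinity>x\<in>-F. (cmod (v x))\<^sup>2)"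
    unfolding norm2_sq
    using infsum_Un_disjoint[of "\<lambda>x. (cmod (v x))\<^sup>2" F "-F"] F(1)
      summable_on_subset_banach[OF ell2_summable[OF v], of "-F"] by (simp add: Un_commute)
  moreover have "(\<Sum>\<^sub>\<infinity>x\<in>-F. (cmod (v x))\<^sup>2) = (norm2 r)\<^sup>2"
    unfolding norm2_sq by (rule infsum_cong_neutral) (auto simp: r_def tr_def)
  ultimately have rn: "(norm2 r)\<^sup>2 < e"
    using F by (simp add: dist_real_def)
  have "\<phi> r = \<phi> v"
    using lin[OF v tr_in, of 1 "-1" F] tr0[OF F(1)] by (simp add: r_def)
  then have "cmod (\<phi> v) \<le> C * norm2 r" using bd[OF r] by simp
  also have "\<dots> \<le> C' * norm2 r" by (intro mult_right_mono C' norm2_nonneg)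
  finally have "cmod (\<phi> v) / C' \<le> norm2 r" using C' by (simp add: divide_le_eq mult.commute)
  then have "e \<le> (norm2 r)\<^sup>2" unfolding e_def using C' by (intro power_mono) auto
  with rn show False by simp
qed

subsection \<open>Bounded operators\<close>

lemma bopI:
  assumes "f \<in> H \<rightarrow>\<^sub>E K"
    and "\<And>v w a b. v \<in> H \<Longrightarrow> w \<in> H \<Longrightarrow> f (\<lambda>x. a * v x + b * w x) = (\<lambda>y. a * f v y + b * f w y)"
    and "\<And>v. v \<in> H \<Longrightarrow> norm2 (f v) \<le> C * norm2 v"
  shows "f \<in> bop H K"
  using assms unfolding bop_def by blast

lemma bop_in: "f \<in> bop H K \<Longrightarrow> v \<in> H \<Longrightarrow> f v \<in> K"
  unfolding bop_def by auto

lemma bop_lin: "f \<in> bop H K \<Longrightarrow> v \<in> H \<Longrightarrow> w \<in> H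
    \<Longrightarrow> f (\<lambda>x. a * v x + b * w x) = (\<lambda>y. a * f v y + b * f w y)"
  unfolding bop_def by blast

lemma bop_bound:
  assumes "f \<in> bop H K"
  obtains C where "C \<ge> 0" "\<And>v. v \<in> H \<Longrightarrow> norm2 (f v) \<le> C * norm2 v"
proof -
  obtain C where C: "\<And>v. v \<in> H \<Longrightarrow> norm2 (f v) \<le> C * norm2 v"
    using assms unfolding bop_def by blast
  have "norm2 (f v) \<le> max C 0 * norm2 v" if "v \<in> H" for v
    using C[OF that] mult_right_mono[of C "max C 0" "norm2 v"] by simp
  then show ?thesis using that[of "max C 0"] by simp
qed

lemma bop_extensional: "f \<in> bop H K \<Longrightarrow> f \<in> extensional H"
  unfolding bop_def by (auto simp: PiE_def)

lemma bop_eqI: "f \<in> bop H K \<Longrightarrow> g \<in> bop H K \<Longrightarrow> (\<And>v. v \<in> H \<Longrightarrow> f v = g v) \<Longrightarrow> f = g"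
  by (meson bop_extensional extensionalityI)

lemma bop_scale: "f \<in> bop (ell2 A) K \<Longrightarrow> v \<in> ell2 A \<Longrightarrow> f (\<lambda>x. a * v x) = (\<lambda>y. a * f v y)"
  using bop_lin[of f "ell2 A" K v v a 0] by simp

lemma bop_add:
  "f \<in> bop (ell2 A) K \<Longrightarrow> v \<in> ell2 A \<Longrightarrow> w \<in> ell2 A
    \<Longrightarrow> f (\<lambda>x. v x + w x) = (\<lambda>y. f v y + f w y)"
  using bop_lin[of f "ell2 A" K v w 1 1] by simp

lemma bop_zero: "f \<in> bop (ell2 A) K \<Longrightarrow> f (\<lambda>x. 0) = (\<lambda>y. 0)"
  using bop_scale[of f A K "\<lambda>x. 0" 0] ell2_zero by auto

lemma bop_sum:
  assumes f: "f \<in> bop (ell2 A) K" and v: "\<And>i. i \<in> I \<Longrightarrow> v i \<in> ell2 A"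
  shows "f (\<lambda>x. \<Sum>i\<in>I. v i x) = (\<lambda>y. \<Sum>i\<in>I. f (v i) y)"
  using v
  by (induction I rule: infinite_finite_induct) (auto simp: bop_zero[OF f] bop_add[OF f] ell2_sum)

lemma bop_compose:
  assumes f: "f \<in> bop (ell2 A) K" and g: "g \<in> bop K L"
  shows "compose (ell2 A) g f \<in> bop (ell2 A) L"
proof -
  obtain C where C: "C \<ge> 0" "\<And>v. v \<in> ell2 A \<Longrightarrow> norm2 (f v) \<le> C * norm2 v" using bop_bound[OF f] by blast
  obtain D where D: "D \<ge> 0" "\<And>v. v \<in> K \<Longrightarrow> norm2 (g v) \<le> D * norm2 v" using bop_bound[OF g] by blast
  show ?thesis
  proof (rule bopI)
    show "compose (ell2 A) g f \<in> ell2 A \<rightarrow>\<^sub>E L" using bop_in[OF f] bop_in[OF g] by (auto simp: compose_def)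
    fix v assume v: "v \<in> ell2 A"
    have "norm2 (g (f v)) \<le> D * norm2 (f v)" using D bop_in[OF f v] by simp
    also have "\<dots> \<le> D * (C * norm2 v)" using C v D by (intro mult_left_mono) auto
    finally show "norm2 (compose (ell2 A) g f v) \<le> D * C * norm2 v" using v by (simp add: compose_eq mult.assoc)
  qed (simp_all add: compose_eq bop_lin[OF f] bop_lin[OF g] bop_in[OF f] ell2_lin)
qed

subsection \<open>Adjoints\<close>

text \<open>The candidate is given by its matrix entries in the ket basis. It remains to see that
  its values are square-summable and that the adjoint equation extends from kets to all
  vectors.\<close>

lemma ex_adjoint:
  assumes f: "f \<in> bop (ell2 A) (ell2 B)"
  shows "\<exists>g. g \<in> bop (ell2 B) (ell2 A) \<and>
    (\<forall>v\<in>ell2 A. \<forall>w\<in>ell2 B. inner2 (f v) w = inner2 v (g w))"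
proof -
  obtain C where C: "C \<ge> 0" "\<And>v. v \<in> ell2 A \<Longrightarrow> norm2 (f v) \<le> C * norm2 v"
    using bop_bound[OF f] by blast
  define g where "g = (\<lambda>w\<in>ell2 B. \<lambda>x. if x \<in> A then inner2 (f (ket x)) w else 0)"
  \<comment> \<open>Duality: for the truncation \<open>u\<close> of \<open>g w\<close> to a finite
    set, the squared norm of \<open>u\<close> equals the inner product of \<open>f u\<close> and
    \<open>w\<close>, hence is at most C * norm2 u * norm2 w, and one factor \<open>norm2 u\<close>
    cancels.\<close>
  have bd: "(\<Sum>x\<in>F. (cmod (g w x))\<^sup>2) \<le> (C * norm2 w)\<^sup>2" if w: "w \<in> ell2 B" and F: "finite F" for w F
  proof -
    define S where "S = (\<Sum>x\<in>F \<inter> A. (cmod (g w x))\<^sup>2)"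
    define u where "u = (\<lambda>x. \<Sum>y\<in>F \<inter> A. g w y * ket y x)"
    have S0: "S \<ge> 0" by (simp add: S_def sum_nonneg)
    have k: "(\<lambda>x. g w y * ket y x) \<in> ell2 A" if "y \<in> F \<inter> A" for y
      using that by (intro ell2_scale ell2_ket) auto
    have u: "u \<in> ell2 A" unfolding u_def by (intro ell2_sum k)
    have u_at: "u y = g w y" if "y \<in> F \<inter> A" for y
    proof -
      have "u y = (\<Sum>z\<in>F \<inter> A. if y = z then g w z else 0)"
        unfolding u_def by (rule sum.cong) (auto simp: ket_def)
      then show ?thesis using F that by simp
    qed
    have sq: "cnj z * z = of_real ((cmod z)\<^sup>2)" for z
      by (metis complex_norm_square mult.commute)
    have "inner2 u u = (\<Sum>y\<in>F \<inter> A. inner2 (\<lambda>x. g w y * ket y x) u)"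
      using inner2_sum_left[OF u k] by (simp only: u_def)
    also have "\<dots> = (\<Sum>y\<in>F \<inter> A. of_real ((cmod (g w y))\<^sup>2))"
      unfolding inner2_scale_left inner2_ket_left by (intro sum.cong refl) (simp only: u_at sq)
    also have "\<dots> = of_real S" unfolding S_def by simp
    finally have nu: "(norm2 u)\<^sup>2 = S"
      unfolding inner2_self[OF u] by (simp only: of_real_eq_iff)
    have "f u = (\<lambda>x. \<Sum>y\<in>F \<inter> A. f (\<lambda>x. g w y * ket y x) x)"
      unfolding u_def by (rule bop_sum[OF f k])
    also have "\<dots> = (\<lambda>x. \<Sum>y\<in>F \<inter> A. g w y * f (ket y) x)"
      by (intro ext sum.cong refl) (auto simp: bop_scale[OF f ell2_ket])
    finally have "f u = (\<lambda>x. \<Sum>y\<in>F \<inter> A. g w y * f (ket y) x)" .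
    then have "inner2 (f u) w = (\<Sum>y\<in>F \<inter> A. inner2 (\<lambda>x. g w y * f (ket y) x) w)"
      using inner2_sum_left[of w B "F \<inter> A" "\<lambda>y x. g w y * f (ket y) x" B, OF w]
      by (simp add: ell2_scale[OF bop_in[OF f ell2_ket]])
    also have "\<dots> = (\<Sum>y\<in>F \<inter> A. of_real ((cmod (g w y))\<^sup>2))"
    proof (intro sum.cong refl)
      fix y assume "y \<in> F \<inter> A"
      then have "inner2 (f (ket y)) w = g w y" using w by (simp add: g_def)
      then show "inner2 (\<lambda>x. g w y * f (ket y) x) w = of_real ((cmod (g w y))\<^sup>2)"
        unfolding inner2_scale_left by (simp only: sq)
    qed
    also have "\<dots> = of_real S" unfolding S_def by simp
    finally have "S = cmod (inner2 (f u) w)" using S0 by simp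
    also have "\<dots> \<le> norm2 (f u) * norm2 w" by (rule inner2_Cauchy_Schwarz[OF bop_in[OF f u] w])
    also have "\<dots> \<le> C * norm2 u * norm2 w" by (intro mult_right_mono C u) simp
    finally have le: "norm2 u * norm2 u \<le> norm2 u * (C * norm2 w)"
      using nu by (simp add: power2_eq_square mult_ac)
    have "norm2 u \<le> C * norm2 w"
    proof (cases "norm2 u = 0")
      case False
      then have "norm2 u > 0" using norm2_nonneg[of u] by linarith
      then show ?thesis using le mult_le_cancel_left_pos by blast
    qed (use C in simp)
    then have "S \<le> (C * norm2 w)\<^sup>2" unfolding nu[symmetric] by (intro power_mono) auto
    moreover have "(\<Sum>x\<in>F. (cmod (g w x))\<^sup>2) = S"
      unfolding S_def using F w by (intro sum.mono_neutral_right) (auto simp: g_def)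
    ultimately show ?thesis by simp
  qed
  have summ: "(\<lambda>x. (cmod (g w x))\<^sup>2) summable_on UNIV" if w: "w \<in> ell2 B" for w
    by (rule nonneg_bdd_above_summable_on) (use bd[OF w] in \<open>auto intro!: bdd_aboveI\<close>)
  have g_in: "g w \<in> ell2 A" if w: "w \<in> ell2 B" for w
    by (rule ell2I[OF _ summ[OF w]]) (use w in \<open>simp add: g_def\<close>)
  have g: "g \<in> bop (ell2 B) (ell2 A)"
  proof (rule bopI)
    show "g \<in> ell2 B \<rightarrow>\<^sub>E ell2 A"
      using g_in by (auto simp: g_def)
    fix v w a b assume v: "v \<in> ell2 B" and w: "w \<in> ell2 B"
    show "g (\<lambda>x. a * v x + b * w x) = (\<lambda>y. a * g v y + b * g w y)"
      using v w ell2_lin[OF v w]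
      by (auto simp: g_def fun_eq_iff inner2_scale_right
          inner2_add_right[OF bop_in[OF f ell2_ket] ell2_scale ell2_scale])
  next
    fix w assume w: "w \<in> ell2 B"
    have "(norm2 (g w))\<^sup>2 \<le> (C * norm2 w)\<^sup>2"
      unfolding norm2_sq[of "g w"] by (rule infsum_le_finite_sums[OF summ[OF w] bd[OF w]])
    then show "norm2 (g w) \<le> C * norm2 w"
      by (rule power2_le_imp_le) (simp add: C)
  qed
  have "inner2 (f v) w = inner2 v (g w)" if v: "v \<in> ell2 A" and w: "w \<in> ell2 B" for v w
  proof -
    \<comment> \<open>Both inner products are flipped, since \<open>inner2\<close> is linear only in
      its second argument and \<open>ket_functional_zero\<close> asks for a linear functional of
      \<open>v\<close>.\<close>
    have "inner2 w (f v) - inner2 (g w) v = 0"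
    proof (rule ket_functional_zero[OF v, where \<phi> = "\<lambda>v. inner2 w (f v) - inner2 (g w) v"])
      fix v v' a b assume v: "v \<in> ell2 A" and v': "v' \<in> ell2 A"
      show "inner2 w (f (\<lambda>x. a * v x + b * v' x)) - inner2 (g w) (\<lambda>x. a * v x + b * v' x)
        = a * (inner2 w (f v) - inner2 (g w) v) + b * (inner2 w (f v') - inner2 (g w) v')"
        unfolding bop_lin[OF f v v'] inner2_scale_right
          inner2_add_right[OF w ell2_scale[OF bop_in[OF f v]] ell2_scale[OF bop_in[OF f v']]]
          inner2_add_right[OF g_in[OF w] ell2_scale[OF v] ell2_scale[OF v']]
        by (simp add: algebra_simps)
    next
      fix v assume v: "v \<in> ell2 A"
      have "cmod (inner2 w (f v)) \<le> norm2 w * (C * norm2 v)"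
        using inner2_Cauchy_Schwarz[OF w bop_in[OF f v]] mult_left_mono[OF C(2)[OF v], of "norm2 w"]
        by simp
      then show "cmod (inner2 w (f v) - inner2 (g w) v) \<le> (norm2 w * C + norm2 (g w)) * norm2 v"
        using norm_triangle_ineq4[of "inner2 w (f v)" "inner2 (g w) v"]
          inner2_Cauchy_Schwarz[OF g_in[OF w] v] by (simp add: distrib_right mult.assoc)
    next
      fix x assume "x \<in> A"
      then have "inner2 (f (ket x)) w = inner2 (ket x) (g w)"
        using w by (simp add: inner2_ket_left g_def)
      then show "inner2 w (f (ket x)) - inner2 (g w) (ket x) = 0"
        unfolding inner2_cnj[of w "f (ket x)"] inner2_cnj[of "g w" "ket x"] by simp
    qed
    then show ?thesis
      unfolding inner2_cnj[of w "f v"] inner2_cnj[of "g w" v] by simp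
  qed
  with g show ?thesis by blast
qed

text \<open>The description in \<open>adj\<close> denotes: existence is \<open>ex_adjoint\<close>,
  and uniqueness holds because a vector is determined by its inner products.\<close>

lemma adj_properties:
  assumes f: "f \<in> bop (ell2 A) (ell2 B)"
  shows adj_bop: "adj (ell2 A) (ell2 B) f \<in> bop (ell2 B) (ell2 A)"
    and adj_inner: "\<And>v w. v \<in> ell2 A \<Longrightarrow> w \<in> ell2 B
      \<Longrightarrow> inner2 v (adj (ell2 A) (ell2 B) f w) = inner2 (f v) w"
proof -
  let ?P = "\<lambda>g. g \<in> bop (ell2 B) (ell2 A) \<and>
    (\<forall>v\<in>ell2 A. \<forall>w\<in>ell2 B. inner2 (f v) w = inner2 v (g w))"
  have "\<exists>!g. ?P g"
  proof (rule ex_ex1I[OF ex_adjoint[OF f]])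
    fix g g' assume g: "?P g" and g': "?P g'"
    show "g = g'"
    proof (rule bop_eqI)
      fix w assume w: "w \<in> ell2 B"
      show "g w = g' w"
        by (rule ell2_eqI[of _ A]) (use g g' w in \<open>auto simp: bop_in\<close>)
    qed (use g g' in auto)
  qed
  from theI'[OF this] have *: "?P (adj (ell2 A) (ell2 B) f)" unfolding adj_def .
  then show "adj (ell2 A) (ell2 B) f \<in> bop (ell2 B) (ell2 A)" by blast
  fix v w assume "v \<in> ell2 A" "w \<in> ell2 B"
  with * show "inner2 v (adj (ell2 A) (ell2 B) f w) = inner2 (f v) w" by simp
qed

lemma adj_eqI:
  assumes "f \<in> bop (ell2 A) (ell2 B)" "w \<in> ell2 B" "u \<in> ell2 A"
    and "\<And>v. v \<in> ell2 A \<Longrightarrow> inner2 (f v) w = inner2 v u"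
  shows "adj (ell2 A) (ell2 B) f w = u"
  by (rule ell2_eqI[of _ A])
     (use assms in \<open>auto simp: adj_inner intro: bop_in[OF adj_bop]\<close>)


subsection \<open>Isometries and unitaries\<close>

text \<open>Norm preservation is used throughout because it passes through composition and sums by
  direct computation; \<open>isom_isometry_op\<close> returns to the formulation with the
  adjoint.\<close>

definition isom ::
  "('a \<Rightarrow> complex) set \<Rightarrow> ('b \<Rightarrow> complex) set \<Rightarrow> (('a \<Rightarrow> complex) \<Rightarrow> ('b \<Rightarrow> complex)) \<Rightarrow> bool" where
  "isom H K f \<longleftrightarrow> f \<in> bop H K \<and> (\<forall>v\<in>H. norm2 (f v) = norm2 v)"

text \<open>For a surjective isometry the adjoint is a two-sided inverse, by \<open>isom_adj\<close>
  and \<open>unitary_op_adj_right\<close>.\<close>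

definition unitary_op ::
  "('a \<Rightarrow> complex) set \<Rightarrow> ('b \<Rightarrow> complex) set \<Rightarrow> (('a \<Rightarrow> complex) \<Rightarrow> ('b \<Rightarrow> complex)) \<Rightarrow> bool" where
  "unitary_op H K f \<longleftrightarrow> isom H K f \<and> K \<subseteq> f ` H"

lemma isom_bop: "isom H K f \<Longrightarrow> f \<in> bop H K"
  by (simp add: isom_def)

lemma isom_norm: "isom H K f \<Longrightarrow> v \<in> H \<Longrightarrow> norm2 (f v) = norm2 v"
  by (simp add: isom_def)

lemma isomI:
  assumes "f \<in> H \<rightarrow>\<^sub>E K"
    and "\<And>v w a b. v \<in> H \<Longrightarrow> w \<in> H \<Longrightarrow> f (\<lambda>x. a * v x + b * w x) = (\<lambda>y. a * f v y + b * f w y)"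
    and "\<And>v. v \<in> H \<Longrightarrow> norm2 (f v) = norm2 v"
  shows "isom H K f"
  unfolding isom_def using assms bopI[of f H K 1] by simp

lemma isom_compose: "isom (ell2 A) K f \<Longrightarrow> isom K L g \<Longrightarrow> isom (ell2 A) L (compose (ell2 A) g f)"
  unfolding isom_def by (auto intro: bop_compose simp: compose_eq bop_in)

text \<open>The expansion behind polarisation and Pythagoras. The literal factor 1 keeps the shape
  in which \<open>bop_lin\<close> rewrites.\<close>

lemma norm2_sq_add_scaled:
  assumes v: "v \<in> ell2 A" and w: "w \<in> ell2 A"
  shows "(norm2 (\<lambda>x. 1 * v x + a * w x))\<^sup>2
    = (norm2 v)\<^sup>2 + (cmod a)\<^sup>2 * (norm2 w)\<^sup>2 + 2 * Re (a * inner2 v w)"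
proof -
  have aw: "(\<lambda>x. a * w x) \<in> ell2 A" by (intro ell2_scale w)
  let ?z = "\<lambda>x. v x + a * w x"
  have z: "?z \<in> ell2 A" by (intro ell2_add v aw)
  have "inner2 ?z ?z = inner2 ?z v + a * inner2 ?z w"
    unfolding inner2_add_right[OF z v aw] inner2_scale_right ..
  also have "inner2 ?z v = cnj (inner2 v v + a * inner2 v w)"
    unfolding inner2_cnj[of ?z] inner2_add_right[OF v v aw] inner2_scale_right ..
  also have "inner2 ?z w = cnj (inner2 w v + a * inner2 w w)"
    unfolding inner2_cnj[of ?z] inner2_add_right[OF w v aw] inner2_scale_right ..
  also have "inner2 w v = cnj (inner2 v w)" by (rule inner2_cnj)
  finally have "inner2 ?z ?z
      = inner2 v v + cnj (a * inner2 v w) + a * inner2 v w + a * cnj a * inner2 w w"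
    unfolding inner2_self[OF v] inner2_self[OF w] by (simp add: algebra_simps)
  then have "Re (inner2 ?z ?z) = Re (inner2 v v + cnj (a * inner2 v w) + a * inner2 v w
      + a * cnj a * inner2 w w)" by simp
  then show ?thesis
    unfolding inner2_self[OF v] inner2_self[OF w] inner2_self[OF z] complex_norm_square[symmetric]
    by (simp flip: of_real_power of_real_mult)
qed

text \<open>Polarisation: comparing the norms of v + a w before and after \<open>f\<close> for all
  scalars \<open>a\<close> fixes the real part of every multiple of the inner product.\<close>

lemma isom_inner:
  assumes f: "isom (ell2 A) (ell2 B) f" and v: "v \<in> ell2 A" and w: "w \<in> ell2 A"
  shows "inner2 (f v) (f w) = inner2 v w"
proof -
  note b = isom_bop[OF f]
  have *: "Re (a * inner2 (f v) (f w)) = Re (a * inner2 v w)" for a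
  proof -
    have "norm2 (\<lambda>x. 1 * f v x + a * f w x) = norm2 (\<lambda>x. 1 * v x + a * w x)"
      unfolding bop_lin[OF b v w, symmetric] by (rule isom_norm[OF f ell2_lin[OF v w]])
    then have "(norm2 (\<lambda>x. 1 * f v x + a * f w x))\<^sup>2 = (norm2 (\<lambda>x. 1 * v x + a * w x))\<^sup>2" by (rule arg_cong)
    then show ?thesis
      unfolding norm2_sq_add_scaled[OF v w] norm2_sq_add_scaled[OF bop_in[OF b v] bop_in[OF b w]]
        isom_norm[OF f v] isom_norm[OF f w] by simp
  qed
  \<comment> \<open>The scalar 1 gives the real part, and Re (-\<i> z) = Im z gives the imaginary
    part.\<close>
  show ?thesis using *[of 1] *[of "-\<i>"] by (simp add: complex_eq_iff)
qed

lemma isom_adj: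
  assumes f: "isom (ell2 A) (ell2 B) f" and v: "v \<in> ell2 A"
  shows "adj (ell2 A) (ell2 B) f (f v) = v"
  by (rule adj_eqI) (use assms in \<open>auto simp: isom_inner isom_bop intro: bop_in[OF isom_bop]\<close>)

lemma isom_isometry_op:
  assumes f: "isom (ell2 A) (ell2 B) f"
  shows "isometry_op (ell2 A) (ell2 B) f"
  unfolding isometry_op_def
  using isom_bop[OF f] isom_adj[OF f] by (auto simp: compose_def fun_eq_iff)

lemma unitary_op_isom: "unitary_op H K f \<Longrightarrow> isom H K f"
  by (simp add: unitary_op_def)

lemma unitary_op_surj: "unitary_op H K f \<Longrightarrow> w \<in> K \<Longrightarrow> \<exists>v\<in>H. w = f v"
  by (auto simp: unitary_op_def)

lemma unitary_op_adj_right: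
  assumes f: "unitary_op (ell2 A) (ell2 B) f" and w: "w \<in> ell2 B"
  shows "f (adj (ell2 A) (ell2 B) f w) = w"
  using unitary_op_surj[OF f w] isom_adj[OF unitary_op_isom[OF f]] by auto

lemma unitary_op_adj:
  assumes f: "unitary_op (ell2 A) (ell2 B) f"
  shows "unitary_op (ell2 B) (ell2 A) (adj (ell2 A) (ell2 B) f)"
proof -
  note i = unitary_op_isom[OF f]
  have "norm2 (adj (ell2 A) (ell2 B) f w) = norm2 w" if w: "w \<in> ell2 B" for w
    using isom_norm[OF i bop_in[OF adj_bop[OF isom_bop[OF i]] w]] unitary_op_adj_right[OF f w] by simp
  moreover have "v \<in> adj (ell2 A) (ell2 B) f ` ell2 B" if v: "v \<in> ell2 A" for v
    using isom_adj[OF i v] bop_in[OF isom_bop[OF i] v] by (metis imageI)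
  ultimately show ?thesis
    unfolding unitary_op_def isom_def using adj_bop[OF isom_bop[OF i]] by auto
qed

lemma unitary_op_compose:
  assumes f: "unitary_op (ell2 A) K f" and g: "unitary_op K L g"
  shows "unitary_op (ell2 A) L (compose (ell2 A) g f)"
proof -
  have "w \<in> compose (ell2 A) g f ` ell2 A" if w: "w \<in> L" for w
  proof -
    obtain u where u: "u \<in> K" "w = g u" using unitary_op_surj[OF g w] by blast
    obtain v where v: "v \<in> ell2 A" "u = f v" using unitary_op_surj[OF f u(1)] by blast
    show ?thesis using u v by (auto simp: compose_eq intro!: rev_image_eqI)
  qed
  then show ?thesis using isom_compose[OF unitary_op_isom[OF f] unitary_op_isom[OF g]]
    by (auto simp: unitary_op_def)
qed


subsection \<open>Square-summable families on products\<close>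

lemma ell2_prodI:
  assumes W: "\<And>a. (\<lambda>c. W (a, c)) \<in> ell2 C" and out: "\<And>a c. a \<notin> A \<Longrightarrow> W (a, c) = 0"
    and s: "(\<lambda>a. (norm2 (\<lambda>c. W (a, c)))\<^sup>2) summable_on UNIV"
  shows "W \<in> ell2 (A \<times> C)"
proof (rule ell2I)
  \<comment> \<open>Tonelli for the squared moduli. The outer \<open>norm\<close> of a nonnegative
    number only matches the form of the criterion for absolute summability on a product.\<close>
  have "(\<lambda>p. norm ((cmod (W p))\<^sup>2)) summable_on (UNIV \<times> UNIV)"
    unfolding Infinite_Sum.abs_summable_on_Sigma_iff
    using s by (auto simp: norm2_sq[symmetric] ell2_summable[OF W])
  then show "(\<lambda>p. (cmod (W p))\<^sup>2) summable_on UNIV" by simp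
  fix p assume "p \<notin> A \<times> C"
  then show "W p = 0"
    using out[of "fst p" "snd p"] ell2_outside[OF W, of "snd p" "fst p"] by (cases p) auto
qed

lemma ell2_slice: "W \<in> ell2 (A \<times> C) \<Longrightarrow> (\<lambda>c. W (a, c)) \<in> ell2 C"
proof (rule ell2I)
  assume W: "W \<in> ell2 (A \<times> C)"
  have "(\<lambda>p. norm ((cmod (W p))\<^sup>2)) summable_on (UNIV \<times> UNIV)"
    using ell2_summable[OF W] by simp
  then show "(\<lambda>c. (cmod (W (a, c)))\<^sup>2) summable_on UNIV"
    unfolding Infinite_Sum.abs_summable_on_Sigma_iff by simp
qed (auto simp: ell2_def)

lemma norm2_slices:
  assumes W: "W \<in> ell2 (A \<times> C)"
  shows norm2_slices_summable: "(\<lambda>a. (norm2 (\<lambda>c. W (a, c)))\<^sup>2) summable_on UNIV"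
    and norm2_sq_slices: "(norm2 W)\<^sup>2 = (\<Sum>\<^sub>\<infinity>a. (norm2 (\<lambda>c. W (a, c)))\<^sup>2)"
proof -
  have s: "(\<lambda>p. (cmod (W p))\<^sup>2) summable_on (UNIV \<times> UNIV)"
    using ell2_summable[OF W] by simp
  show "(\<lambda>a. (norm2 (\<lambda>c. W (a, c)))\<^sup>2) summable_on UNIV"
    unfolding norm2_sq by (rule summable_on_Sigma_banach) (use s in \<open>simp add: case_prod_unfold\<close>)
  show "(norm2 W)\<^sup>2 = (\<Sum>\<^sub>\<infinity>a. (norm2 (\<lambda>c. W (a, c)))\<^sup>2)"
    unfolding norm2_sq using infsum_Sigma_banach[OF s] by simp
qed

lemma inner2_slices:
  assumes V: "V \<in> ell2 (A \<times> C)" and W: "W \<in> ell2 (A \<times> C)"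
  shows "inner2 V W = (\<Sum>\<^sub>\<infinity>a. inner2 (\<lambda>c. V (a, c)) (\<lambda>c. W (a, c)))"
proof -
  have s: "(\<lambda>p. cnj (V p) * W p) summable_on (UNIV \<times> UNIV)"
    using ell2_inner_summable[OF V W] by simp
  show ?thesis
    unfolding inner2_def using infsum_Sigma_banach[OF s] by simp
qed

text \<open>In coordinates this is the identity tensored with \<open>f\<close>: the first index is a
  parameter.\<close>

definition slice_op :: "'a set \<Rightarrow> 'b set \<Rightarrow> (('b \<Rightarrow> complex) \<Rightarrow> ('c \<Rightarrow> complex))
    \<Rightarrow> ('a \<times> 'b \<Rightarrow> complex) \<Rightarrow> ('a \<times> 'c \<Rightarrow> complex)" where
  "slice_op A B f = (\<lambda>V\<in>ell2 (A \<times> B). \<lambda>(a, c). f (\<lambda>b. V (a, b)) c)"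

lemma slice_op_apply: "V \<in> ell2 (A \<times> B) \<Longrightarrow> slice_op A B f V (a, c) = f (\<lambda>b. V (a, b)) c"
  by (simp add: slice_op_def)

lemma slice_op_in:
  assumes f: "f \<in> bop (ell2 B) (ell2 C)" and V: "V \<in> ell2 (A \<times> B)"
  shows "slice_op A B f V \<in> ell2 (A \<times> C)"
proof (rule ell2_prodI)
  obtain K where K: "K \<ge> 0" "\<And>v. v \<in> ell2 B \<Longrightarrow> norm2 (f v) \<le> K * norm2 v"
    using bop_bound[OF f] by blast
  show "(\<lambda>a. (norm2 (\<lambda>c. slice_op A B f V (a, c)))\<^sup>2) summable_on UNIV"
  proof (rule summable_on_comparison_test)
    show "(\<lambda>a. K\<^sup>2 * (norm2 (\<lambda>b. V (a, b)))\<^sup>2) summable_on UNIV"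
      by (intro summable_on_cmult_right norm2_slices_summable[OF V])
    show "(norm2 (\<lambda>c. slice_op A B f V (a, c)))\<^sup>2 \<le> K\<^sup>2 * (norm2 (\<lambda>b. V (a, b)))\<^sup>2" for a
      using power_mono[OF K(2)[OF ell2_slice[OF V, of a]] norm2_nonneg, of 2]
      by (simp add: slice_op_apply[OF V] power_mult_distrib)
  qed auto
  show "(\<lambda>c. slice_op A B f V (a, c)) \<in> ell2 C" for a
    using bop_in[OF f ell2_slice[OF V]] by (simp add: slice_op_apply[OF V])
  fix a c assume "a \<notin> A"
  then have "(\<lambda>b. V (a, b)) = (\<lambda>b. 0)" using ell2_outside[OF V] by auto
  then show "slice_op A B f V (a, c) = 0" by (simp add: slice_op_apply[OF V] bop_zero[OF f])
qed

lemma slice_op_lin: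
  assumes f: "f \<in> bop (ell2 B) (ell2 C)" and V: "V \<in> ell2 (A \<times> B)" and W: "W \<in> ell2 (A \<times> B)"
  shows "slice_op A B f (\<lambda>p. a * V p + b * W p)
    = (\<lambda>p. a * slice_op A B f V p + b * slice_op A B f W p)"
  by (rule ext) (auto simp: slice_op_apply V W ell2_lin bop_lin[OF f ell2_slice[OF V] ell2_slice[OF W]])

lemma slice_op_bop:
  assumes f: "f \<in> bop (ell2 B) (ell2 C)"
  shows "slice_op A B f \<in> bop (ell2 (A \<times> B)) (ell2 (A \<times> C))"
proof -
  obtain K where K: "K \<ge> 0" "\<And>v. v \<in> ell2 B \<Longrightarrow> norm2 (f v) \<le> K * norm2 v"
    using bop_bound[OF f] by blast
  show ?thesis
  proof (rule bopI[where C = K])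
    show "slice_op A B f \<in> ell2 (A \<times> B) \<rightarrow>\<^sub>E ell2 (A \<times> C)"
    proof
      fix V assume "V \<in> ell2 (A \<times> B)"
      then show "slice_op A B f V \<in> ell2 (A \<times> C)" by (rule slice_op_in[OF f])
    qed (simp add: slice_op_def)
    fix V assume V: "V \<in> ell2 (A \<times> B)"
    have "(norm2 (slice_op A B f V))\<^sup>2 = (\<Sum>\<^sub>\<infinity>a. (norm2 (\<lambda>c. slice_op A B f V (a, c)))\<^sup>2)"
      by (rule norm2_sq_slices[OF slice_op_in[OF f V]])
    also have "\<dots> \<le> (\<Sum>\<^sub>\<infinity>a. K\<^sup>2 * (norm2 (\<lambda>b. V (a, b)))\<^sup>2)"
    proof (rule infsum_mono[OF norm2_slices_summable[OF slice_op_in[OF f V]]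
        summable_on_cmult_right[OF norm2_slices_summable[OF V]]])
      fix a
      show "(norm2 (\<lambda>c. slice_op A B f V (a, c)))\<^sup>2 \<le> K\<^sup>2 * (norm2 (\<lambda>b. V (a, b)))\<^sup>2"
        using power_mono[OF K(2)[OF ell2_slice[OF V, of a]] norm2_nonneg, of 2]
        by (simp add: slice_op_apply[OF V] power_mult_distrib)
    qed
    also have "\<dots> = (K * norm2 V)\<^sup>2"
      by (simp add: infsum_cmult_right' norm2_sq_slices[OF V] power_mult_distrib)
    finally show "norm2 (slice_op A B f V) \<le> K * norm2 V"
      by (rule power2_le_imp_le) (simp add: K)
  qed (rule slice_op_lin[OF f])
qed

lemma slice_op_isom:
  assumes f: "isom (ell2 B) (ell2 C) f"
  shows "isom (ell2 (A \<times> B)) (ell2 (A \<times> C)) (slice_op A B f)"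
proof -
  have "norm2 (slice_op A B f V) = norm2 V" if V: "V \<in> ell2 (A \<times> B)" for V
  proof -
    have "(norm2 (slice_op A B f V))\<^sup>2 = (norm2 V)\<^sup>2"
      using norm2_sq_slices[OF slice_op_in[OF isom_bop[OF f] V]] norm2_sq_slices[OF V]
      by (simp add: slice_op_apply[OF V] isom_norm[OF f ell2_slice[OF V]])
    then show ?thesis by (simp add: power2_eq_iff_nonneg)
  qed
  then show ?thesis unfolding isom_def by (simp add: slice_op_bop[OF isom_bop[OF f]])
qed

section \<open>Reindexing of bases\<close>

text \<open>Pullback, so \<psi> runs from the new index set \<open>D\<close> back to
  \<open>C\<close>. Swapping, currying and, after extension by zero, the embeddings for injections
  and successor all have this form.\<close>

definition reindex_op :: "('d \<Rightarrow> 'c) \<Rightarrow> 'c set \<Rightarrow> 'd set \<Rightarrow> ('c \<Rightarrow> complex) \<Rightarrow> ('d \<Rightarrow> complex)" where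
  "reindex_op \<psi> C D = (\<lambda>v\<in>ell2 C. \<lambda>d. if d \<in> D then v (\<psi> d) else 0)"

lemma reindex_op_isom:
  assumes \<psi>: "bij_betw \<psi> D C"
  shows "isom (ell2 C) (ell2 D) (reindex_op \<psi> C D)"
proof (rule isomI)
  fix v w a b assume v: "v \<in> ell2 C" and w: "w \<in> ell2 C"
  show "reindex_op \<psi> C D (\<lambda>x. a * v x + b * w x)
      = (\<lambda>y. a * reindex_op \<psi> C D v y + b * reindex_op \<psi> C D w y)"
    using v w ell2_lin[OF v w] by (auto simp: reindex_op_def)
next
  have sq: "(\<lambda>d. (cmod (reindex_op \<psi> C D v d))\<^sup>2) summable_on UNIV"
    if v: "v \<in> ell2 C" for v
  proof -
    have "(\<lambda>c. (cmod (v c))\<^sup>2) summable_on C"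
      using ell2_summable[OF v] summable_on_subset_banach by blast
    then have "(\<lambda>d. (cmod (v (\<psi> d)))\<^sup>2) summable_on D"
      by (subst summable_on_reindex_bij_betw[OF \<psi>, of "\<lambda>c. (cmod (v c))\<^sup>2"])
    then show ?thesis
      by (rule summable_on_cong_neutral[THEN iffD1, rotated -1]) (use v in \<open>auto simp: reindex_op_def\<close>)
  qed
  show "reindex_op \<psi> C D \<in> ell2 C \<rightarrow>\<^sub>E ell2 D"
  proof
    fix v assume v: "v \<in> ell2 C"
    show "reindex_op \<psi> C D v \<in> ell2 D"
      by (rule ell2I[OF _ sq[OF v]]) (use v in \<open>simp add: reindex_op_def\<close>)
  qed (simp add: reindex_op_def)
  fix v assume v: "v \<in> ell2 C"
  have "(norm2 (reindex_op \<psi> C D v))\<^sup>2 = (\<Sum>\<^sub>\<infinity>d\<in>D. (cmod (v (\<psi> d)))\<^sup>2)"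
    unfolding norm2_sq using v by (intro infsum_cong_neutral) (auto simp: reindex_op_def)
  also have "\<dots> = (\<Sum>\<^sub>\<infinity>c\<in>C. (cmod (v c))\<^sup>2)"
    by (rule infsum_reindex_bij_betw[OF \<psi>])
  also have "\<dots> = (norm2 v)\<^sup>2"
    unfolding norm2_sq using ell2_outside[OF v] by (intro infsum_cong_neutral) auto
  finally show "norm2 (reindex_op \<psi> C D v) = norm2 v"
    by (simp add: power2_eq_iff_nonneg)
qed


subsection \<open>Tensor products\<close>

text \<open>\<open>P\<close> identifies \<open>A \<times> B\<close> with \<open>D\<close>, and \<open>\<tau> v w\<close> is the elementary tensor.\<close>

locale pairing =
  fixes A :: "'a set" and B :: "'b set" and D :: "'d set" and P :: "'a \<Rightarrow> 'b \<Rightarrow> 'd"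
    and \<tau> :: "('a \<Rightarrow> complex) \<Rightarrow> ('b \<Rightarrow> complex) \<Rightarrow> 'd \<Rightarrow> complex"
  assumes bij: "bij_betw (\<lambda>(a, b). P a b) (A \<times> B) D"
    and tau_at: "\<And>v w a b. v \<in> ell2 A \<Longrightarrow> w \<in> ell2 B \<Longrightarrow> a \<in> A \<Longrightarrow> b \<in> B \<Longrightarrow> \<tau> v w (P a b) = v a * w b"
    and tau_out: "\<And>v w d. v \<in> ell2 A \<Longrightarrow> w \<in> ell2 B \<Longrightarrow> d \<notin> D \<Longrightarrow> \<tau> v w d = 0"
begin

lemma P_in: "a \<in> A \<Longrightarrow> b \<in> B \<Longrightarrow> P a b \<in> D"
  using bij by (auto simp: bij_betw_def)

lemma D_cases:
  assumes "d \<in> D" obtains a b where "a \<in> A" "b \<in> B" "d = P a b"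
  using bij assms by (force simp: bij_betw_def)

text \<open>Symmetry of the two factors: a second interpretation of the locale turns each statement
  about rows into one about columns.\<close>

lemma pairing_flip: "pairing B A D (\<lambda>b a. P a b) (\<lambda>w v. \<tau> v w)"
proof
  have "(\<lambda>(b, a). P a b) = (\<lambda>(a, b). P a b) \<circ> prod.swap" by auto
  moreover have "bij_betw prod.swap (B \<times> A) (A \<times> B)"
    by (auto simp: bij_betw_def inj_on_def)
  ultimately show "bij_betw (\<lambda>(b, a). P a b) (B \<times> A) D"
    using bij by (metis bij_betw_trans)
qed (auto simp: tau_at tau_out)

definition curried :: "('d \<Rightarrow> complex) \<Rightarrow> 'a \<times> 'b \<Rightarrow> complex" where
  "curried = reindex_op (\<lambda>(a, b). P a b) D (A \<times> B)"

lemma curried_isom: "isom (ell2 D) (ell2 (A \<times> B)) curried"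
  unfolding curried_def by (rule reindex_op_isom[OF bij])

lemma curried_apply: "v \<in> ell2 D \<Longrightarrow> curried v (a, b) = (if a \<in> A \<and> b \<in> B then v (P a b) else 0)"
  by (simp add: curried_def reindex_op_def)

text \<open>The guard matters because \<open>P a b\<close> may lie in \<open>D\<close> although
  \<open>a\<close> or \<open>b\<close> is not an admissible index, as happens with
  \<open>(++)\<close> on environments.\<close>

definition row :: "('d \<Rightarrow> complex) \<Rightarrow> 'a \<Rightarrow> 'b \<Rightarrow> complex" where
  "row v a = (\<lambda>b. if a \<in> A \<and> b \<in> B then v (P a b) else 0)"

lemma row_in: "v \<in> ell2 D \<Longrightarrow> row v a \<in> ell2 B"
  using ell2_slice[OF bop_in[OF isom_bop[OF curried_isom]], of v a] by (simp add: row_def curried_apply)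

lemma inner2_rows:
  assumes v: "v \<in> ell2 D" and w: "w \<in> ell2 D"
  shows "inner2 v w = (\<Sum>\<^sub>\<infinity>a. inner2 (row v a) (row w a))"
proof -
  note c = bop_in[OF isom_bop[OF curried_isom]]
  have "inner2 v w = inner2 (curried v) (curried w)"
    by (rule isom_inner[OF curried_isom v w, symmetric])
  also have "\<dots> = (\<Sum>\<^sub>\<infinity>a. inner2 (\<lambda>b. curried v (a, b)) (\<lambda>b. curried w (a, b)))"
    by (rule inner2_slices[OF c[OF v] c[OF w]])
  finally show ?thesis using v w by (simp add: curried_apply row_def)
qed

lemma inner2_cols:
  assumes v: "v \<in> ell2 D" and w: "w \<in> ell2 D"
  shows "inner2 v w = (\<Sum>\<^sub>\<infinity>b. inner2 (\<lambda>a. row v a b) (\<lambda>a. row w a b))"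
proof -
  interpret flip: pairing B A D "\<lambda>b a. P a b" "\<lambda>w v. \<tau> v w" by (rule pairing_flip)
  have "flip.row u b = (\<lambda>a. row u a b)" for u b
    by (auto simp: flip.row_def row_def)
  then show ?thesis using flip.inner2_rows[OF v w] by simp
qed

lemma norm2_rows:
  assumes v: "v \<in> ell2 D"
  shows "(norm2 v)\<^sup>2 = (\<Sum>\<^sub>\<infinity>a. (norm2 (row v a))\<^sup>2)"
  using norm2_sq_slices[OF bop_in[OF isom_bop[OF curried_isom] v]] isom_norm[OF curried_isom v] v
  by (simp add: curried_apply row_def)

lemma ell2_D_eqI:
  assumes "v \<in> ell2 D" "w \<in> ell2 D" "\<And>a b. a \<in> A \<Longrightarrow> b \<in> B \<Longrightarrow> v (P a b) = w (P a b)"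
  shows "v = w"
proof
  fix d show "v d = w d"
    using assms ell2_outside[OF assms(1)] ell2_outside[OF assms(2)]
    by (cases "d \<in> D") (auto elim!: D_cases)
qed

text \<open>On the Cartesian product each row is a multiple of \<open>w\<close> with factor
  \<open>v a\<close>, so the row norms are square-summable; the family is then transported along the
  inverse of the pairing.\<close>

lemma tau_in: assumes v: "v \<in> ell2 A" and w: "w \<in> ell2 B" shows "\<tau> v w \<in> ell2 D"
proof -
  define V where "V = (\<lambda>(a, b). v a * w b)"
  have "V \<in> ell2 (A \<times> B)"
  proof (rule ell2_prodI)
    show "(\<lambda>a. (norm2 (\<lambda>b. V (a, b)))\<^sup>2) summable_on UNIV"
      by (auto simp: V_def norm2_scale power_mult_distrib
          intro!: summable_on_cmult_left ell2_summable[OF v])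
  qed (auto simp: V_def ell2_scale[OF w] ell2_outside[OF v])
  moreover have "\<tau> v w = reindex_op (inv_into (A \<times> B) (\<lambda>(a, b). P a b)) (A \<times> B) D V"
  proof
    fix d
    show "\<tau> v w d = reindex_op (inv_into (A \<times> B) (\<lambda>(a, b). P a b)) (A \<times> B) D V d"
    proof (cases "d \<in> D")
      case True
      then obtain a b where d: "a \<in> A" "b \<in> B" "d = P a b" by (rule D_cases)
      then have "inv_into (A \<times> B) (\<lambda>(a, b). P a b) d = (a, b)"
        using bij_betw_inv_into_left[OF bij, of "(a, b)"] by simp
      then show ?thesis
        using d True \<open>V \<in> _\<close> v w by (simp add: reindex_op_def V_def tau_at)
    qed (use \<open>V \<in> _\<close> v w in \<open>simp add: reindex_op_def tau_out\<close>)
  qed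
  ultimately show ?thesis
    using bop_in[OF isom_bop[OF reindex_op_isom[OF bij_betw_inv_into[OF bij]]]] by simp
qed

lemma ket_tau: "a \<in> A \<Longrightarrow> b \<in> B \<Longrightarrow> \<tau> (ket a) (ket b) = ket (P a b)"
proof
  fix d assume ab: "a \<in> A" "b \<in> B"
  show "\<tau> (ket a) (ket b) d = ket (P a b) d"
  proof (cases "d \<in> D")
    case True
    then obtain a' b' where d: "a' \<in> A" "b' \<in> B" "d = P a' b'" by (rule D_cases)
    have "P a' b' = P a b \<longleftrightarrow> a' = a \<and> b' = b"
      using bij ab d unfolding bij_betw_def inj_on_def by auto
    then show ?thesis
      using tau_at[OF ell2_ket[OF ab(1)] ell2_ket[OF ab(2)] d(1,2)] d by (auto simp: ket_def)
  next
    case False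
    then show ?thesis
      using tau_out[OF ell2_ket[OF ab(1)] ell2_ket[OF ab(2)]] P_in[OF ab] by (auto simp: ket_def)
  qed
qed

text \<open>Tensors of kets are exactly the kets of \<open>D\<close>. Read at a coordinate
  \<open>y\<close>, the difference of the two operators is a bounded functional that vanishes on
  them.\<close>

lemma bop_eq_on_tensors:
  assumes h: "h \<in> bop (ell2 D) (ell2 E)" and k: "k \<in> bop (ell2 D) (ell2 E)"
    and eq: "\<And>v w. v \<in> ell2 A \<Longrightarrow> w \<in> ell2 B \<Longrightarrow> h (\<tau> v w) = k (\<tau> v w)"
  shows "h = k"
proof (rule bop_eqI[OF h k], rule ext)
  fix v y assume v: "v \<in> ell2 D"
  obtain C where C: "\<And>v. v \<in> ell2 D \<Longrightarrow> norm2 (h v) \<le> C * norm2 v" using bop_bound[OF h] by blast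
  obtain C' where C': "\<And>v. v \<in> ell2 D \<Longrightarrow> norm2 (k v) \<le> C' * norm2 v" using bop_bound[OF k] by blast
  have "h v y - k v y = 0"
  proof (rule ket_functional_zero[OF v, where \<phi> = "\<lambda>v. h v y - k v y"])
    fix v assume v: "v \<in> ell2 D"
    show "cmod (h v y - k v y) \<le> (C + C') * norm2 v"
      using norm_triangle_ineq4[of "h v y" "k v y"] C[OF v] C'[OF v]
        ell2_eval_le_norm2[OF bop_in[OF h v], of y] ell2_eval_le_norm2[OF bop_in[OF k v], of y]
      by (simp add: distrib_right)
  next
    fix d assume "d \<in> D"
    then obtain a b where d: "a \<in> A" "b \<in> B" "d = P a b" by (rule D_cases)
    show "h (ket d) y - k (ket d) y = 0"
      using eq[OF ell2_ket[OF d(1)] ell2_ket[OF d(2)]] d by (simp add: ket_tau)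
  qed (simp add: bop_lin[OF h] bop_lin[OF k] algebra_simps)
  then show "h v y = k v y" by simp
qed

end

lemma swap_isom: "isom (ell2 (A \<times> B)) (ell2 (B \<times> A)) (reindex_op prod.swap (A \<times> B) (B \<times> A))"
  by (rule reindex_op_isom) (auto simp: bij_betw_def inj_on_def)

lemma ell2_slice_left:
  assumes W: "W \<in> ell2 (A \<times> C)" shows "(\<lambda>a. W (a, c)) \<in> ell2 A"
proof -
  have "reindex_op prod.swap (A \<times> C) (C \<times> A) W (c, a) = W (a, c)" for a
    using W ell2_outside[OF W, of "(a, c)"] by (auto simp: reindex_op_def)
  then show ?thesis using ell2_slice[OF bop_in[OF isom_bop[OF swap_isom] W], of c] by simp
qed

locale pairing2 = dom: pairing A B D P \<tau> + cod: pairing A' B' D' P' \<tau>'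
  for A :: "'a set" and B :: "'b set" and D :: "'d set" and P \<tau>
    and A' :: "'e set" and B' :: "'f set" and D' :: "'g set" and P' \<tau>'
begin

text \<open>Curry, apply \<open>g\<close> to every row, swap, apply \<open>f\<close> to every
  column, and uncurry. Every factor is known to be bounded, and isometric if \<open>f\<close> and
  \<open>g\<close> are, so both properties hold for the composite without estimates for double
  series.\<close>

definition tensor :: "(('a \<Rightarrow> complex) \<Rightarrow> ('e \<Rightarrow> complex)) \<Rightarrow> (('b \<Rightarrow> complex) \<Rightarrow> ('f \<Rightarrow> complex))
    \<Rightarrow> ('d \<Rightarrow> complex) \<Rightarrow> ('g \<Rightarrow> complex)" where
  "tensor f g = compose (ell2 D) (reindex_op (inv_into (B' \<times> A') (\<lambda>(b, a). P' a b)) (B' \<times> A') D')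
     (compose (ell2 D) (slice_op B' A f)
     (compose (ell2 D) (reindex_op prod.swap (A \<times> B') (B' \<times> A))
     (compose (ell2 D) (slice_op A B g) dom.curried)))"

lemma unpair_isom:
  "isom (ell2 (B' \<times> A')) (ell2 D') (reindex_op (inv_into (B' \<times> A') (\<lambda>(b, a). P' a b)) (B' \<times> A') D')"
  by (rule reindex_op_isom, rule bij_betw_inv_into, rule pairing.bij[OF cod.pairing_flip])

text \<open>The family is a column of the vector obtained by applying \<open>g\<close> to all
  rows.\<close>

lemma row_image_in:
  assumes g: "g \<in> bop (ell2 B) (ell2 B')" and v: "v \<in> ell2 D"
  shows "(\<lambda>a. g (dom.row v a) b') \<in> ell2 A"
proof -
  have c: "dom.curried v \<in> ell2 (A \<times> B)" by (rule bop_in[OF isom_bop[OF dom.curried_isom] v])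
  have "(\<lambda>a. slice_op A B g (dom.curried v) (a, b')) \<in> ell2 A"
    by (rule ell2_slice_left[OF slice_op_in[OF g c]])
  moreover have "(\<lambda>b. dom.curried v (a, b)) = dom.row v a" for a
    by (auto simp: dom.curried_apply[OF v] dom.row_def)
  ultimately show ?thesis by (simp add: slice_op_apply[OF c])
qed

lemma col_image_in:
  assumes f: "f \<in> bop (ell2 A) (ell2 A')" and v: "v \<in> ell2 D"
  shows "(\<lambda>b. f (\<lambda>a. dom.row v a b) a') \<in> ell2 B"
proof -
  interpret flip: pairing2 B A D "\<lambda>b a. P a b" "\<lambda>w v. \<tau> v w" B' A' D' "\<lambda>b a. P' a b" "\<lambda>w v. \<tau>' v w"
    using dom.pairing_flip cod.pairing_flip by (rule pairing2.intro)
  have "flip.dom.row v b = (\<lambda>a. dom.row v a b)" for b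
    by (auto simp: flip.dom.row_def dom.row_def)
  then show ?thesis using flip.row_image_in[OF f v] by simp
qed

lemma tensor_bop:
  assumes "f \<in> bop (ell2 A) (ell2 A')" "g \<in> bop (ell2 B) (ell2 B')"
  shows "tensor f g \<in> bop (ell2 D) (ell2 D')"
  unfolding tensor_def
  by (intro bop_compose[OF _ isom_bop[OF unpair_isom]] bop_compose[OF _ isom_bop[OF swap_isom]]
      bop_compose[OF _ slice_op_bop[OF assms(1)]] bop_compose[OF _ slice_op_bop[OF assms(2)]]
      isom_bop[OF dom.curried_isom])

lemma tensor_isom:
  assumes "isom (ell2 A) (ell2 A') f" "isom (ell2 B) (ell2 B') g"
  shows "isom (ell2 D) (ell2 D') (tensor f g)"
  unfolding tensor_def
  by (intro isom_compose[OF _ unpair_isom] isom_compose[OF _ swap_isom]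
      isom_compose[OF _ slice_op_isom[OF assms(1)]] isom_compose[OF _ slice_op_isom[OF assms(2)]]
      dom.curried_isom)

lemma tensor_apply:
  assumes f: "f \<in> bop (ell2 A) (ell2 A')" and g: "g \<in> bop (ell2 B) (ell2 B')"
    and v: "v \<in> ell2 D" and ab: "a' \<in> A'" "b' \<in> B'"
  shows "tensor f g v (P' a' b') = f (\<lambda>a. g (dom.row v a) b') a'"
proof -
  define V1 where "V1 = slice_op A B g (dom.curried v)"
  define V2 where "V2 = reindex_op prod.swap (A \<times> B') (B' \<times> A) V1"
  define V3 where "V3 = slice_op B' A f V2"
  have cv: "dom.curried v \<in> ell2 (A \<times> B)" by (rule bop_in[OF isom_bop[OF dom.curried_isom] v])
  have V1: "V1 \<in> ell2 (A \<times> B')" unfolding V1_def by (rule slice_op_in[OF g cv])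
  have V2: "V2 \<in> ell2 (B' \<times> A)" unfolding V2_def by (rule bop_in[OF isom_bop[OF swap_isom] V1])
  have V3: "V3 \<in> ell2 (B' \<times> A')" unfolding V3_def by (rule slice_op_in[OF f V2])
  have 1: "V1 (a, b) = g (dom.row v a) b" for a b
    unfolding V1_def slice_op_apply[OF cv] by (simp add: dom.row_def dom.curried_apply[OF v])
  have 2: "V2 (b', a) = V1 (a, b')" for a
    using ab V1 ell2_outside[OF V1, of "(a, b')"] by (auto simp: V2_def reindex_op_def)
  have "tensor f g v = reindex_op (inv_into (B' \<times> A') (\<lambda>(b, a). P' a b)) (B' \<times> A') D' V3"
    using v by (simp add: tensor_def compose_eq V1_def V2_def V3_def)
  then have "tensor f g v (P' a' b') = V3 (inv_into (B' \<times> A') (\<lambda>(b, a). P' a b) (P' a' b'))"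
    using V3 cod.P_in[OF ab] by (simp add: reindex_op_def)
  also have "inv_into (B' \<times> A') (\<lambda>(b, a). P' a b) (P' a' b') = (b', a')"
    using bij_betw_inv_into_left[OF pairing.bij[OF cod.pairing_flip], of "(b', a')"] ab by simp
  also have "V3 (b', a') = f (\<lambda>a. g (dom.row v a) b') a'"
    unfolding V3_def slice_op_apply[OF V2] 2 1 ..
  finally show ?thesis .
qed

lemma tensor_tau:
  assumes f: "f \<in> bop (ell2 A) (ell2 A')" and g: "g \<in> bop (ell2 B) (ell2 B')"
    and v: "v \<in> ell2 A" and w: "w \<in> ell2 B"
  shows "tensor f g (\<tau> v w) = \<tau>' (f v) (g w)"
proof (rule cod.ell2_D_eqI)
  note t = dom.tau_in[OF v w]
  show "tensor f g (\<tau> v w) \<in> ell2 D'" by (rule bop_in[OF tensor_bop[OF f g] t])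
  show "\<tau>' (f v) (g w) \<in> ell2 D'" by (rule cod.tau_in[OF bop_in[OF f v] bop_in[OF g w]])
  fix a' b' assume ab: "a' \<in> A'" "b' \<in> B'"
  have row: "dom.row (\<tau> v w) a = (\<lambda>b. v a * w b)" for a
    using ell2_outside[OF v] ell2_outside[OF w]
    by (auto simp: dom.row_def dom.tau_at[OF v w] fun_eq_iff)
  have "tensor f g (\<tau> v w) (P' a' b') = f (\<lambda>a. g w b' * v a) a'"
    unfolding tensor_apply[OF f g t ab] row bop_scale[OF g w] by (simp add: mult.commute)
  then show "tensor f g (\<tau> v w) (P' a' b') = \<tau>' (f v) (g w) (P' a' b')"
    unfolding bop_scale[OF f v] cod.tau_at[OF bop_in[OF f v] bop_in[OF g w] ab] by (simp add: mult.commute)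
qed

lemma tensor_unique:
  assumes f: "f \<in> bop (ell2 A) (ell2 A')" and g: "g \<in> bop (ell2 B) (ell2 B')"
    and h: "h \<in> bop (ell2 D) (ell2 D')"
    and eq: "\<And>v w. v \<in> ell2 A \<Longrightarrow> w \<in> ell2 B \<Longrightarrow> h (\<tau> v w) = \<tau>' (f v) (g w)"
  shows "h = tensor f g"
  by (rule dom.bop_eq_on_tensors[OF h tensor_bop[OF f g]]) (simp add: eq tensor_tau[OF f g])

text \<open>Applying the factors in the other order gives the same operator because both composites
  agree on elementary tensors. This avoids interchanging \<open>f\<close> and \<open>g\<close> on a
  general vector.\<close>

lemma tensor_apply_flip:
  assumes f: "f \<in> bop (ell2 A) (ell2 A')" and g: "g \<in> bop (ell2 B) (ell2 B')"
    and v: "v \<in> ell2 D" and ab: "a' \<in> A'" "b' \<in> B'"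
  shows "tensor f g v (P' a' b') = g (\<lambda>b. f (\<lambda>a. dom.row v a b) a') b'"
proof -
  interpret flip: pairing2 B A D "\<lambda>b a. P a b" "\<lambda>w v. \<tau> v w" B' A' D' "\<lambda>b a. P' a b" "\<lambda>w v. \<tau>' v w"
    using dom.pairing_flip cod.pairing_flip by (rule pairing2.intro)
  have "flip.tensor g f = tensor f g"
    by (rule tensor_unique[OF f g flip.tensor_bop[OF g f] flip.tensor_tau[OF g f]])
  moreover have "flip.dom.row v b = (\<lambda>a. dom.row v a b)" for b
    by (auto simp: flip.dom.row_def dom.row_def)
  ultimately show ?thesis using flip.tensor_apply[OF g f v ab(2,1)] by simp
qed

text \<open>In the formula with \<open>g\<close> outermost the argument of \<open>g\<close> does not
  depend on the second index, so a whole row of the image is one value of \<open>g\<close>. This is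
  how orthogonality of second components reaches pairs.\<close>

lemma row_tensor:
  assumes f: "f \<in> bop (ell2 A) (ell2 A')" and g: "g \<in> bop (ell2 B) (ell2 B')" and v: "v \<in> ell2 D"
    and a': "a' \<in> A'"
  shows "\<exists>w\<in>ell2 B. cod.row (tensor f g v) a' = g w"
proof
  show w: "(\<lambda>b. f (\<lambda>a. dom.row v a b) a') \<in> ell2 B" by (rule col_image_in[OF f v])
  show "cod.row (tensor f g v) a' = g (\<lambda>b. f (\<lambda>a. dom.row v a b) a')"
    using a' ell2_outside[OF bop_in[OF g w]]
    by (auto simp: cod.row_def tensor_apply_flip[OF f g v])
qed

lemma col_tensor:
  assumes f: "f \<in> bop (ell2 A) (ell2 A')" and g: "g \<in> bop (ell2 B) (ell2 B')" and v: "v \<in> ell2 D"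
    and b': "b' \<in> B'"
  shows "\<exists>w\<in>ell2 A. (\<lambda>a'. cod.row (tensor f g v) a' b') = f w"
proof
  show w: "(\<lambda>a. g (dom.row v a) b') \<in> ell2 A" by (rule row_image_in[OF g v])
  show "(\<lambda>a'. cod.row (tensor f g v) a' b') = f (\<lambda>a. g (dom.row v a) b')"
    using b' ell2_outside[OF bop_in[OF f w]]
    by (auto simp: cod.row_def tensor_apply[OF f g v])
qed

end

text \<open>The description in \<open>op_tensor\<close> denotes the constructed operator, because
  boundedness and the values on elementary tensors characterise it.\<close>

lemma op_tensor_eq:
  assumes "pairing2 A B D P \<tau> A' B' D' P' vtensor"
    and f: "f \<in> bop (ell2 A) (ell2 A')" and g: "g \<in> bop (ell2 B) (ell2 B')"
  shows "op_tensor \<tau> (ell2 A) (ell2 B) (ell2 D) (ell2 D') f g = pairing2.tensor A B D P A' B' D' P' f g"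
proof -
  interpret pairing2 A B D P \<tau> A' B' D' P' vtensor by fact
  show ?thesis
    unfolding op_tensor_def
    by (rule the_equality) (auto intro!: tensor_unique tensor_bop f g simp: tensor_tau[OF f g])
qed

text \<open>Both sides agree on elementary tensors. It serves to invert a tensor product of
  unitaries and to factor the projection onto the range of a pair.\<close>

lemma tensor_compose:
  assumes AB: "pairing2 A B D P \<tau> A' B' D' P' \<tau>'"
    and BC: "pairing2 A' B' D' P' \<tau>' A'' B'' D'' P'' \<tau>''"
    and f: "f \<in> bop (ell2 A) (ell2 A')" and g: "g \<in> bop (ell2 B) (ell2 B')"
    and f': "f' \<in> bop (ell2 A') (ell2 A'')" and g': "g' \<in> bop (ell2 B') (ell2 B'')"
    and v: "v \<in> ell2 D"
  shows "pairing2.tensor A' B' D' P' A'' B'' D'' P'' f' g' (pairing2.tensor A B D P A' B' D' P' f g v)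
    = pairing2.tensor A B D P A'' B'' D'' P'' (compose (ell2 A) f' f) (compose (ell2 B) g' g) v"
proof -
  interpret ab: pairing2 A B D P \<tau> A' B' D' P' \<tau>' by fact
  interpret bc: pairing2 A' B' D' P' \<tau>' A'' B'' D'' P'' \<tau>'' by fact
  interpret ac: pairing2 A B D P \<tau> A'' B'' D'' P'' \<tau>''
    by (intro pairing2.intro ab.dom.pairing_axioms bc.cod.pairing_axioms)
  have "compose (ell2 D) (bc.tensor f' g') (ab.tensor f g)
      = ac.tensor (compose (ell2 A) f' f) (compose (ell2 B) g' g)"
    by (rule ac.tensor_unique)
       (auto simp: compose_eq ab.dom.tau_in ab.tensor_tau[OF f g] bc.tensor_tau[OF f' g']
          bop_in[OF f] bop_in[OF g] intro!: bop_compose f g f' g' ab.tensor_bop bc.tensor_bop)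
  from fun_cong[OF this, of v] show ?thesis using v by (simp add: compose_eq)
qed


subsection \<open>Uniqueness of typing\<close>

inductive_cases typed_TVarE: "typed \<Gamma> (TVar x) Q"
inductive_cases typed_TStarE: "typed \<Gamma> TStar Q"
inductive_cases typed_TZeroE: "typed \<Gamma> TZero Q"
inductive_cases typed_TInlE: "typed \<Gamma> (TInl t) Q"
inductive_cases typed_TInrE: "typed \<Gamma> (TInr t) Q"
inductive_cases typed_TSuccE: "typed \<Gamma> (TSucc t) Q"
inductive_cases typed_TPairE: "typed \<Gamma> (TPair t s) Q"
inductive_cases typed_TAppE: "typed \<Gamma> (TApp u t) Q"
inductive_cases typed_TSumE: "typed \<Gamma> (TSum M) Q"
inductive_cases utyped_UMatchE: "utyped (UMatch cs) Q\<^sub>1 Q\<^sub>2"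
inductive_cases utyped_UAdjE: "utyped (UAdj u) Q\<^sub>1 Q\<^sub>2"
inductive_cases utyped_UCompE: "utyped (UComp u v) Q\<^sub>1 Q\<^sub>2"
inductive_cases utyped_UTensorE: "utyped (UTensor u v) Q\<^sub>1 Q\<^sub>2"
inductive_cases utyped_UPlusE: "utyped (UPlus u v) Q\<^sub>1 Q\<^sub>2"
inductive_cases utyped_UCtrlE: "utyped (UCtrl u) Q\<^sub>1 Q\<^sub>2"

inductive_cases sem_TVarE: "sem \<Gamma> (TVar x) Q f"
inductive_cases sem_TStarE: "sem \<Gamma> TStar Q f"
inductive_cases sem_TZeroE: "sem \<Gamma> TZero Q f"
inductive_cases sem_TInlE: "sem \<Gamma> (TInl t) Q f"
inductive_cases sem_TInrE: "sem \<Gamma> (TInr t) Q f"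
inductive_cases sem_TSuccE: "sem \<Gamma> (TSucc t) Q f"
inductive_cases sem_TPairE: "sem \<Gamma> (TPair t s) Q f"
inductive_cases sem_TAppE: "sem \<Gamma> (TApp u t) Q f"
inductive_cases sem_TSumE: "sem \<Gamma> (TSum M) Q f"
inductive_cases usem_UMatchE: "usem (UMatch cs) Q\<^sub>1 Q\<^sub>2 f"
inductive_cases usem_UAdjE: "usem (UAdj u) Q\<^sub>1 Q\<^sub>2 f"
inductive_cases usem_UCompE: "usem (UComp u v) Q\<^sub>1 Q\<^sub>2 f"
inductive_cases usem_UTensorE: "usem (UTensor u v) Q\<^sub>1 Q\<^sub>2 f"
inductive_cases usem_UPlusE: "usem (UPlus u v) Q\<^sub>1 Q\<^sub>2 f"
inductive_cases usem_UCtrlE: "usem (UCtrl u) Q\<^sub>1 Q\<^sub>2 f"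

lemma typed_TSumD:
  assumes "typed \<Gamma> (TSum M) Q"
  shows "M \<noteq> {#}" "\<And>\<alpha> t. (\<alpha>, t) \<in># M \<Longrightarrow> typed \<Gamma> t Q"
proof -
  from assms obtain I \<alpha> t where I: "M = image_mset (\<lambda>i. (\<alpha> i, t i)) (mset_set I)" "finite (I :: nat set)"
    "\<And>i. i \<in> I \<Longrightarrow> typed \<Gamma> (t i) Q" "(\<Sum>i\<in>I. (cmod (\<alpha> i))\<^sup>2) = 1"
    by (auto elim!: typed_TSumE)
  then show "M \<noteq> {#}" by (auto simp: mset_set_empty_iff)
  show "\<And>\<alpha> t. (\<alpha>, t) \<in># M \<Longrightarrow> typed \<Gamma> t Q" using I by auto
qed

lemma sem_typed: "sem \<Gamma> t Q f \<Longrightarrow> typed \<Gamma> t Q"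
  and usem_utyped: "usem u Q\<^sub>1 Q\<^sub>2 g \<Longrightarrow> utyped u Q\<^sub>1 Q\<^sub>2"
proof (induction rule: sem_usem.inducts)
  case (umatch cs \<Gamma> Q\<^sub>1 f Q\<^sub>2 g)
  show ?case by (rule typed_utyped.umatch[of cs \<Gamma>]) (use umatch in auto)
qed (blast intro: typed_utyped.intros)+

lemma typed_ex_sem: "typed \<Gamma> t Q \<Longrightarrow> \<exists>f. sem \<Gamma> t Q f"
  and utyped_ex_usem: "utyped u Q\<^sub>1 Q\<^sub>2 \<Longrightarrow> \<exists>g. usem u Q\<^sub>1 Q\<^sub>2 g"
proof (induction rule: typed_utyped.inducts)
  case (sum I \<Gamma> t Q \<alpha>)
  then obtain f where "\<And>i. i \<in> I \<Longrightarrow> sem \<Gamma> (t i) Q (f i)" by metis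
  with sem_usem.sum[of I \<Gamma> t Q f \<alpha>] sum.hyps show ?case by blast
next
  case (umatch cs \<Gamma> Q\<^sub>1 Q\<^sub>2)
  have "\<forall>i. \<exists>f. i < length cs \<longrightarrow> sem (\<Gamma> i) (fst (cs ! i)) Q\<^sub>1 f" using umatch by blast
  then obtain f where f: "\<And>i. i < length cs \<Longrightarrow> sem (\<Gamma> i) (fst (cs ! i)) Q\<^sub>1 (f i)" by metis
  have "\<forall>i. \<exists>f. i < length cs \<longrightarrow> sem (\<Gamma> i) (snd (cs ! i)) Q\<^sub>2 f" using umatch by blast
  then obtain g where g: "\<And>i. i < length cs \<Longrightarrow> sem (\<Gamma> i) (snd (cs ! i)) Q\<^sub>2 (g i)" by metis
  show ?case
    by (rule exI, rule sem_usem.umatch[OF _ f g]) (use umatch in auto)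
qed (blast intro: sem_usem.intros)+

text \<open>Linear typing makes the domain the set of variables of the term, whatever the types are.
  Domains can therefore be compared before any types are known to agree.\<close>

lemma typed_dom_unique: "typed \<Gamma> t Q \<Longrightarrow> typed \<Gamma>' t Q' \<Longrightarrow> dom \<Gamma>' = dom \<Gamma>"
proof (induction arbitrary: \<Gamma>' Q' rule: typed_utyped.inducts(1)[where ?P2.0 = "\<lambda>_ _ _. True"])
  case (sum I \<Gamma> t Q \<alpha>)
  \<comment> \<open>The squared moduli add up to 1, so there is a summand from which to read the
    context.\<close>
  have "I \<noteq> {}" using sum by auto
  then obtain i where i: "i \<in> I" by blast
  have "typed \<Gamma>' (t i) Q'"
    using typed_TSumD(2)[OF sum.prems, of "\<alpha> i" "t i"] i sum by auto
  then show ?case using sum i by blast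
next
  case (app u Q\<^sub>1 Q\<^sub>2 \<Gamma> t)
  from app.prems show ?case by (rule typed_TAppE) (rule app.IH)
next
  case (pair \<Gamma>\<^sub>1 t\<^sub>1 Q\<^sub>1 \<Gamma>\<^sub>2 t\<^sub>2 Q\<^sub>2)
  from pair.prems show ?case by (rule typed_TPairE) (simp add: pair.IH)
next
  case (inl \<Gamma> t Q\<^sub>1 Q\<^sub>2)
  from inl.prems show ?case by (rule typed_TInlE) (rule inl.IH)
next
  case (inr \<Gamma> t Q\<^sub>2 Q\<^sub>1)
  from inr.prems show ?case by (rule typed_TInrE) (rule inr.IH)
next
  case (succ \<Gamma> t)
  from succ.prems show ?case by (rule typed_TSuccE) (rule succ.IH)
next
  case (var x Q)
  from var show ?case by (rule typed_TVarE) (simp add: dom_def)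
qed (auto elim: typed_TStarE typed_TZeroE)

lemma map_add_disjoint_cancel:
  assumes "\<Gamma>\<^sub>1 ++ \<Gamma>\<^sub>2 = \<Gamma>\<^sub>1' ++ \<Gamma>\<^sub>2'" "dom \<Gamma>\<^sub>1' = dom \<Gamma>\<^sub>1" "dom \<Gamma>\<^sub>2' = dom \<Gamma>\<^sub>2"
    and "dom \<Gamma>\<^sub>1 \<inter> dom \<Gamma>\<^sub>2 = {}"
  shows "\<Gamma>\<^sub>1' = \<Gamma>\<^sub>1 \<and> \<Gamma>\<^sub>2' = \<Gamma>\<^sub>2"
proof (intro conjI ext)
  fix x
  have *: "(\<Gamma>\<^sub>1 ++ \<Gamma>\<^sub>2) x = (\<Gamma>\<^sub>1' ++ \<Gamma>\<^sub>2') x" using assms(1) by simp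
  have d: "x \<in> dom \<Gamma>\<^sub>1' \<longleftrightarrow> x \<in> dom \<Gamma>\<^sub>1" "x \<in> dom \<Gamma>\<^sub>2' \<longleftrightarrow> x \<in> dom \<Gamma>\<^sub>2" "x \<notin> dom \<Gamma>\<^sub>1 \<or> x \<notin> dom \<Gamma>\<^sub>2"
    using assms(2-4) by auto
  show "\<Gamma>\<^sub>1' x = \<Gamma>\<^sub>1 x" "\<Gamma>\<^sub>2' x = \<Gamma>\<^sub>2 x"
    using * d by (auto simp: map_add_def dom_def split: option.splits)
qed

text \<open>The split of the context is forced: each component has the same domain in both
  derivations, and the two domains are disjoint.\<close>

lemma typed_TPair_same_ctx:
  assumes "typed \<Gamma> (TPair t s) (Tensor Q\<^sub>1 Q\<^sub>2)" "typed \<Gamma> (TPair t s) (Tensor R\<^sub>1 R\<^sub>2)"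
  obtains \<Gamma>\<^sub>1 \<Gamma>\<^sub>2 where "typed \<Gamma>\<^sub>1 t Q\<^sub>1" "typed \<Gamma>\<^sub>1 t R\<^sub>1" "typed \<Gamma>\<^sub>2 s Q\<^sub>2" "typed \<Gamma>\<^sub>2 s R\<^sub>2"
proof -
  from assms(1) obtain \<Gamma>\<^sub>1 \<Gamma>\<^sub>2 where 1: "\<Gamma> = \<Gamma>\<^sub>1 ++ \<Gamma>\<^sub>2" "typed \<Gamma>\<^sub>1 t Q\<^sub>1" "typed \<Gamma>\<^sub>2 s Q\<^sub>2"
    "dom \<Gamma>\<^sub>1 \<inter> dom \<Gamma>\<^sub>2 = {}" by (auto elim: typed_TPairE)
  from assms(2) obtain \<Gamma>\<^sub>1' \<Gamma>\<^sub>2' where 2: "\<Gamma> = \<Gamma>\<^sub>1' ++ \<Gamma>\<^sub>2'" "typed \<Gamma>\<^sub>1' t R\<^sub>1" "typed \<Gamma>\<^sub>2' s R\<^sub>2"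
    by (auto elim: typed_TPairE)
  have "\<Gamma>\<^sub>1' = \<Gamma>\<^sub>1 \<and> \<Gamma>\<^sub>2' = \<Gamma>\<^sub>2"
    using map_add_disjoint_cancel[of \<Gamma>\<^sub>1 \<Gamma>\<^sub>2 \<Gamma>\<^sub>1' \<Gamma>\<^sub>2'] typed_dom_unique[OF 1(2) 2(2)]
      typed_dom_unique[OF 1(3) 2(3)] 1 2 by simp
  then show thesis using that 1 2 by blast
qed

text \<open>The rules for basis values are among those for expressions, so the left sides of clauses
  need no separate theory.\<close>

lemma ONB_ONBe: "ONB Q S \<Longrightarrow> ONBe Q S"
  by (induction rule: ONB.induct) (blast intro: ONBe.intros)+

lemma ONBe_finite: "ONBe Q S \<Longrightarrow> finite S"
  by (induction rule: ONBe.induct) auto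

lemma ONBe_nonempty: "ONBe Q S \<Longrightarrow> S \<noteq> {}"
  by (induction rule: ONBe.induct) (auto simp: proj1_def proj2_def)

text \<open>A shared context fixes the types of variables, and the basis as a whole fixes the rest.
  Single terms would not do, as \<open>TInl t\<close> leaves the right summand open, but the set
  also contains right injections.\<close>

lemma ONBe_type_unique:
  assumes "ONBe Q S" "\<And>e. e \<in> S \<Longrightarrow> \<exists>\<Gamma>. typed \<Gamma> e Q \<and> typed \<Gamma> e Q'"
  shows "Q' = Q"
  using assms
proof (induction arbitrary: Q' rule: ONBe.induct)
  case (var Q x)
  then show ?case by (auto elim!: typed_TVarE dest: map_upd_eqD1)
next
  case star
  then show ?case by (auto elim!: typed_TStarE)
next
  case (plus Q\<^sub>1 S Q\<^sub>2 T)
  obtain s where "s \<in> S" using ONBe_nonempty[OF plus.hyps(1)] by blast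
  then obtain R\<^sub>1 R\<^sub>2 where R: "Q' = Plus R\<^sub>1 R\<^sub>2" using plus.prems[of "TInl s"] by (auto elim!: typed_TInlE)
  have "R\<^sub>1 = Q\<^sub>1"
    by (rule plus.IH) (use plus.prems[of "TInl _"] R in \<open>fastforce elim!: typed_TInlE\<close>)
  moreover have "R\<^sub>2 = Q\<^sub>2"
    by (rule plus.IH) (use plus.prems[of "TInr _"] R in \<open>fastforce elim!: typed_TInrE\<close>)
  ultimately show ?case using R by simp
next
  case (nat S)
  then show ?case by (auto elim!: typed_TZeroE)
next
  case (tensor2 S Q\<^sub>2 Q\<^sub>1)
  obtain e where "e \<in> S" using ONBe_nonempty[OF tensor2.hyps(3)] by (auto simp: proj2_def)
  then obtain R\<^sub>1 R\<^sub>2 where R: "Q' = Tensor R\<^sub>1 R\<^sub>2"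
    using tensor2.prems[of e] tensor2.hyps(2) by (auto elim!: typed_TPairE simp: pair_set_def)
  have p: "\<exists>\<Gamma>\<^sub>1 \<Gamma>\<^sub>2. typed \<Gamma>\<^sub>1 b Q\<^sub>1 \<and> typed \<Gamma>\<^sub>1 b R\<^sub>1 \<and> typed \<Gamma>\<^sub>2 b' Q\<^sub>2 \<and> typed \<Gamma>\<^sub>2 b' R\<^sub>2"
    if "TPair b b' \<in> S" for b b'
    using tensor2.prems[OF that] R typed_TPair_same_ctx by metis
  have "R\<^sub>2 = Q\<^sub>2"
    by (rule tensor2.IH(1)) (use p in \<open>auto simp: proj2_def; blast\<close>)
  moreover obtain b where b: "b \<in> proj2 S" using ONBe_nonempty[OF tensor2.hyps(3)] by blast
  have "R\<^sub>1 = Q\<^sub>1"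
    by (rule tensor2.IH(2)[OF b]) (use p in \<open>auto simp: fibre2_def; blast\<close>)
  ultimately show ?case using R by simp
next
  case (tensor1 S Q\<^sub>1 Q\<^sub>2)
  obtain e where "e \<in> S" using ONBe_nonempty[OF tensor1.hyps(3)] by (auto simp: proj1_def)
  then obtain R\<^sub>1 R\<^sub>2 where R: "Q' = Tensor R\<^sub>1 R\<^sub>2"
    using tensor1.prems[of e] tensor1.hyps(2) by (auto elim!: typed_TPairE simp: pair_set_def)
  have p: "\<exists>\<Gamma>\<^sub>1 \<Gamma>\<^sub>2. typed \<Gamma>\<^sub>1 b Q\<^sub>1 \<and> typed \<Gamma>\<^sub>1 b R\<^sub>1 \<and> typed \<Gamma>\<^sub>2 b' Q\<^sub>2 \<and> typed \<Gamma>\<^sub>2 b' R\<^sub>2"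
    if "TPair b b' \<in> S" for b b'
    using tensor1.prems[OF that] R typed_TPair_same_ctx by metis
  have "R\<^sub>1 = Q\<^sub>1"
    by (rule tensor1.IH(1)) (use p in \<open>auto simp: proj1_def; blast\<close>)
  moreover obtain b where b: "b \<in> proj1 S" using ONBe_nonempty[OF tensor1.hyps(3)] by blast
  have "R\<^sub>2 = Q\<^sub>2"
    by (rule tensor1.IH(2)[OF b]) (use p in \<open>auto simp: fibre1_def; blast\<close>)
  ultimately show ?case using R by simp
next
  case (unitary Q S A)
  obtain e where e: "e \<in> S" using ONBe_nonempty[OF unitary.hyps(1)] by blast
  obtain \<Gamma> where G: "typed \<Gamma> (LC S (A e) (\<lambda>e'. e')) Q" "typed \<Gamma> (LC S (A e) (\<lambda>e'. e')) Q'"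
    using unitary.prems e by blast
  show ?case
    by (rule unitary.IH)
       (use typed_TSumD(2)[OF G(1)] typed_TSumD(2)[OF G(2)] ONBe_finite[OF unitary.hyps(1)] in force)
qed

text \<open>The context of \<open>TApp u t\<close> is found from the source of \<open>u\<close>,
  which has to be recovered from its target; for a list of clauses, target and source are recovered
  from each other through the contexts. Hence neither half can be proved alone, and both directions
  are needed for unitaries because \<open>UAdj\<close> exchanges them.\<close>

lemma typed_ctx_unique: "typed \<Gamma> t Q \<Longrightarrow> typed \<Gamma>' t Q \<Longrightarrow> \<Gamma>' = \<Gamma>"
  and utyped_unique: "utyped u Q\<^sub>1 Q\<^sub>2 \<Longrightarrow>
    (\<forall>Q. utyped u Q\<^sub>1 Q \<longrightarrow> Q = Q\<^sub>2) \<and> (\<forall>Q. utyped u Q Q\<^sub>2 \<longrightarrow> Q = Q\<^sub>1)"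
proof (induction arbitrary: \<Gamma>' and rule: typed_utyped.inducts)
  case (pair \<Gamma>\<^sub>1 t\<^sub>1 Q\<^sub>1 \<Gamma>\<^sub>2 t\<^sub>2 Q\<^sub>2)
  from pair.prems show ?case
    using pair.IH by (auto elim!: typed_TPairE)
next
  case (sum I \<Gamma> t Q \<alpha>)
  have "I \<noteq> {}" using sum by auto
  then obtain i where i: "i \<in> I" by blast
  have "typed \<Gamma>' (t i) Q"
    using typed_TSumD(2)[OF sum.prems, of "\<alpha> i" "t i"] i sum by auto
  then show ?case using sum i by blast
next
  case (app u Q\<^sub>1 Q\<^sub>2 \<Gamma> t)
  from app.prems app.IH show ?case by (auto elim!: typed_TAppE)
next
  case (umatch cs \<Gamma> Q\<^sub>1 Q\<^sub>2)
  have "Q = Q\<^sub>2" if u: "utyped (UMatch cs) Q\<^sub>1 Q" for Q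
  proof -
    from u obtain \<Gamma>' where G: "\<And>i. i < length cs \<Longrightarrow> typed (\<Gamma>' i) (fst (cs ! i)) Q\<^sub>1"
      "\<And>i. i < length cs \<Longrightarrow> typed (\<Gamma>' i) (snd (cs ! i)) Q" by (auto elim!: utyped_UMatchE)
    \<comment> \<open>The known source type fixes the contexts of the left sides. The right sides
      then have both candidate target types in the same contexts.\<close>
    have eq: "\<Gamma>' i = \<Gamma> i" if "i < length cs" for i using umatch.IH G that by blast
    show ?thesis
    proof (rule ONBe_type_unique[OF \<open>ONBe Q\<^sub>2 (snd ` set cs)\<close>])
      fix e assume "e \<in> snd ` set cs"
      then obtain i where "i < length cs" "e = snd (cs ! i)" by (auto simp: in_set_conv_nth)
      then show "\<exists>\<Gamma>. typed \<Gamma> e Q\<^sub>2 \<and> typed \<Gamma> e Q" using G(2)[of i] umatch.hyps(3)[of i] eq[of i] by metis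
    qed
  qed
  moreover have "Q = Q\<^sub>1" if u: "utyped (UMatch cs) Q Q\<^sub>2" for Q
  proof -
    from u obtain \<Gamma>' where G: "\<And>i. i < length cs \<Longrightarrow> typed (\<Gamma>' i) (fst (cs ! i)) Q"
      "\<And>i. i < length cs \<Longrightarrow> typed (\<Gamma>' i) (snd (cs ! i)) Q\<^sub>2" by (auto elim!: utyped_UMatchE)
    have eq: "\<Gamma>' i = \<Gamma> i" if "i < length cs" for i using umatch.IH G that by blast
    show ?thesis
    proof (rule ONBe_type_unique[OF ONB_ONBe[OF \<open>ONB Q\<^sub>1 (fst ` set cs)\<close>]])
      fix e assume "e \<in> fst ` set cs"
      then obtain i where "i < length cs" "e = fst (cs ! i)" by (auto simp: in_set_conv_nth)
      then show "\<exists>\<Gamma>. typed \<Gamma> e Q\<^sub>1 \<and> typed \<Gamma> e Q" using G(1)[of i] umatch.hyps(2)[of i] eq[of i] by metis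
    qed
  qed
  ultimately show ?case by blast
next
  case (inl \<Gamma> t Q\<^sub>1 Q\<^sub>2)
  from inl.prems show ?case by (rule typed_TInlE) (use inl.IH in blast)
next
  case (inr \<Gamma> t Q\<^sub>2 Q\<^sub>1)
  from inr.prems show ?case by (rule typed_TInrE) (use inr.IH in blast)
next
  case (succ \<Gamma> t)
  from succ.prems show ?case by (rule typed_TSuccE) (use succ.IH in blast)
next
  case (uadj u Q\<^sub>1 Q\<^sub>2)
  from uadj.IH show ?case by (auto elim!: utyped_UAdjE)
next
  case (ucomp u\<^sub>1 Q\<^sub>1 Q\<^sub>2 u\<^sub>2 Q\<^sub>3)
  have "Q = Q\<^sub>3" if "utyped (UComp u\<^sub>2 u\<^sub>1) Q\<^sub>1 Q" for Q
  proof -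
    from that obtain R where R: "utyped u\<^sub>1 Q\<^sub>1 R" "utyped u\<^sub>2 R Q" by (rule utyped_UCompE)
    then have "R = Q\<^sub>2" using ucomp.IH by blast
    then show ?thesis using R ucomp.IH by blast
  qed
  moreover have "Q = Q\<^sub>1" if "utyped (UComp u\<^sub>2 u\<^sub>1) Q Q\<^sub>3" for Q
  proof -
    from that obtain R where R: "utyped u\<^sub>1 Q R" "utyped u\<^sub>2 R Q\<^sub>3" by (rule utyped_UCompE)
    then have "R = Q\<^sub>2" using ucomp.IH by blast
    then show ?thesis using R ucomp.IH by blast
  qed
  ultimately show ?case by blast
next
  case (utensor u\<^sub>1 Q\<^sub>1 Q\<^sub>2 u\<^sub>2 Q\<^sub>3 Q\<^sub>4)
  from utensor.IH show ?case by (auto elim!: utyped_UTensorE)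
next
  case (uplus u\<^sub>1 Q\<^sub>1 Q\<^sub>2 u\<^sub>2 Q\<^sub>3 Q\<^sub>4)
  from uplus.IH show ?case by (auto elim!: utyped_UPlusE)
next
  case (uctrl u Q)
  from uctrl.IH show ?case by (auto elim!: utyped_UCtrlE)
qed (auto elim: typed_TVarE typed_TStarE typed_TZeroE)


subsection \<open>Uniqueness of the interpretation\<close>

text \<open>The value depends only on the multiset of pairs, so two presentations of one sum can be
  compared without a bijection between their index sets.\<close>

lemma LC_sum_eq:
  assumes "LC I \<alpha> t = LC J \<beta> s"
  shows "(\<Sum>i\<in>I. h (\<alpha> i) (t i)) = (\<Sum>j\<in>J. h (\<beta> j) (s j))"
proof -
  have "image_mset (\<lambda>p. h (fst p) (snd p)) (image_mset (\<lambda>i. (\<alpha> i, t i)) (mset_set I))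
      = image_mset (\<lambda>p. h (fst p) (snd p)) (image_mset (\<lambda>j. (\<beta> j, s j)) (mset_set J))"
    using assms by simp
  then show ?thesis
    by (simp add: sum_unfold_sum_mset image_mset.compositionality o_def)
qed

lemma LC_memD:
  assumes "LC I \<alpha> t = LC J \<beta> s" "finite I" "finite J" "i \<in> I"
  shows "\<exists>j\<in>J. \<beta> j = \<alpha> i \<and> s j = t i"
proof -
  have "(\<alpha> i, t i) \<in># image_mset (\<lambda>i. (\<alpha> i, t i)) (mset_set I)"
    using assms(2,4) by auto
  also have "image_mset (\<lambda>i. (\<alpha> i, t i)) (mset_set I) = image_mset (\<lambda>j. (\<beta> j, s j)) (mset_set J)"
    using assms(1) by simp
  finally have "(\<alpha> i, t i) \<in># image_mset (\<lambda>j. (\<beta> j, s j)) (mset_set J)" .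
  then show ?thesis using assms(3) by auto
qed

text \<open>A derivation leaves open only the contexts, the intermediate types and the presentation
  of a sum. Uniqueness of typing settles the first two, \<open>LC_sum_eq\<close> the third.\<close>

lemma sem_unique: "sem \<Gamma> t Q f \<Longrightarrow> sem \<Gamma> t Q f' \<Longrightarrow> f' = f"
  and usem_unique: "usem u Q\<^sub>1 Q\<^sub>2 g \<Longrightarrow> usem u Q\<^sub>1 Q\<^sub>2 g' \<Longrightarrow> g' = g"
proof (induction arbitrary: f' and g' rule: sem_usem.inducts)
  case (star f') then show ?case by (auto elim: sem_TStarE)
next
  case (var x Q f') then show ?case by (auto elim!: sem_TVarE)
next
  case (pair \<Gamma>\<^sub>1 t\<^sub>1 Q\<^sub>1 f\<^sub>1 \<Gamma>\<^sub>2 t\<^sub>2 Q\<^sub>2 f\<^sub>2)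
  from pair.prems obtain \<Delta>\<^sub>1 \<Delta>\<^sub>2 h\<^sub>1 h\<^sub>2 where D: "\<Gamma>\<^sub>1 ++ \<Gamma>\<^sub>2 = \<Delta>\<^sub>1 ++ \<Delta>\<^sub>2"
    "sem \<Delta>\<^sub>1 t\<^sub>1 Q\<^sub>1 h\<^sub>1" "sem \<Delta>\<^sub>2 t\<^sub>2 Q\<^sub>2 h\<^sub>2" "f' = op_tensor_ctx \<Delta>\<^sub>1 Q\<^sub>1 \<Delta>\<^sub>2 Q\<^sub>2 h\<^sub>1 h\<^sub>2"
    by (auto elim!: sem_TPairE)
  have "\<Delta>\<^sub>1 = \<Gamma>\<^sub>1" "\<Delta>\<^sub>2 = \<Gamma>\<^sub>2"
    using typed_ctx_unique[OF sem_typed[OF pair.hyps(1)] sem_typed[OF D(2)]]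
      typed_ctx_unique[OF sem_typed[OF pair.hyps(2)] sem_typed[OF D(3)]] by auto
  then show ?case using D pair.IH by simp
next
  case (inl \<Gamma> t Q\<^sub>1 f Q\<^sub>2 f')
  from inl.prems obtain h where h: "sem \<Gamma> t Q\<^sub>1 h" "f' = compose (hctx \<Gamma>) (inj_left Q\<^sub>1) h"
    by (rule sem_TInlE) simp
  show ?case unfolding h(2) inl.IH[OF h(1)] ..
next
  case (inr \<Gamma> t Q\<^sub>2 f Q\<^sub>1 f')
  from inr.prems obtain h where h: "sem \<Gamma> t Q\<^sub>2 h" "f' = compose (hctx \<Gamma>) (inj_right Q\<^sub>2) h"
    by (rule sem_TInrE) simp
  show ?case unfolding h(2) inr.IH[OF h(1)] ..
next
  case (zero f') then show ?case by (auto elim: sem_TZeroE)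
next
  case (succ \<Gamma> t f f')
  from succ.prems obtain h where h: "sem \<Gamma> t Qnat h" "f' = compose (hctx \<Gamma>) succ_op h"
    by (rule sem_TSuccE) simp
  show ?case unfolding h(2) succ.IH[OF h(1)] ..
next
  case (sum I \<Gamma> t Q f \<alpha>)
  from sum.prems obtain J \<beta> s h where J: "LC I \<alpha> t = LC J \<beta> s" "finite (J :: nat set)"
    "\<And>j. j \<in> J \<Longrightarrow> sem \<Gamma> (s j) Q (h j)"
    "f' = (\<lambda>v\<in>hctx \<Gamma>. \<lambda>l. \<Sum>j\<in>J. \<beta> j * h j v l)"
    by (auto elim!: sem_TSumE)
  \<comment> \<open>To compare the two multisets, the interpretation of a summand must be a function
    of the term instead of the index. By the induction hypothesis the choice can only return
    \<open>f i\<close> at \<open>t i\<close>.\<close>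
  define F where "F = (\<lambda>r. SOME f. sem \<Gamma> r Q f)"
  have F1: "F (t i) = f i" if "i \<in> I" for i
    unfolding F_def using sum that by (blast intro: some_equality)
  have F2: "F (s j) = h j" if j: "j \<in> J" for j
  proof -
    obtain i where i: "i \<in> I" "t i = s j" using LC_memD[OF J(1)[symmetric] J(2) sum.hyps(1) j] by blast
    then show ?thesis using F1[OF i(1)] sum.IH[of i "h j"] J(3)[OF j] by simp
  qed
  have "(\<Sum>i\<in>I. \<alpha> i * f i v l) = (\<Sum>j\<in>J. \<beta> j * h j v l)" for v l
    using LC_sum_eq[OF J(1), of "\<lambda>a r. a * F r v l"] F1 F2 by simp
  then show ?case using J by simp
next
  case (app u Q\<^sub>1 Q\<^sub>2 g \<Gamma> t f)
  from app.prems obtain R g' h where R: "usem u R Q\<^sub>2 g'" "sem \<Gamma> t R h" "f' = compose (hctx \<Gamma>) g' h"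
    by (auto elim!: sem_TAppE)
  have "R = Q\<^sub>1" using utyped_unique usem_utyped app.hyps R by blast
  then show ?case using R app.IH by simp
next
  case (umatch cs \<Gamma> Q\<^sub>1 f Q\<^sub>2 g)
  from umatch.prems obtain \<Delta> h k where D:
    "\<And>i. i < length cs \<Longrightarrow> sem (\<Delta> i) (fst (cs ! i)) Q\<^sub>1 (h i)"
    "\<And>i. i < length cs \<Longrightarrow> sem (\<Delta> i) (snd (cs ! i)) Q\<^sub>2 (k i)"
    "g' = (\<lambda>v\<in>hty Q\<^sub>1. \<lambda>l. \<Sum>i<length cs. k i (adj (hctx (\<Delta> i)) (hty Q\<^sub>1) (h i) v) l)"
    by (auto elim!: usem_UMatchE)
  have "\<Delta> i = \<Gamma> i \<and> h i = f i \<and> k i = g i" if i: "i < length cs" for i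
  proof -
    have "\<Delta> i = \<Gamma> i" using typed_ctx_unique sem_typed umatch.hyps D i by blast
    then show ?thesis using umatch.IH[OF i] D(1,2)[OF i] by simp
  qed
  then show ?case unfolding D(3) by (intro restrict_ext ext sum.cong) auto
next
  case (uadj u Q\<^sub>1 Q\<^sub>2 f g')
  from uadj.prems obtain h where h: "usem u Q\<^sub>1 Q\<^sub>2 h" "g' = adj (hty Q\<^sub>1) (hty Q\<^sub>2) h"
    by (rule usem_UAdjE)
  show ?case unfolding h(2) uadj.IH[OF h(1)] ..
next
  case (ucomp u\<^sub>1 Q\<^sub>1 Q\<^sub>2 f u\<^sub>2 Q\<^sub>3 g)
  from ucomp.prems obtain R h k where R: "usem u\<^sub>1 Q\<^sub>1 R h" "usem u\<^sub>2 R Q\<^sub>3 k" "g' = compose (hty Q\<^sub>1) k h"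
    by (auto elim!: usem_UCompE)
  have "R = Q\<^sub>2" using utyped_unique usem_utyped ucomp.hyps R by blast
  have "h = f" "k = g" using R ucomp.IH \<open>R = Q\<^sub>2\<close> by blast+
  then show ?case using R by simp
next
  case (utensor u\<^sub>1 Q\<^sub>1 Q\<^sub>2 f u\<^sub>2 Q\<^sub>3 Q\<^sub>4 g g')
  from utensor.prems obtain h k where h: "usem u\<^sub>1 Q\<^sub>1 Q\<^sub>2 h" "usem u\<^sub>2 Q\<^sub>3 Q\<^sub>4 k"
    "g' = op_tensor_ty Q\<^sub>1 Q\<^sub>2 Q\<^sub>3 Q\<^sub>4 h k"
    by (rule usem_UTensorE) simp
  show ?case unfolding h(3) utensor.IH(1)[OF h(1)] utensor.IH(2)[OF h(2)] ..
next
  case (uplus u\<^sub>1 Q\<^sub>1 Q\<^sub>2 f u\<^sub>2 Q\<^sub>3 Q\<^sub>4 g g')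
  from uplus.prems obtain h k where h: "usem u\<^sub>1 Q\<^sub>1 Q\<^sub>2 h" "usem u\<^sub>2 Q\<^sub>3 Q\<^sub>4 k"
    "g' = op_plus Q\<^sub>1 Q\<^sub>3 h k"
    by (rule usem_UPlusE) simp
  show ?case unfolding h(3) uplus.IH(1)[OF h(1)] uplus.IH(2)[OF h(2)] ..
next
  case (uctrl u Q f g')
  from uctrl.prems obtain h where h: "usem u Q Q h" "g' = ctrl_op Q h"
    by (rule usem_UCtrlE) simp
  show ?case unfolding h(2) uctrl.IH[OF h(1)] ..
qed

text \<open>Inverting the sum rule yields some family over natural numbers presenting the same
  multiset. This carries it back to the given index set, which may itself be a set of terms.\<close>

lemma sem_LC:
  assumes f: "sem \<Gamma> (LC J \<beta> s) Q f" and J: "finite J"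
  shows "\<exists>F. (\<forall>j\<in>J. sem \<Gamma> (s j) Q (F j)) \<and> (\<Sum>j\<in>J. (cmod (\<beta> j))\<^sup>2) = 1 \<and>
    f = (\<lambda>v\<in>hctx \<Gamma>. \<lambda>l. \<Sum>j\<in>J. \<beta> j * F j v l)"
proof -
  from f obtain I \<alpha> t h where I: "LC J \<beta> s = LC I \<alpha> t" "finite (I :: nat set)"
    "\<And>i. i \<in> I \<Longrightarrow> sem \<Gamma> (t i) Q (h i)" "(\<Sum>i\<in>I. (cmod (\<alpha> i))\<^sup>2) = 1"
    "f = (\<lambda>v\<in>hctx \<Gamma>. \<lambda>l. \<Sum>i\<in>I. \<alpha> i * h i v l)"
    by (auto elim!: sem_TSumE)
  define F where "F = (\<lambda>r. SOME f. sem \<Gamma> r Q f)"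
  have F: "sem \<Gamma> (s j) Q (F (s j))" if "j \<in> J" for j
    using LC_memD[OF I(1) J I(2) that] I(3) unfolding F_def by (metis someI)
  have F2: "F (t i) = h i" if "i \<in> I" for i
    unfolding F_def using I(3)[OF that] sem_unique by (blast intro: some_equality)
  have "(\<Sum>j\<in>J. \<beta> j * F (s j) v l) = (\<Sum>i\<in>I. \<alpha> i * h i v l)" for v l
    using LC_sum_eq[OF I(1), of "\<lambda>a r. a * F r v l"] F2 by simp
  moreover have "(\<Sum>j\<in>J. (cmod (\<beta> j))\<^sup>2) = 1"
    using LC_sum_eq[OF I(1), of "\<lambda>a r. (cmod a)\<^sup>2"] I(4) by simp
  ultimately show ?thesis using F I(5) by (intro exI[of _ "\<lambda>j. F (s j)"]) simp
qed


subsection \<open>The concrete operators\<close>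

lemma isom_mono: "isom H (ell2 D) f \<Longrightarrow> D \<subseteq> D' \<Longrightarrow> isom H (ell2 D') f"
  unfolding isom_def bop_def using ell2_mono by fastforce

text \<open>Recognises a pullback along a bijection followed by extension by zero, which covers all
  the concrete embeddings.\<close>

lemma isom_reindex_eq:
  assumes "bij_betw \<psi> D C" "D \<subseteq> D'" "\<And>v. v \<in> ell2 C \<Longrightarrow> f v = (\<lambda>d. if d \<in> D then v (\<psi> d) else 0)"
    and "f \<in> extensional (ell2 C)"
  shows "isom (ell2 C) (ell2 D') f"
proof -
  have "f = reindex_op \<psi> C D"
    using assms(3,4) by (intro extensionalityI[of f "ell2 C"]) (auto simp: reindex_op_def)
  then show ?thesis using isom_mono[OF reindex_op_isom[OF assms(1)] assms(2)] by simp
qed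

section \<open>Small contexts and the basic embeddings\<close>

lemma basis_ctx_empty: "basis_ctx Map.empty = {Map.empty}"
  by (auto simp: basis_ctx_def)

lemma basis_ctx_single: "basis_ctx [x \<mapsto> Q] = (\<lambda>l. [x \<mapsto> l]) ` basis Q"
proof
  show "basis_ctx [x \<mapsto> Q] \<subseteq> (\<lambda>l. [x \<mapsto> l]) ` basis Q"
  proof
    fix \<rho> assume r: "\<rho> \<in> basis_ctx [x \<mapsto> Q]"
    then have d: "dom \<rho> = {x}" by (simp add: basis_ctx_def dom_def)
    then obtain l where l: "\<rho> x = Some l" by blast
    have "\<rho> = [x \<mapsto> l]" using d l by (auto simp: dom_def fun_eq_iff)
    moreover have "l \<in> basis Q" using r l by (auto simp: basis_ctx_def)
    ultimately show "\<rho> \<in> (\<lambda>l. [x \<mapsto> l]) ` basis Q" by blast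
  qed
qed (auto simp: basis_ctx_def dom_def split: if_splits)

lemma unit_ket_isom:
  assumes "b \<in> basis Q"
  shows "isom (hctx Map.empty) (hty Q) (\<lambda>v\<in>hctx Map.empty. \<lambda>l. v Map.empty * ket b l)"
  unfolding hctx_def hty_def basis_ctx_empty
  by (rule isom_reindex_eq[of "\<lambda>_. Map.empty" "{b}"])
     (use assms in \<open>auto simp: bij_betw_def ket_def\<close>)

text \<open>Surjectivity is the reason why one variable forms an orthonormal basis of any
  type.\<close>

lemma var_isom: "isom (hctx [x \<mapsto> Q]) (hty Q) (\<lambda>v\<in>hctx [x \<mapsto> Q]. \<lambda>l. v [x \<mapsto> l])"
  and var_surj: "w \<in> hty Q \<Longrightarrow> \<exists>v\<in>hctx [x \<mapsto> Q]. w = (\<lambda>v\<in>hctx [x \<mapsto> Q]. \<lambda>l. v [x \<mapsto> l]) v"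
proof -
  have inj: "[x \<mapsto> l] = [x \<mapsto> l'] \<longleftrightarrow> l = l'" for l l' :: label
    by (metis map_upd_eqD1)
  have b: "bij_betw (\<lambda>l. [x \<mapsto> l]) (basis Q) (basis_ctx [x \<mapsto> Q])"
    unfolding basis_ctx_single by (auto simp: bij_betw_def inj_on_def inj)
  show 1: "isom (hctx [x \<mapsto> Q]) (hty Q) (\<lambda>v\<in>hctx [x \<mapsto> Q]. \<lambda>l. v [x \<mapsto> l])"
    unfolding hctx_def hty_def
  proof (rule isom_reindex_eq[OF b subset_refl])
    fix v assume v: "v \<in> ell2 (basis_ctx [x \<mapsto> Q])"
    \<comment> \<open>The interpretation of a variable has no guard, but for a label outside
      \<open>basis Q\<close> the environment lies outside the basis of the context, where
      \<open>v\<close> vanishes.\<close>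
    have "v [x \<mapsto> l] = 0" if "l \<notin> basis Q" for l
      using that by (intro ell2_outside[OF v]) (auto simp: basis_ctx_single inj)
    then show "(\<lambda>v\<in>ell2 (basis_ctx [x \<mapsto> Q]). \<lambda>l. v [x \<mapsto> l]) v
        = (\<lambda>d. if d \<in> basis Q then v [x \<mapsto> d] else 0)"
      using v by auto
  qed simp
  assume w: "w \<in> hty Q"
  let ?i = "inv_into (basis Q) (\<lambda>l. [x \<mapsto> l])"
  define v where "v = reindex_op ?i (basis Q) (basis_ctx [x \<mapsto> Q]) w"
  have v: "v \<in> hctx [x \<mapsto> Q]"
    unfolding v_def hctx_def using w
    by (intro bop_in[OF isom_bop[OF reindex_op_isom[OF bij_betw_inv_into[OF b]]]]) (simp add: hty_def)
  have "w l = v [x \<mapsto> l]" for l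
  proof (cases "l \<in> basis Q")
    case True
    then show ?thesis
      using w bij_betw_inv_into_left[OF b True] by (simp add: v_def reindex_op_def hty_def basis_ctx_single)
  next
    case False
    then have "[x \<mapsto> l] \<notin> basis_ctx [x \<mapsto> Q]" by (auto simp: basis_ctx_single inj)
    then show ?thesis using False w v by (simp add: ell2_outside hty_def hctx_def)
  qed
  then show "\<exists>v\<in>hctx [x \<mapsto> Q]. w = (\<lambda>v\<in>hctx [x \<mapsto> Q]. \<lambda>l. v [x \<mapsto> l]) v"
    using v by (intro bexI[of _ v]) auto
qed

lemma inj_left_isom: "isom (hty Q\<^sub>1) (hty (Plus Q\<^sub>1 Q\<^sub>2)) (inj_left Q\<^sub>1)"
  unfolding hty_def
  by (rule isom_reindex_eq[of "\<lambda>l. case l of LInl a \<Rightarrow> a" "LInl ` basis Q\<^sub>1"])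
     (auto simp: bij_betw_def inj_on_def inj_left_def hty_def fun_eq_iff ell2_outside image_iff
       split: label.splits)

lemma inj_right_isom: "isom (hty Q\<^sub>2) (hty (Plus Q\<^sub>1 Q\<^sub>2)) (inj_right Q\<^sub>2)"
  unfolding hty_def
  by (rule isom_reindex_eq[of "\<lambda>l. case l of LInr a \<Rightarrow> a" "LInr ` basis Q\<^sub>2"])
     (auto simp: bij_betw_def inj_on_def inj_right_def hty_def fun_eq_iff ell2_outside image_iff
       split: label.splits)

lemma succ_op_isom: "isom (hty Qnat) (hty Qnat) succ_op"
  unfolding hty_def
proof (rule isom_reindex_eq[of "\<lambda>l. case l of LNat (Suc n) \<Rightarrow> LNat n" "range (\<lambda>n. LNat (Suc n))"])
  show "bij_betw (\<lambda>l. case l of LNat (Suc n) \<Rightarrow> LNat n) (range (\<lambda>n. LNat (Suc n))) (basis Qnat)"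
    by (auto simp: bij_betw_def inj_on_def image_image)
qed (auto simp: succ_op_def hty_def fun_eq_iff split: label.splits nat.splits)

lemma inner2_disjoint: "(\<And>x. v x = 0 \<or> w x = 0) \<Longrightarrow> inner2 v w = 0"
  unfolding inner2_def by (rule infsum_0) auto

section \<open>Tensor products of types and of contexts\<close>

lemma pairing_ty: "pairing (basis Q\<^sub>1) (basis Q\<^sub>2) (basis (Tensor Q\<^sub>1 Q\<^sub>2)) LPair vtensor"
  by standard (auto simp: bij_betw_def inj_on_def vtensor_def ell2_outside split: label.splits)

lemma map_add_restrict_disjoint:
  assumes "dom \<rho>\<^sub>1 \<inter> dom \<rho>\<^sub>2 = {}"
  shows "(\<rho>\<^sub>1 ++ \<rho>\<^sub>2) |` dom \<rho>\<^sub>1 = \<rho>\<^sub>1" "(\<rho>\<^sub>1 ++ \<rho>\<^sub>2) |` dom \<rho>\<^sub>2 = \<rho>\<^sub>2"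
proof -
  have "\<rho>\<^sub>1 x = None \<or> \<rho>\<^sub>2 x = None" for x using assms by (auto simp: dom_def)
  then show "(\<rho>\<^sub>1 ++ \<rho>\<^sub>2) |` dom \<rho>\<^sub>1 = \<rho>\<^sub>1" "(\<rho>\<^sub>1 ++ \<rho>\<^sub>2) |` dom \<rho>\<^sub>2 = \<rho>\<^sub>2"
    by (auto simp: fun_eq_iff restrict_map_def map_add_def dom_def split: option.splits) (metis option.distinct(1))+
qed

lemma basis_ctx_dom: "\<rho> \<in> basis_ctx \<Gamma> \<Longrightarrow> dom \<rho> = dom \<Gamma>"
  by (simp add: basis_ctx_def)

lemma basis_ctx_add:
  assumes "dom \<Gamma>\<^sub>1 \<inter> dom \<Gamma>\<^sub>2 = {}" "\<rho>\<^sub>1 \<in> basis_ctx \<Gamma>\<^sub>1" "\<rho>\<^sub>2 \<in> basis_ctx \<Gamma>\<^sub>2"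
  shows "\<rho>\<^sub>1 ++ \<rho>\<^sub>2 \<in> basis_ctx (\<Gamma>\<^sub>1 ++ \<Gamma>\<^sub>2)"
proof -
  have d: "dom \<rho>\<^sub>1 = dom \<Gamma>\<^sub>1" "dom \<rho>\<^sub>2 = dom \<Gamma>\<^sub>2" using assms by (auto simp: basis_ctx_def)
  have "a \<in> basis Q" if "(\<Gamma>\<^sub>1 ++ \<Gamma>\<^sub>2) x = Some Q" "(\<rho>\<^sub>1 ++ \<rho>\<^sub>2) x = Some a" for x Q a
  proof (cases "x \<in> dom \<Gamma>\<^sub>2")
    case True
    then have "\<Gamma>\<^sub>2 x = Some Q" "\<rho>\<^sub>2 x = Some a" using that d by (auto simp: map_add_def split: option.splits)
    then show ?thesis using assms(3) by (auto simp: basis_ctx_def)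
  next
    case False
    then have "x \<notin> dom \<rho>\<^sub>2" using d by simp
    with False have "\<Gamma>\<^sub>2 x = None" "\<rho>\<^sub>2 x = None" by auto
    then have "\<Gamma>\<^sub>1 x = Some Q" "\<rho>\<^sub>1 x = Some a" using that by (auto simp: map_add_def)
    then show ?thesis using assms(2) by (auto simp: basis_ctx_def)
  qed
  then show ?thesis using d by (auto simp: basis_ctx_def)
qed

lemma basis_ctx_restrict:
  assumes "dom \<Gamma>\<^sub>1 \<inter> dom \<Gamma>\<^sub>2 = {}" "\<rho> \<in> basis_ctx (\<Gamma>\<^sub>1 ++ \<Gamma>\<^sub>2)"
  shows "\<rho> |` dom \<Gamma>\<^sub>1 \<in> basis_ctx \<Gamma>\<^sub>1" "\<rho> |` dom \<Gamma>\<^sub>2 \<in> basis_ctx \<Gamma>\<^sub>2"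
    "\<rho> |` dom \<Gamma>\<^sub>1 ++ \<rho> |` dom \<Gamma>\<^sub>2 = \<rho>"
proof -
  have d: "dom \<rho> = dom \<Gamma>\<^sub>1 \<union> dom \<Gamma>\<^sub>2" using assms by (auto simp: basis_ctx_def)
  have b: "a \<in> basis Q" if "(\<Gamma>\<^sub>1 ++ \<Gamma>\<^sub>2) x = Some Q" "\<rho> x = Some a" for x Q a
    using assms(2) that by (auto simp: basis_ctx_def)
  have b1: "a \<in> basis Q" if "\<Gamma>\<^sub>1 x = Some Q" "\<rho> x = Some a" for x Q a
    using assms(1) that by (intro b[of x]) (auto simp: map_add_Some_iff dom_def)
  have b2: "a \<in> basis Q" if "\<Gamma>\<^sub>2 x = Some Q" "\<rho> x = Some a" for x Q a
    using that by (intro b[of x]) (auto simp: map_add_Some_iff)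
  have "dom (\<rho> |` dom \<Gamma>\<^sub>1) = dom \<Gamma>\<^sub>1" "dom (\<rho> |` dom \<Gamma>\<^sub>2) = dom \<Gamma>\<^sub>2" using d by auto
  then show "\<rho> |` dom \<Gamma>\<^sub>1 \<in> basis_ctx \<Gamma>\<^sub>1" "\<rho> |` dom \<Gamma>\<^sub>2 \<in> basis_ctx \<Gamma>\<^sub>2"
    using b1 b2 unfolding basis_ctx_def by (auto simp: restrict_map_def split: if_splits)
  show "\<rho> |` dom \<Gamma>\<^sub>1 ++ \<rho> |` dom \<Gamma>\<^sub>2 = \<rho>"
  proof
    fix x
    have "x \<notin> dom \<Gamma>\<^sub>1 \<union> dom \<Gamma>\<^sub>2 \<Longrightarrow> \<rho> x = None" using d by blast
    then show "(\<rho> |` dom \<Gamma>\<^sub>1 ++ \<rho> |` dom \<Gamma>\<^sub>2) x = \<rho> x"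
      by (cases "x \<in> dom \<Gamma>\<^sub>2"; cases "x \<in> dom \<Gamma>\<^sub>1")
         (simp_all add: map_add_def restrict_map_def split: option.split)
  qed
qed

lemma pairing_ctx:
  assumes d: "dom \<Gamma>\<^sub>1 \<inter> dom \<Gamma>\<^sub>2 = {}"
  shows "pairing (basis_ctx \<Gamma>\<^sub>1) (basis_ctx \<Gamma>\<^sub>2) (basis_ctx (\<Gamma>\<^sub>1 ++ \<Gamma>\<^sub>2)) (++) (etensor \<Gamma>\<^sub>1 \<Gamma>\<^sub>2)"
proof
  have r: "(\<rho>\<^sub>1 ++ \<rho>\<^sub>2) |` dom \<Gamma>\<^sub>1 = \<rho>\<^sub>1" "(\<rho>\<^sub>1 ++ \<rho>\<^sub>2) |` dom \<Gamma>\<^sub>2 = \<rho>\<^sub>2"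
    if "\<rho>\<^sub>1 \<in> basis_ctx \<Gamma>\<^sub>1" "\<rho>\<^sub>2 \<in> basis_ctx \<Gamma>\<^sub>2" for \<rho>\<^sub>1 \<rho>\<^sub>2
    using map_add_restrict_disjoint[of \<rho>\<^sub>1 \<rho>\<^sub>2] d that by (simp_all add: basis_ctx_dom)
  show "bij_betw (\<lambda>(a, b). a ++ b) (basis_ctx \<Gamma>\<^sub>1 \<times> basis_ctx \<Gamma>\<^sub>2) (basis_ctx (\<Gamma>\<^sub>1 ++ \<Gamma>\<^sub>2))"
    by (rule bij_betw_byWitness[where f' = "\<lambda>\<rho>. (\<rho> |` dom \<Gamma>\<^sub>1, \<rho> |` dom \<Gamma>\<^sub>2)"])
       (auto simp: r basis_ctx_add[OF d] basis_ctx_restrict[OF d])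
  show "etensor \<Gamma>\<^sub>1 \<Gamma>\<^sub>2 v w (a ++ b) = v a * w b"
    if "a \<in> basis_ctx \<Gamma>\<^sub>1" "b \<in> basis_ctx \<Gamma>\<^sub>2" for v w a b
    using that by (simp add: etensor_def r basis_ctx_add[OF d])
qed (simp add: etensor_def)

lemma ty_row: "v \<in> hty (Tensor Q\<^sub>1 Q\<^sub>2) \<Longrightarrow> pairing.row (basis Q\<^sub>1) (basis Q\<^sub>2) LPair v a = (\<lambda>b. v (LPair a b))"
  unfolding pairing.row_def[OF pairing_ty] hty_def by (auto simp: fun_eq_iff ell2_outside)

lemma ty_row_in: "v \<in> hty (Tensor Q\<^sub>1 Q\<^sub>2) \<Longrightarrow> (\<lambda>b. v (LPair a b)) \<in> hty Q\<^sub>2"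
  using pairing.row_in[OF pairing_ty, of v Q\<^sub>1 Q\<^sub>2 a] ty_row[of v Q\<^sub>1 Q\<^sub>2 a] by (simp add: hty_def)

lemma ty_col_in:
  assumes v: "v \<in> hty (Tensor Q\<^sub>1 Q\<^sub>2)" shows "(\<lambda>a. v (LPair a b)) \<in> hty Q\<^sub>1"
proof -
  note flip = pairing.pairing_flip[OF pairing_ty]
  have "pairing.row (basis Q\<^sub>2) (basis Q\<^sub>1) (\<lambda>b a. LPair a b) v b = (\<lambda>a. v (LPair a b))"
    using v unfolding pairing.row_def[OF flip] hty_def by (auto simp: fun_eq_iff ell2_outside)
  then show ?thesis using pairing.row_in[OF flip, of v Q\<^sub>1 Q\<^sub>2 b] v by (simp add: hty_def)
qed

lemma ty_inner2_rows:
  assumes "v \<in> hty (Tensor Q\<^sub>1 Q\<^sub>2)" "w \<in> hty (Tensor Q\<^sub>1 Q\<^sub>2)"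
  shows "inner2 v w = (\<Sum>\<^sub>\<infinity>a. inner2 (\<lambda>b. v (LPair a b)) (\<lambda>b. w (LPair a b)))"
  using pairing.inner2_rows[OF pairing_ty, of v Q\<^sub>1 Q\<^sub>2 w] assms ty_row[OF assms(1)] ty_row[OF assms(2)]
  by (simp add: hty_def)

lemma ty_inner2_cols:
  assumes "v \<in> hty (Tensor Q\<^sub>1 Q\<^sub>2)" "w \<in> hty (Tensor Q\<^sub>1 Q\<^sub>2)"
  shows "inner2 v w = (\<Sum>\<^sub>\<infinity>b. inner2 (\<lambda>a. v (LPair a b)) (\<lambda>a. w (LPair a b)))"
  using pairing.inner2_cols[OF pairing_ty, of v Q\<^sub>1 Q\<^sub>2 w] assms ty_row[OF assms(1)] ty_row[OF assms(2)]
  by (simp add: hty_def)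

lemma ty_norm2_rows:
  assumes "v \<in> hty (Tensor Q\<^sub>1 Q\<^sub>2)"
  shows "(norm2 v)\<^sup>2 = (\<Sum>\<^sub>\<infinity>a. (norm2 (\<lambda>b. v (LPair a b)))\<^sup>2)"
  using pairing.norm2_rows[OF pairing_ty, of v Q\<^sub>1 Q\<^sub>2] assms ty_row[OF assms] by (simp add: hty_def)

text \<open>Isometry is inherited from the factors. For surjectivity, the tensor product of the
  adjoints provides the preimage, since each factor composed with its adjoint fixes every vector of
  its target.\<close>

lemma op_tensor_unitary:
  assumes f: "unitary_op (hty Q\<^sub>1) (hty Q\<^sub>2) f" and g: "unitary_op (hty Q\<^sub>3) (hty Q\<^sub>4) g"
  shows "unitary_op (hty (Tensor Q\<^sub>1 Q\<^sub>3)) (hty (Tensor Q\<^sub>2 Q\<^sub>4)) (op_tensor_ty Q\<^sub>1 Q\<^sub>2 Q\<^sub>3 Q\<^sub>4 f g)"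
proof -
  interpret ab: pairing2 "basis Q\<^sub>1" "basis Q\<^sub>3" "basis (Tensor Q\<^sub>1 Q\<^sub>3)" LPair vtensor
      "basis Q\<^sub>2" "basis Q\<^sub>4" "basis (Tensor Q\<^sub>2 Q\<^sub>4)" LPair vtensor
    by (intro pairing2.intro pairing_ty)
  interpret ba: pairing2 "basis Q\<^sub>2" "basis Q\<^sub>4" "basis (Tensor Q\<^sub>2 Q\<^sub>4)" LPair vtensor
      "basis Q\<^sub>1" "basis Q\<^sub>3" "basis (Tensor Q\<^sub>1 Q\<^sub>3)" LPair vtensor
    by (intro pairing2.intro pairing_ty)
  note fi = unitary_op_isom[OF f, unfolded hty_def] and gi = unitary_op_isom[OF g, unfolded hty_def]
  note fb = isom_bop[OF fi] and gb = isom_bop[OF gi]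
  have eq: "op_tensor_ty Q\<^sub>1 Q\<^sub>2 Q\<^sub>3 Q\<^sub>4 f g = ab.tensor f g"
    unfolding hty_def by (rule op_tensor_eq[OF ab.pairing2_axioms fb gb])
  have i: "isom (hty (Tensor Q\<^sub>1 Q\<^sub>3)) (hty (Tensor Q\<^sub>2 Q\<^sub>4)) (ab.tensor f g)"
    unfolding hty_def by (rule ab.tensor_isom[OF fi gi])
  let ?f' = "adj (ell2 (basis Q\<^sub>1)) (ell2 (basis Q\<^sub>2)) f" and ?g' = "adj (ell2 (basis Q\<^sub>3)) (ell2 (basis Q\<^sub>4)) g"
  note fa = adj_bop[OF fb] and ga = adj_bop[OF gb]
  have "w \<in> ab.tensor f g ` hty (Tensor Q\<^sub>1 Q\<^sub>3)" if w: "w \<in> hty (Tensor Q\<^sub>2 Q\<^sub>4)" for w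
  proof (rule image_eqI)
    have w': "w \<in> ell2 (basis (Tensor Q\<^sub>2 Q\<^sub>4))" using w by (simp add: hty_def)
    interpret bb: pairing2 "basis Q\<^sub>2" "basis Q\<^sub>4" "basis (Tensor Q\<^sub>2 Q\<^sub>4)" LPair vtensor
        "basis Q\<^sub>2" "basis Q\<^sub>4" "basis (Tensor Q\<^sub>2 Q\<^sub>4)" LPair vtensor
      by (intro pairing2.intro pairing_ty)
    show "ba.tensor ?f' ?g' w \<in> hty (Tensor Q\<^sub>1 Q\<^sub>3)"
      unfolding hty_def by (rule bop_in[OF ba.tensor_bop[OF fa ga] w'])
    have cf: "compose (ell2 (basis Q\<^sub>2)) f ?f' \<in> bop (ell2 (basis Q\<^sub>2)) (ell2 (basis Q\<^sub>2))"
      and cg: "compose (ell2 (basis Q\<^sub>4)) g ?g' \<in> bop (ell2 (basis Q\<^sub>4)) (ell2 (basis Q\<^sub>4))"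
      by (intro bop_compose[OF fa fb] bop_compose[OF ga gb])+
    have "ab.tensor f g (ba.tensor ?f' ?g' w) = bb.tensor (compose (ell2 (basis Q\<^sub>2)) f ?f') (compose (ell2 (basis Q\<^sub>4)) g ?g') w"
      by (rule tensor_compose[OF ba.pairing2_axioms ab.pairing2_axioms fa ga fb gb w'])
    also have "\<dots> = w"
    proof (rule ab.cod.ell2_D_eqI[OF bop_in[OF bb.tensor_bop[OF cf cg] w'] w'])
      fix a b assume ab: "a \<in> basis Q\<^sub>2" "b \<in> basis Q\<^sub>4"
      have gr: "compose (ell2 (basis Q\<^sub>4)) g ?g' (ab.cod.row w a) = ab.cod.row w a" for a
        using ab.cod.row_in[OF w'] unitary_op_adj_right[OF g[unfolded hty_def]] by (simp add: compose_eq)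
      \<comment> \<open>\<open>row_image_in\<close> applies to columns of images; here the operator
        applied to the rows leaves them fixed, so the column of \<open>w\<close> itself is
        obtained.\<close>
      have "(\<lambda>a. ab.cod.row w a b) \<in> ell2 (basis Q\<^sub>2)"
        using bb.row_image_in[OF cg w'] gr by simp
      then have "compose (ell2 (basis Q\<^sub>2)) f ?f' (\<lambda>a. ab.cod.row w a b) = (\<lambda>a. ab.cod.row w a b)"
        using unitary_op_adj_right[OF f[unfolded hty_def]] by (simp add: compose_eq)
      then show "bb.tensor (compose (ell2 (basis Q\<^sub>2)) f ?f') (compose (ell2 (basis Q\<^sub>4)) g ?g') w (LPair a b) = w (LPair a b)"
        unfolding bb.tensor_apply[OF cf cg w' ab] gr using ab by (simp add: ab.cod.row_def)
    qed
    finally show "w = ab.tensor f g (ba.tensor ?f' ?g' w)" ..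
  qed
  then show ?thesis unfolding eq unitary_op_def using i by blast
qed

section \<open>Direct sums\<close>

lemma hty_Plus_components:
  assumes v: "v \<in> hty (Plus Q\<^sub>1 Q\<^sub>2)"
  shows "(\<lambda>b. v (LInl b)) \<in> hty Q\<^sub>1" "(\<lambda>b. v (LInr b)) \<in> hty Q\<^sub>2"
    and "v = (\<lambda>l. inj_left Q\<^sub>1 (\<lambda>b. v (LInl b)) l + inj_right Q\<^sub>2 (\<lambda>b. v (LInr b)) l)"
proof -
  have s: "(\<lambda>x. (cmod (v x))\<^sup>2) summable_on S" for S
    using ell2_summable[of v] v summable_on_subset_banach unfolding hty_def by blast
  have "(\<lambda>x. (cmod (v (LInl x)))\<^sup>2) summable_on UNIV" "(\<lambda>x. (cmod (v (LInr x)))\<^sup>2) summable_on UNIV"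
    using s[of "range LInl"] s[of "range LInr"]
    by (simp_all add: summable_on_reindex inj_on_def o_def)
  then show 1: "(\<lambda>b. v (LInl b)) \<in> hty Q\<^sub>1" "(\<lambda>b. v (LInr b)) \<in> hty Q\<^sub>2"
    using v by (auto simp: hty_def ell2_def)
  have 0: "v l = 0" if "l \<notin> range LInl \<union> range LInr" for l
    using v that by (auto simp: hty_def ell2_def)
  show "v = (\<lambda>l. inj_left Q\<^sub>1 (\<lambda>b. v (LInl b)) l + inj_right Q\<^sub>2 (\<lambda>b. v (LInr b)) l)"
    using 1 0 by (auto simp: inj_left_def inj_right_def fun_eq_iff image_iff split: label.split)
qed

text \<open>Pythagoras, as the two injected vectors have disjoint supports.\<close>

lemma norm2_Plus:
  assumes x: "x \<in> hty Q\<^sub>1" and y: "y \<in> hty Q\<^sub>2"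
  shows "(norm2 (\<lambda>l. inj_left Q\<^sub>1 x l + inj_right Q\<^sub>2 y l))\<^sup>2 = (norm2 x)\<^sup>2 + (norm2 y)\<^sup>2"
proof -
  have i: "inj_left Q\<^sub>1 x \<in> ell2 (basis (Plus Q\<^sub>1 Q\<^sub>2))" "inj_right Q\<^sub>2 y \<in> ell2 (basis (Plus Q\<^sub>1 Q\<^sub>2))"
    using bop_in[OF isom_bop[OF inj_left_isom] x, of Q\<^sub>2] bop_in[OF isom_bop[OF inj_right_isom] y, of Q\<^sub>1]
    unfolding hty_def by blast+
  have "inner2 (inj_left Q\<^sub>1 x) (inj_right Q\<^sub>2 y) = 0"
    using x y by (intro inner2_disjoint) (auto simp: inj_left_def inj_right_def split: label.split)
  then show ?thesis
    using norm2_sq_add_scaled[OF i, of 1] isom_norm[OF inj_left_isom x] isom_norm[OF inj_right_isom y]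
    by simp
qed

text \<open>Replaces the case distinction on labels by a sum of injected components, to which
  \<open>norm2_Plus\<close> applies.\<close>

lemma op_plus_eq:
  assumes f: "f \<in> bop (hty Q\<^sub>1) (hty Q\<^sub>2)" and g: "g \<in> bop (hty Q\<^sub>3) (hty Q\<^sub>4)" and v: "v \<in> hty (Plus Q\<^sub>1 Q\<^sub>3)"
  shows "op_plus Q\<^sub>1 Q\<^sub>3 f g v = (\<lambda>l. inj_left Q\<^sub>2 (f (\<lambda>b. v (LInl b))) l + inj_right Q\<^sub>4 (g (\<lambda>b. v (LInr b))) l)"
  using v bop_in[OF f hty_Plus_components(1)[OF v]] bop_in[OF g hty_Plus_components(2)[OF v]]
  by (auto simp: op_plus_def inj_left_def inj_right_def fun_eq_iff split: label.split)

lemma op_plus_unitary: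
  assumes f: "unitary_op (hty Q\<^sub>1) (hty Q\<^sub>2) f" and g: "unitary_op (hty Q\<^sub>3) (hty Q\<^sub>4) g"
  shows "unitary_op (hty (Plus Q\<^sub>1 Q\<^sub>3)) (hty (Plus Q\<^sub>2 Q\<^sub>4)) (op_plus Q\<^sub>1 Q\<^sub>3 f g)"
proof -
  note fi = unitary_op_isom[OF f] and gi = unitary_op_isom[OF g]
  note fb = isom_bop[OF fi] and gb = isom_bop[OF gi]
  note eq = op_plus_eq[OF fb gb]
  have in_Plus: "(\<lambda>l. inj_left P\<^sub>1 x l + inj_right P\<^sub>2 y l) \<in> hty (Plus P\<^sub>1 P\<^sub>2)"
    if x: "x \<in> hty P\<^sub>1" and y: "y \<in> hty P\<^sub>2" for P\<^sub>1 P\<^sub>2 x y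
    using bop_in[OF isom_bop[OF inj_left_isom] x, of P\<^sub>2] bop_in[OF isom_bop[OF inj_right_isom] y, of P\<^sub>1]
    unfolding hty_def by (rule ell2_add)
  have comp: "(\<lambda>b. inj_left P\<^sub>1 x (LInl b) + inj_right P\<^sub>2 y (LInl b)) = x"
    "(\<lambda>b. inj_left P\<^sub>1 x (LInr b) + inj_right P\<^sub>2 y (LInr b)) = y"
    if "x \<in> hty P\<^sub>1" "y \<in> hty P\<^sub>2" for P\<^sub>1 P\<^sub>2 x y
    using that by (simp_all add: inj_left_def inj_right_def)
  have i: "isom (hty (Plus Q\<^sub>1 Q\<^sub>3)) (hty (Plus Q\<^sub>2 Q\<^sub>4)) (op_plus Q\<^sub>1 Q\<^sub>3 f g)"
  proof (rule isomI)
    show "op_plus Q\<^sub>1 Q\<^sub>3 f g \<in> hty (Plus Q\<^sub>1 Q\<^sub>3) \<rightarrow>\<^sub>E hty (Plus Q\<^sub>2 Q\<^sub>4)"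
    proof
      fix v assume v: "v \<in> hty (Plus Q\<^sub>1 Q\<^sub>3)"
      show "op_plus Q\<^sub>1 Q\<^sub>3 f g v \<in> hty (Plus Q\<^sub>2 Q\<^sub>4)"
        unfolding eq[OF v]
        by (rule in_Plus[OF bop_in[OF fb hty_Plus_components(1)[OF v]] bop_in[OF gb hty_Plus_components(2)[OF v]]])
    qed (simp add: op_plus_def)
    fix v assume v: "v \<in> hty (Plus Q\<^sub>1 Q\<^sub>3)"
    note c = hty_Plus_components[OF v]
    have "(norm2 (op_plus Q\<^sub>1 Q\<^sub>3 f g v))\<^sup>2 = (norm2 v)\<^sup>2"
      unfolding eq[OF v] norm2_Plus[OF bop_in[OF fb c(1)] bop_in[OF gb c(2)]]
        isom_norm[OF fi c(1)] isom_norm[OF gi c(2)]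
      using norm2_Plus[OF c(1,2)] c(3) by simp
    then show "norm2 (op_plus Q\<^sub>1 Q\<^sub>3 f g v) = norm2 v" by (simp add: power2_eq_iff_nonneg)
  next
    fix v w a b assume v: "v \<in> hty (Plus Q\<^sub>1 Q\<^sub>3)" and w: "w \<in> hty (Plus Q\<^sub>1 Q\<^sub>3)"
    have vw: "(\<lambda>x. a * v x + b * w x) \<in> hty (Plus Q\<^sub>1 Q\<^sub>3)"
      using v w unfolding hty_def by (rule ell2_lin)
    note cv = hty_Plus_components[OF v] and cw = hty_Plus_components[OF w]
    show "op_plus Q\<^sub>1 Q\<^sub>3 f g (\<lambda>x. a * v x + b * w x)
        = (\<lambda>y. a * op_plus Q\<^sub>1 Q\<^sub>3 f g v y + b * op_plus Q\<^sub>1 Q\<^sub>3 f g w y)"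
      using v w vw bop_lin[OF fb cv(1) cw(1)] bop_lin[OF gb cv(2) cw(2)]
      by (auto simp: op_plus_def fun_eq_iff split: label.split)
  qed
  have "w \<in> op_plus Q\<^sub>1 Q\<^sub>3 f g ` hty (Plus Q\<^sub>1 Q\<^sub>3)" if w: "w \<in> hty (Plus Q\<^sub>2 Q\<^sub>4)" for w
  proof -
    note c = hty_Plus_components[OF w]
    obtain x where x: "x \<in> hty Q\<^sub>1" "(\<lambda>b. w (LInl b)) = f x" using unitary_op_surj[OF f c(1)] by blast
    obtain y where y: "y \<in> hty Q\<^sub>3" "(\<lambda>b. w (LInr b)) = g y" using unitary_op_surj[OF g c(2)] by blast
    note p = in_Plus[OF x(1) y(1)]
    have "w = op_plus Q\<^sub>1 Q\<^sub>3 f g (\<lambda>l. inj_left Q\<^sub>1 x l + inj_right Q\<^sub>3 y l)"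
      unfolding eq[OF p] comp[OF x(1) y(1)] x(2)[symmetric] y(2)[symmetric] by (rule c(3))
    then show ?thesis using p by blast
  qed
  then show ?thesis unfolding unitary_op_def using i by blast
qed

section \<open>Controlled unitaries\<close>

lemma proj_ket_eq: "v \<in> hty Q \<Longrightarrow> proj_ket Q b v = (\<lambda>l. v b * ket b l)"
  by (simp add: proj_ket_def inner2_ket_left)

lemma proj_ket_bop:
  assumes b: "b \<in> basis Q" shows "proj_ket Q b \<in> bop (hty Q) (hty Q)"
proof (rule bopI)
  show "proj_ket Q b \<in> hty Q \<rightarrow>\<^sub>E hty Q"
  proof
    fix v assume "v \<in> hty Q"
    then show "proj_ket Q b v \<in> hty Q"
      by (simp add: proj_ket_eq) (simp add: hty_def ell2_scale ell2_ket b)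
  qed (simp add: proj_ket_def)
  fix v assume v: "v \<in> hty Q"
  show "norm2 (proj_ket Q b v) \<le> 1 * norm2 v"
    unfolding proj_ket_eq[OF v] norm2_scale using ell2_eval_le_norm2 v by (auto simp: hty_def)
next
  fix v w c d assume v: "v \<in> hty Q" and w: "w \<in> hty Q"
  have "(\<lambda>x. c * v x + d * w x) \<in> hty Q" using v w unfolding hty_def by (rule ell2_lin)
  then show "proj_ket Q b (\<lambda>x. c * v x + d * w x) = (\<lambda>y. c * proj_ket Q b v y + d * proj_ket Q b w y)"
    by (simp add: proj_ket_eq v w algebra_simps)
qed

lemma id_isom: "isom (ell2 A) (ell2 A) (\<lambda>v\<in>ell2 A. v)"
  by (rule isomI) (auto simp: ell2_lin)

text \<open>A vector consists of the two rows at \<open>LInl LStar\<close> and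
  \<open>LInr LStar\<close>. The operator keeps the first and applies \<open>f\<close> to the
  second, so norm and surjectivity can be checked row by row.\<close>

lemma ctrl_op_unitary:
  assumes f: "unitary_op (hty Q) (hty Q) f"
  shows "unitary_op (hty (Tensor Qbit Q)) (hty (Tensor Qbit Q)) (ctrl_op Q f)"
proof -
  interpret T: pairing2 "basis Qbit" "basis Q" "basis (Tensor Qbit Q)" LPair vtensor
      "basis Qbit" "basis Q" "basis (Tensor Qbit Q)" LPair vtensor
    by (intro pairing2.intro pairing_ty)
  let ?T = "hty (Tensor Qbit Q)"
  let ?k0 = "LInl LStar" and ?k1 = "LInr LStar"
  note fi = unitary_op_isom[OF f]
  note fb = isom_bop[OF fi]
  have ib: "(\<lambda>w\<in>hty Q. w) \<in> bop (hty Q) (hty Q)"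
    unfolding hty_def by (rule isom_bop[OF id_isom])
  define P where "P k g = op_tensor_ty Qbit Qbit Q Q (proj_ket Qbit k) g" for k g
  have P_bop: "P k g \<in> bop ?T ?T" and P_at: "\<And>v a b. v \<in> ?T \<Longrightarrow> a \<in> basis Qbit \<Longrightarrow> b \<in> basis Q
      \<Longrightarrow> P k g v (LPair a b) = (if a = k then g (\<lambda>b. v (LPair k b)) b else 0)"
    if k: "k \<in> basis Qbit" and g: "g \<in> bop (hty Q) (hty Q)" for k g
  proof -
    note kb = proj_ket_bop[OF k, unfolded hty_def] and g' = g[unfolded hty_def]
    have eq: "P k g = T.tensor (proj_ket Qbit k) g"
      unfolding P_def hty_def by (rule op_tensor_eq[OF T.pairing2_axioms kb g'])
    show "P k g \<in> bop ?T ?T" unfolding eq unfolding hty_def by (rule T.tensor_bop[OF kb g'])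
    fix v a b assume v: "v \<in> ?T" and ab: "a \<in> basis Qbit" "b \<in> basis Q"
    note v' = v[unfolded hty_def]
    show "P k g v (LPair a b) = (if a = k then g (\<lambda>b. v (LPair k b)) b else 0)"
      \<comment> \<open>With the projection innermost, the argument of \<open>g\<close> is the row
        of \<open>v\<close> at \<open>k\<close> when \<open>a\<close> equals \<open>k\<close>, and
        zero otherwise.\<close>
      unfolding eq T.tensor_apply_flip[OF kb g' v' ab] ty_row[OF v] proj_ket_eq[OF ty_col_in[OF v]]
      using bop_zero[OF g'] by (simp add: ket_def)
  qed
  have k: "?k0 \<in> basis Qbit" "?k1 \<in> basis Qbit" by auto
  have eq: "ctrl_op Q f v = (\<lambda>l. P ?k0 (\<lambda>w\<in>hty Q. w) v l + P ?k1 f v l)" if "v \<in> ?T" for v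
    using that by (simp add: ctrl_op_def P_def)
  have C_in: "ctrl_op Q f v \<in> ?T" if v: "v \<in> ?T" for v
    unfolding eq[OF v] using bop_in[OF P_bop[OF k(1) ib] v] bop_in[OF P_bop[OF k(2) fb] v]
    unfolding hty_def by (rule ell2_add)
  have out: "(\<lambda>b. v (LPair a b)) = (\<lambda>b. 0)" if "v \<in> ?T" "a \<notin> basis Qbit" for v a
    using that by (auto simp: hty_def ell2_def)
  have out2: "v (LPair a b) = 0" if "v \<in> ?T" "b \<notin> basis Q" for v a b
    using that by (auto simp: hty_def ell2_def)
  have row0: "(\<lambda>b. ctrl_op Q f v (LPair ?k0 b)) = (\<lambda>b. v (LPair ?k0 b))"
    and row1: "(\<lambda>b. ctrl_op Q f v (LPair ?k1 b)) = f (\<lambda>b. v (LPair ?k1 b))" if v: "v \<in> ?T" for v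
  proof -
    have fo: "f (\<lambda>b. v (LPair ?k1 b)) b = 0" if "b \<notin> basis Q" for b
      using bop_in[OF fb ty_row_in[OF v]] that unfolding hty_def by (rule ell2_outside)
    show "(\<lambda>b. ctrl_op Q f v (LPair ?k0 b)) = (\<lambda>b. v (LPair ?k0 b))"
    proof
      fix b show "ctrl_op Q f v (LPair ?k0 b) = v (LPair ?k0 b)"
        using out2[OF C_in[OF v]] out2[OF v] P_at[OF k(1) ib v k(1), of b] P_at[OF k(2) fb v k(1), of b]
          ty_row_in[OF v] by (cases "b \<in> basis Q") (simp_all add: eq[OF v])
    qed
    show "(\<lambda>b. ctrl_op Q f v (LPair ?k1 b)) = f (\<lambda>b. v (LPair ?k1 b))"
    proof
      fix b show "ctrl_op Q f v (LPair ?k1 b) = f (\<lambda>b. v (LPair ?k1 b)) b"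
        using out2[OF C_in[OF v]] fo P_at[OF k(1) ib v k(2), of b] P_at[OF k(2) fb v k(2), of b]
        by (cases "b \<in> basis Q") (simp_all add: eq[OF v])
    qed
  qed
  have norm: "norm2 (ctrl_op Q f v) = norm2 v" if v: "v \<in> ?T" for v
  proof -
    have "norm2 (\<lambda>b. ctrl_op Q f v (LPair a b)) = norm2 (\<lambda>b. v (LPair a b))" for a
    proof (cases "a \<in> basis Qbit")
      case True
      then consider "a = ?k0" | "a = ?k1" by auto
      then show ?thesis by cases (simp_all only: row0[OF v] row1[OF v] isom_norm[OF fi ty_row_in[OF v]])
    qed (simp add: out[OF C_in[OF v]] out[OF v])
    then have "(norm2 (ctrl_op Q f v))\<^sup>2 = (norm2 v)\<^sup>2"
      unfolding ty_norm2_rows[OF v] ty_norm2_rows[OF C_in[OF v]] by simp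
    then show ?thesis by (simp add: power2_eq_iff_nonneg)
  qed
  have i: "isom ?T ?T (ctrl_op Q f)"
  proof (rule isomI[OF _ _ norm])
    show "ctrl_op Q f \<in> ?T \<rightarrow>\<^sub>E ?T"
      using C_in by (intro PiE_I) (simp_all add: ctrl_op_def)
    fix v w a b assume v: "v \<in> ?T" and w: "w \<in> ?T"
    have vw: "(\<lambda>x. a * v x + b * w x) \<in> ?T" using v w unfolding hty_def by (rule ell2_lin)
    show "ctrl_op Q f (\<lambda>x. a * v x + b * w x) = (\<lambda>y. a * ctrl_op Q f v y + b * ctrl_op Q f w y)"
      unfolding eq[OF v] eq[OF w] eq[OF vw] bop_lin[OF P_bop[OF k(1) ib] v w] bop_lin[OF P_bop[OF k(2) fb] v w]
      by (simp add: algebra_simps)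
  qed
  have "w \<in> ctrl_op Q f ` ?T" if w: "w \<in> ?T" for w
  proof -
    obtain z where z: "z \<in> hty Q" "(\<lambda>b. w (LPair ?k1 b)) = f z"
      using unitary_op_surj[OF f ty_row_in[OF w]] by blast
    define y where "y = (\<lambda>b. w (LPair ?k0 b))"
    have y: "y \<in> hty Q" unfolding y_def by (rule ty_row_in[OF w])
    \<comment> \<open>The preimage keeps the first row of \<open>w\<close> and has a preimage of the
      second row under \<open>f\<close> as its second row.\<close>
    define v where "v = (\<lambda>l. vtensor (ket ?k0) y l + vtensor (ket ?k1) z l)"
    have v: "v \<in> ?T"
      unfolding v_def hty_def
      using y z by (intro ell2_add T.dom.tau_in ell2_ket k) (simp_all add: hty_def)
    have vr: "(\<lambda>b. v (LPair ?k0 b)) = y" "(\<lambda>b. v (LPair ?k1 b)) = z"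
      by (simp_all add: v_def vtensor_def ket_def)
    have "w = ctrl_op Q f v"
    proof (rule T.dom.ell2_D_eqI)
      fix a b assume a: "a \<in> basis Qbit" "b \<in> basis Q"
      then consider "a = ?k0" | "a = ?k1" by auto
      then show "w (LPair a b) = ctrl_op Q f v (LPair a b)"
        using fun_cong[OF row0[OF v], of b] fun_cong[OF row1[OF v], of b] fun_cong[OF z(2), of b]
          fun_cong[OF vr(1), of b] by cases (simp_all add: vr y_def)
    qed (use w C_in[OF v] in \<open>simp_all add: hty_def\<close>)
    then show ?thesis using v by blast
  qed
  then show ?thesis unfolding unitary_op_def using i by blast
qed


subsection \<open>Soundness of orthogonality\<close>

lemma size_TSum: "(\<alpha>, t) \<in># M \<Longrightarrow> size t < size (TSum M)"
proof -
  assume "(\<alpha>, t) \<in># M"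
  then obtain N where "M = add_mset (\<alpha>, t) N" by (metis multi_member_split)
  then show ?thesis by simp
qed

lemma size_LC:
  assumes "size (LC I \<alpha> s) < n" "finite I" "i \<in> I" shows "size (s i) < n"
proof -
  have "(\<alpha> i, s i) \<in># image_mset (\<lambda>i. (\<alpha> i, s i)) (mset_set I)" using assms(2,3) by auto
  from size_TSum[OF this] assms(1) show ?thesis by (rule less_trans)
qed

text \<open>The context is quantified away because two pairs in one context may split it
  differently, so the orthogonal components in \<open>pair_right\<close> and
  \<open>pair_left\<close> can have different contexts.\<close>

definition rng :: "tm \<Rightarrow> ty \<Rightarrow> vec set" where
  "rng t Q = {x. \<exists>\<Gamma> f v. sem \<Gamma> t Q f \<and> v \<in> hctx \<Gamma> \<and> x = f v}"

lemma rngI: "sem \<Gamma> t Q f \<Longrightarrow> v \<in> hctx \<Gamma> \<Longrightarrow> f v \<in> rng t Q"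
  by (auto simp: rng_def)

lemma rng_LC:
  assumes "x \<in> rng (LC J \<beta> s) Q" "finite J"
  obtains \<Gamma> v F where "v \<in> hctx \<Gamma>" "\<And>j. j \<in> J \<Longrightarrow> sem \<Gamma> (s j) Q (F j)"
    "x = (\<lambda>l. \<Sum>j\<in>J. \<beta> j * F j v l)"
proof -
  from assms(1) obtain \<Gamma> h v where h: "sem \<Gamma> (LC J \<beta> s) Q h" "v \<in> hctx \<Gamma>" "x = h v"
    by (auto simp: rng_def)
  obtain F where F: "\<forall>j\<in>J. sem \<Gamma> (s j) Q (F j)" "h = (\<lambda>v\<in>hctx \<Gamma>. \<lambda>l. \<Sum>j\<in>J. \<beta> j * F j v l)"
    using sem_LC[OF h(1) assms(2)] by blast
  show thesis by (rule that[of v \<Gamma> F]) (use h(2,3) F in auto)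
qed

text \<open>The isometry property of a sum relies on the orthogonality of its summands, whose soundness
  in turn relies on the isometry property of smaller terms; hence the bound on the size.\<close>

locale isometric_below =
  fixes n :: nat
  assumes below_isom: "\<And>t \<Gamma> Q f. size t < n \<Longrightarrow> sem \<Gamma> t Q f \<Longrightarrow> isom (hctx \<Gamma>) (hty Q) f"
    and below_unitary: "\<And>u Q\<^sub>1 Q\<^sub>2 g. size u < n \<Longrightarrow> usem u Q\<^sub>1 Q\<^sub>2 g
      \<Longrightarrow> unitary_op (hty Q\<^sub>1) (hty Q\<^sub>2) g"
begin

lemma rng_hty: "size t < n \<Longrightarrow> x \<in> rng t Q \<Longrightarrow> x \<in> hty Q"
  unfolding rng_def using bop_in[OF isom_bop[OF below_isom]] by blast

lemma rng_TInl:
  assumes "x \<in> rng (TInl t) Q" "size t < n"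
  shows "\<exists>Q\<^sub>1 Q\<^sub>2 y. Q = Plus Q\<^sub>1 Q\<^sub>2 \<and> y \<in> rng t Q\<^sub>1 \<and> y \<in> hty Q\<^sub>1 \<and> x = inj_left Q\<^sub>1 y"
proof -
  from assms(1) obtain \<Gamma> f v where f: "sem \<Gamma> (TInl t) Q f" "v \<in> hctx \<Gamma>" "x = f v"
    by (auto simp: rng_def)
  from f(1) obtain Q\<^sub>1 Q\<^sub>2 g where "Q = Plus Q\<^sub>1 Q\<^sub>2" "sem \<Gamma> t Q\<^sub>1 g" "f = compose (hctx \<Gamma>) (inj_left Q\<^sub>1) g"
    by (auto elim!: sem_TInlE)
  then show ?thesis
    using f rngI[of \<Gamma> t Q\<^sub>1 g v] rng_hty[OF assms(2), of "g v" Q\<^sub>1] by (auto simp: compose_eq)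
qed

lemma rng_TInr:
  assumes "x \<in> rng (TInr t) Q" "size t < n"
  shows "\<exists>Q\<^sub>1 Q\<^sub>2 y. Q = Plus Q\<^sub>1 Q\<^sub>2 \<and> y \<in> rng t Q\<^sub>2 \<and> y \<in> hty Q\<^sub>2 \<and> x = inj_right Q\<^sub>2 y"
proof -
  from assms(1) obtain \<Gamma> f v where f: "sem \<Gamma> (TInr t) Q f" "v \<in> hctx \<Gamma>" "x = f v"
    by (auto simp: rng_def)
  from f(1) obtain Q\<^sub>1 Q\<^sub>2 g where "Q = Plus Q\<^sub>1 Q\<^sub>2" "sem \<Gamma> t Q\<^sub>2 g" "f = compose (hctx \<Gamma>) (inj_right Q\<^sub>2) g"
    by (auto elim!: sem_TInrE)
  then show ?thesis
    using f rngI[of \<Gamma> t Q\<^sub>2 g v] rng_hty[OF assms(2), of "g v" Q\<^sub>2] by (auto simp: compose_eq)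
qed

lemma rng_TSucc:
  assumes "x \<in> rng (TSucc t) Q" "size t < n"
  shows "\<exists>y. Q = Qnat \<and> y \<in> rng t Qnat \<and> y \<in> hty Qnat \<and> x = succ_op y"
proof -
  from assms(1) obtain \<Gamma> f v where f: "sem \<Gamma> (TSucc t) Q f" "v \<in> hctx \<Gamma>" "x = f v"
    by (auto simp: rng_def)
  from f(1) obtain g where "Q = Qnat" "sem \<Gamma> t Qnat g" "f = compose (hctx \<Gamma>) succ_op g"
    by (auto elim!: sem_TSuccE)
  then show ?thesis
    using f rngI[of \<Gamma> t Qnat g v] rng_hty[OF assms(2), of "g v" Qnat] by (auto simp: compose_eq)
qed

lemma rng_TZero:
  assumes "x \<in> rng TZero Q" shows "\<exists>c. x = (\<lambda>l. c * ket (LNat 0) l)"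
  using assms by (auto simp: rng_def elim!: sem_TZeroE)

lemma rng_TApp:
  assumes "x \<in> rng (TApp u t) Q"
  shows "\<exists>Q\<^sub>1 g y. usem u Q\<^sub>1 Q g \<and> y \<in> rng t Q\<^sub>1 \<and> x = g y"
proof -
  from assms(1) obtain \<Gamma> f v where f: "sem \<Gamma> (TApp u t) Q f" "v \<in> hctx \<Gamma>" "x = f v"
    by (auto simp: rng_def)
  from f(1) obtain Q\<^sub>1 g h where "usem u Q\<^sub>1 Q g" "sem \<Gamma> t Q\<^sub>1 h" "f = compose (hctx \<Gamma>) g h"
    by (auto elim!: sem_TAppE)
  then show ?thesis
    using f rngI[of \<Gamma> t Q\<^sub>1 h v] by (auto simp: compose_eq)
qed

text \<open>Inversion with the definite description already replaced by the explicit operator. That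
  replacement needs bounded components, hence the bound on their sizes.\<close>

lemma sem_TPair:
  assumes "sem \<Gamma> (TPair t s) Q h" "size t < n" "size s < n"
  obtains \<Gamma>\<^sub>1 \<Gamma>\<^sub>2 Q\<^sub>1 Q\<^sub>2 f g where "Q = Tensor Q\<^sub>1 Q\<^sub>2" "\<Gamma> = \<Gamma>\<^sub>1 ++ \<Gamma>\<^sub>2" "dom \<Gamma>\<^sub>1 \<inter> dom \<Gamma>\<^sub>2 = {}"
    "sem \<Gamma>\<^sub>1 t Q\<^sub>1 f" "sem \<Gamma>\<^sub>2 s Q\<^sub>2 g"
    "isom (ell2 (basis_ctx \<Gamma>\<^sub>1)) (ell2 (basis Q\<^sub>1)) f" "isom (ell2 (basis_ctx \<Gamma>\<^sub>2)) (ell2 (basis Q\<^sub>2)) g"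
    "pairing2 (basis_ctx \<Gamma>\<^sub>1) (basis_ctx \<Gamma>\<^sub>2) (basis_ctx \<Gamma>) (++) (etensor \<Gamma>\<^sub>1 \<Gamma>\<^sub>2)
       (basis Q\<^sub>1) (basis Q\<^sub>2) (basis Q) LPair vtensor"
    "h = pairing2.tensor (basis_ctx \<Gamma>\<^sub>1) (basis_ctx \<Gamma>\<^sub>2) (basis_ctx \<Gamma>) (++) (basis Q\<^sub>1) (basis Q\<^sub>2) (basis Q) LPair f g"
proof -
  from assms(1) obtain \<Gamma>\<^sub>1 \<Gamma>\<^sub>2 Q\<^sub>1 Q\<^sub>2 f g where 1: "Q = Tensor Q\<^sub>1 Q\<^sub>2" "\<Gamma> = \<Gamma>\<^sub>1 ++ \<Gamma>\<^sub>2" "dom \<Gamma>\<^sub>1 \<inter> dom \<Gamma>\<^sub>2 = {}"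
    "sem \<Gamma>\<^sub>1 t Q\<^sub>1 f" "sem \<Gamma>\<^sub>2 s Q\<^sub>2 g" "h = op_tensor_ctx \<Gamma>\<^sub>1 Q\<^sub>1 \<Gamma>\<^sub>2 Q\<^sub>2 f g"
    by (auto elim!: sem_TPairE)
  have i: "isom (ell2 (basis_ctx \<Gamma>\<^sub>1)) (ell2 (basis Q\<^sub>1)) f" "isom (ell2 (basis_ctx \<Gamma>\<^sub>2)) (ell2 (basis Q\<^sub>2)) g"
    using below_isom[OF assms(2) 1(4)] below_isom[OF assms(3) 1(5)] by (simp_all add: hctx_def hty_def)
  have p: "pairing2 (basis_ctx \<Gamma>\<^sub>1) (basis_ctx \<Gamma>\<^sub>2) (basis_ctx \<Gamma>) (++) (etensor \<Gamma>\<^sub>1 \<Gamma>\<^sub>2)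
       (basis Q\<^sub>1) (basis Q\<^sub>2) (basis Q) LPair vtensor"
    unfolding 1(1,2) by (intro pairing2.intro pairing_ctx 1 pairing_ty)
  have "h = pairing2.tensor (basis_ctx \<Gamma>\<^sub>1) (basis_ctx \<Gamma>\<^sub>2) (basis_ctx \<Gamma>) (++) (basis Q\<^sub>1) (basis Q\<^sub>2) (basis Q) LPair f g"
    using op_tensor_eq[OF p isom_bop[OF i(1)] isom_bop[OF i(2)]] 1 by (simp add: hctx_def hty_def)
  then show thesis using that 1 i p by blast
qed

lemma rng_TPair:
  assumes "x \<in> rng (TPair t s) Q" "size t < n" "size s < n"
  shows "\<exists>Q\<^sub>1 Q\<^sub>2. Q = Tensor Q\<^sub>1 Q\<^sub>2 \<and> x \<in> hty Q
    \<and> (\<forall>a\<in>basis Q\<^sub>1. (\<lambda>b. x (LPair a b)) \<in> rng s Q\<^sub>2) \<and> (\<forall>b\<in>basis Q\<^sub>2. (\<lambda>a. x (LPair a b)) \<in> rng t Q\<^sub>1)"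
proof -
  from assms(1) obtain \<Gamma> h v where h: "sem \<Gamma> (TPair t s) Q h" "v \<in> hctx \<Gamma>" "x = h v"
    by (auto simp: rng_def)
  obtain \<Gamma>\<^sub>1 \<Gamma>\<^sub>2 Q\<^sub>1 Q\<^sub>2 f g where 1: "Q = Tensor Q\<^sub>1 Q\<^sub>2" "\<Gamma> = \<Gamma>\<^sub>1 ++ \<Gamma>\<^sub>2" "dom \<Gamma>\<^sub>1 \<inter> dom \<Gamma>\<^sub>2 = {}"
    "sem \<Gamma>\<^sub>1 t Q\<^sub>1 f" "sem \<Gamma>\<^sub>2 s Q\<^sub>2 g"
    "isom (ell2 (basis_ctx \<Gamma>\<^sub>1)) (ell2 (basis Q\<^sub>1)) f" "isom (ell2 (basis_ctx \<Gamma>\<^sub>2)) (ell2 (basis Q\<^sub>2)) g"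
    "pairing2 (basis_ctx \<Gamma>\<^sub>1) (basis_ctx \<Gamma>\<^sub>2) (basis_ctx \<Gamma>) (++) (etensor \<Gamma>\<^sub>1 \<Gamma>\<^sub>2)
       (basis Q\<^sub>1) (basis Q\<^sub>2) (basis Q) LPair vtensor"
    "h = pairing2.tensor (basis_ctx \<Gamma>\<^sub>1) (basis_ctx \<Gamma>\<^sub>2) (basis_ctx \<Gamma>) (++) (basis Q\<^sub>1) (basis Q\<^sub>2) (basis Q) LPair f g"
    by (rule sem_TPair[OF h(1) assms(2,3)])
  interpret T: pairing2 "basis_ctx \<Gamma>\<^sub>1" "basis_ctx \<Gamma>\<^sub>2" "basis_ctx \<Gamma>" "(++)" "etensor \<Gamma>\<^sub>1 \<Gamma>\<^sub>2"
       "basis Q\<^sub>1" "basis Q\<^sub>2" "basis Q" LPair vtensor by (rule 1(8))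
  note fb = isom_bop[OF 1(6)] and gb = isom_bop[OF 1(7)] and v = h(2)[unfolded hctx_def]
  have x: "x \<in> hty Q" unfolding h(3) 1(9) hty_def by (rule bop_in[OF T.tensor_bop[OF fb gb] v])
  have row: "T.cod.row x a = (\<lambda>b. x (LPair a b))" for a
    using ty_row[of x Q\<^sub>1 Q\<^sub>2] x unfolding 1(1) by simp
  have "(\<lambda>b. x (LPair a b)) \<in> rng s Q\<^sub>2" if "a \<in> basis Q\<^sub>1" for a
    using T.row_tensor[OF fb gb v that] rngI[OF 1(5)] row[of a] unfolding h(3) 1(9) hctx_def by auto
  moreover have "(\<lambda>a. x (LPair a b)) \<in> rng t Q\<^sub>1" if "b \<in> basis Q\<^sub>2" for b
    using T.col_tensor[OF fb gb v that] rngI[OF 1(4)] row unfolding h(3) 1(9) hctx_def by auto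
  ultimately show ?thesis using x 1(1) by blast
qed

text \<open>The disjunction in the last premise covers \<open>sum\<close> and
  \<open>sum_zero\<close> together: in the latter, the summand equal to the other term has
  coefficient zero.\<close>

lemma inner2_rng_LC:
  assumes x: "x \<in> hty Q" and y: "y \<in> rng (LC I \<alpha> s) Q" and fin: "finite I" and sz: "size (LC I \<alpha> s) < n"
    and 0: "\<And>i z. i \<in> I \<Longrightarrow> z \<in> rng (s i) Q \<Longrightarrow> \<alpha> i = 0 \<or> inner2 x z = 0"
  shows "inner2 x y = 0"
proof -
  obtain \<Gamma> v F where v: "v \<in> hctx \<Gamma>"
    and F: "\<And>i. i \<in> I \<Longrightarrow> sem \<Gamma> (s i) Q (F i)" "y = (\<lambda>l. \<Sum>i\<in>I. \<alpha> i * F i v l)"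
    by (rule rng_LC[OF y fin]) blast
  have F_in: "F i v \<in> ell2 (basis Q)" if "i \<in> I" for i
    using rng_hty[OF size_LC[OF sz fin] rngI[OF F(1) v]] that by (simp add: hty_def)
  have "inner2 x y = (\<Sum>i\<in>I. inner2 x (\<lambda>l. \<alpha> i * F i v l))"
    unfolding F(2) by (rule inner2_sum_right[OF x[unfolded hty_def]]) (rule ell2_scale[OF F_in])
  also have "\<dots> = 0"
    using 0[OF _ rngI[OF F(1) v]] by (intro sum.neutral) (auto simp: inner2_scale_right)
  finally show ?thesis .
qed

text \<open>Induction on the derivation, with the size bounds kept as premises so that isometry is
  available for the components being compared. The type stays general because the rule for
  applications changes it.\<close>

lemma orth_sound:
  "t \<bottom>\<bottom> s \<Longrightarrow> size t < n \<Longrightarrow> size s < n \<Longrightarrow> x \<in> rng t Q \<Longrightarrow> y \<in> rng s Q \<Longrightarrow> inner2 x y = 0"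
proof (induction arbitrary: x y Q rule: orth.induct)
  case (sym t s)
  then show ?case using inner2_cnj[of x y] by simp
next
  case (inl_inr t\<^sub>1 t\<^sub>2)
  have s: "size t\<^sub>1 < n" "size t\<^sub>2 < n" using inl_inr.prems by simp_all
  show ?case
    using rng_TInl[OF inl_inr.prems(3) s(1)] rng_TInr[OF inl_inr.prems(4) s(2)]
    by (auto intro!: inner2_disjoint simp: inj_left_def inj_right_def split: label.split)
next
  case (zero_succ t)
  have s: "size t < n" using zero_succ.prems by simp
  show ?case
    using rng_TZero[OF zero_succ.prems(3)] rng_TSucc[OF zero_succ.prems(4) s]
    by (auto intro!: inner2_disjoint simp: succ_op_def ket_def split: label.split nat.split)
next
  case (succ t\<^sub>1 t\<^sub>2)
  have s: "size t\<^sub>1 < n" "size t\<^sub>2 < n" using succ.prems by simp_all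
  show ?case
    using rng_TSucc[OF succ.prems(3) s(1)] rng_TSucc[OF succ.prems(4) s(2)] succ.IH s
      isom_inner[OF succ_op_isom[unfolded hty_def]] by (auto simp: hty_def)
next
  case (inl t\<^sub>1 t\<^sub>2)
  have s: "size t\<^sub>1 < n" "size t\<^sub>2 < n" using inl.prems by simp_all
  show ?case
    using rng_TInl[OF inl.prems(3) s(1)] rng_TInl[OF inl.prems(4) s(2)] inl.IH s
      isom_inner[OF inj_left_isom[unfolded hty_def]] by (auto simp: hty_def)
next
  case (inr t\<^sub>1 t\<^sub>2)
  have s: "size t\<^sub>1 < n" "size t\<^sub>2 < n" using inr.prems by simp_all
  show ?case
    using rng_TInr[OF inr.prems(3) s(1)] rng_TInr[OF inr.prems(4) s(2)] inr.IH s
      isom_inner[OF inj_right_isom[unfolded hty_def]] by (auto simp: hty_def)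
next
  case (app t\<^sub>1 t\<^sub>2 u)
  have s: "size t\<^sub>1 < n" "size t\<^sub>2 < n" "size u < n" using app.prems by simp_all
  obtain P g x' where x: "usem u P Q g" "x' \<in> rng t\<^sub>1 P" "x = g x'" using rng_TApp[OF app.prems(3)] by blast
  obtain P' g' y' where y: "usem u P' Q g'" "y' \<in> rng t\<^sub>2 P'" "y = g' y'" using rng_TApp[OF app.prems(4)] by blast
  \<comment> \<open>The common target determines the source and the operator, so both arguments pass
    through one isometry, which preserves their inner product.\<close>
  have "P' = P" using utyped_unique[OF usem_utyped[OF x(1)]] usem_utyped[OF y(1)] by blast
  moreover from this have "g' = g" using usem_unique[OF x(1)] y(1) by simp
  ultimately have "inner2 x y = inner2 x' y'"
    using isom_inner[OF unitary_op_isom[OF below_unitary[OF s(3) x(1), unfolded hty_def]]]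
      rng_hty[OF s(1) x(2)] rng_hty[OF s(2) y(2)] x(3) y(3) by (simp add: hty_def)
  then show ?case using app.IH[OF s(1,2) x(2)] y(2) \<open>P' = P\<close> by simp
next
  case (pair_right t\<^sub>1 t\<^sub>2 t t')
  have s: "size t\<^sub>1 < n" "size t\<^sub>2 < n" "size t < n" "size t' < n" using pair_right.prems by simp_all
  obtain Q\<^sub>1 Q\<^sub>2 where x: "Q = Tensor Q\<^sub>1 Q\<^sub>2" "x \<in> hty Q" "\<And>a. a \<in> basis Q\<^sub>1 \<Longrightarrow> (\<lambda>b. x (LPair a b)) \<in> rng t\<^sub>1 Q\<^sub>2"
    using rng_TPair[OF pair_right.prems(3) s(3,1)] by blast
  have y: "y \<in> hty Q" "\<And>a. a \<in> basis Q\<^sub>1 \<Longrightarrow> (\<lambda>b. y (LPair a b)) \<in> rng t\<^sub>2 Q\<^sub>2"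
    using rng_TPair[OF pair_right.prems(4) s(4,2)] x(1) by auto
  have "inner2 (\<lambda>b. x (LPair a b)) (\<lambda>b. y (LPair a b)) = 0" for a
  proof (cases "a \<in> basis Q\<^sub>1")
    case True then show ?thesis using pair_right.IH[OF s(1,2)] x(3) y(2) by blast
  next
    case False
    then have "x (LPair a b) = 0" for b using x(1,2) by (auto simp: hty_def ell2_def)
    then show ?thesis by (intro inner2_disjoint) simp
  qed
  then show ?case using ty_inner2_rows[of x Q\<^sub>1 Q\<^sub>2 y] x y by simp
next
  case (pair_left t\<^sub>1 t\<^sub>2 t t')
  have s: "size t\<^sub>1 < n" "size t\<^sub>2 < n" "size t < n" "size t' < n" using pair_left.prems by simp_all
  obtain Q\<^sub>1 Q\<^sub>2 where x: "Q = Tensor Q\<^sub>1 Q\<^sub>2" "x \<in> hty Q" "\<And>b. b \<in> basis Q\<^sub>2 \<Longrightarrow> (\<lambda>a. x (LPair a b)) \<in> rng t\<^sub>1 Q\<^sub>1"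
    using rng_TPair[OF pair_left.prems(3) s(1,3)] by blast
  have y: "y \<in> hty Q" "\<And>b. b \<in> basis Q\<^sub>2 \<Longrightarrow> (\<lambda>a. y (LPair a b)) \<in> rng t\<^sub>2 Q\<^sub>1"
    using rng_TPair[OF pair_left.prems(4) s(2,4)] x(1) by auto
  have "inner2 (\<lambda>a. x (LPair a b)) (\<lambda>a. y (LPair a b)) = 0" for b
  proof (cases "b \<in> basis Q\<^sub>2")
    case True then show ?thesis using pair_left.IH[OF s(1,2)] x(3) y(2) by blast
  next
    case False
    then have "x (LPair a b) = 0" for a using x(1,2) by (auto simp: hty_def ell2_def)
    then show ?thesis by (intro inner2_disjoint) simp
  qed
  then show ?case using ty_inner2_cols[of x Q\<^sub>1 Q\<^sub>2 y] x y by simp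
next
  case (sum I t s \<alpha>)
  have x: "x \<in> hty Q" by (rule rng_hty[OF sum.prems(1,3)])
  show ?case
    by (rule inner2_rng_LC[OF x sum.prems(4) sum.hyps(1) sum.prems(2)])
       (use sum.IH sum.prems(1,3) size_LC[OF sum.prems(2) sum.hyps(1)] in blast)
next
  case (sum_zero I k t s \<alpha>)
  have fin: "finite (insert k I)" using sum_zero.hyps(1) by simp
  have x: "x \<in> hty Q" by (rule rng_hty[OF sum_zero.prems(1,3)])
  show ?case
    by (rule inner2_rng_LC[OF x sum_zero.prems(4) fin sum_zero.prems(2)])
       (use sum_zero.IH sum_zero.hyps sum_zero.prems(1,3) size_LC[OF sum_zero.prems(2) fin] in blast)
next
  case (sum_sum I t J K \<alpha> \<beta>)
  have fin: "finite J" "finite K" using sum_sum.hyps finite_subset by blast+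
  have sJ: "size (t j) < n" if "j \<in> J" for j
    by (rule size_LC[OF sum_sum.prems(1) fin(1) that])
  have sK: "size (t j) < n" if "j \<in> K" for j
    by (rule size_LC[OF sum_sum.prems(2) fin(2) that])
  obtain \<Gamma> v F where h: "v \<in> hctx \<Gamma>"
    and F: "\<And>i. i \<in> J \<Longrightarrow> sem \<Gamma> (t i) Q (F i)" "x = (\<lambda>l. \<Sum>i\<in>J. \<alpha> i * F i v l)"
    by (rule rng_LC[OF sum_sum.prems(3) fin(1)]) blast
  obtain \<Delta> w G where k: "w \<in> hctx \<Delta>"
    and G: "\<And>i. i \<in> K \<Longrightarrow> sem \<Delta> (t i) Q (G i)" "y = (\<lambda>l. \<Sum>i\<in>K. \<beta> i * G i w l)"
    by (rule rng_LC[OF sum_sum.prems(4) fin(2)]) blast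
  have F_in: "F i v \<in> ell2 (basis Q)" if "i \<in> J" for i
    using rng_hty[OF sJ rngI[OF F(1) h]] that by (simp add: hty_def)
  have G_in: "G i w \<in> ell2 (basis Q)" if "i \<in> K" for i
    using rng_hty[OF sK rngI[OF G(1) k]] that by (simp add: hty_def)
  have x_in: "x \<in> ell2 (basis Q)" unfolding F(2) by (rule ell2_sum) (rule ell2_scale[OF F_in])
  \<comment> \<open>Equal indices mean the same term at the same type, hence the same context and
    the same isometry. The diagonal entries are therefore all equal to \<open>inner2 v w\<close>,
    which can be factored out of the sum in the side condition.\<close>
  have FG: "inner2 (F j v) (G i w) = (if i = j then inner2 v w else 0)" if "j \<in> J" "i \<in> K" for i j
  proof (cases "i = j")
    case True
    have "\<Delta> = \<Gamma>" using typed_ctx_unique[OF sem_typed[OF F(1)[OF that(1)]]] sem_typed[OF G(1)[OF that(2)]] True by simp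
    moreover have "G j = F j" using sem_unique[OF F(1)[OF that(1)]] G(1)[OF that(2)] True calculation by simp
    ultimately show ?thesis
      using True isom_inner[OF below_isom[OF sJ[OF that(1)] F(1)[OF that(1)], unfolded hty_def hctx_def]] h k
      by (simp add: hctx_def)
  next
    case False
    then have "inner2 (F j v) (G i w) = 0"
      using sum_sum.IH[of j i, OF _ _ _ sJ sK rngI[OF F(1) h] rngI[OF G(1) k]] that sum_sum.hyps by auto
    then show ?thesis using False by simp
  qed
  have "inner2 x y = (\<Sum>i\<in>K. inner2 x (\<lambda>l. \<beta> i * G i w l))"
    unfolding G(2) by (rule inner2_sum_right[OF x_in]) (rule ell2_scale[OF G_in])
  also have "\<dots> = (\<Sum>i\<in>K. \<beta> i * (\<Sum>j\<in>J. cnj (\<alpha> j) * inner2 (F j v) (G i w)))"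
  proof (rule sum.cong[OF refl])
    fix i assume i: "i \<in> K"
    have "inner2 x (G i w) = (\<Sum>j\<in>J. inner2 (\<lambda>l. \<alpha> j * F j v l) (G i w))"
      unfolding F(2) by (rule inner2_sum_left[OF G_in[OF i]]) (rule ell2_scale[OF F_in])
    then show "inner2 x (\<lambda>l. \<beta> i * G i w l) = \<beta> i * (\<Sum>j\<in>J. cnj (\<alpha> j) * inner2 (F j v) (G i w))"
      by (simp add: inner2_scale_right inner2_scale_left)
  qed
  also have "\<dots> = (\<Sum>i\<in>K. \<beta> i * (\<Sum>j\<in>J. if j = i then cnj (\<alpha> i) * inner2 v w else 0))"
    by (intro sum.cong refl arg_cong2[where f = "(*)"]) (auto simp: FG)
  also have "\<dots> = (\<Sum>i\<in>K. if i \<in> J then cnj (\<alpha> i) * \<beta> i * inner2 v w else 0)"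
    using fin by (intro sum.cong refl) auto
  also have "\<dots> = (\<Sum>i\<in>J \<inter> K. cnj (\<alpha> i) * \<beta> i) * inner2 v w"
    using fin by (simp add: sum.inter_restrict[symmetric] sum_distrib_right Int_commute)
  finally show ?case using sum_sum.hyps by simp
qed

end

text \<open>Two distinct pairs either differ in the component that indexes the fibres or lie in one
  fibre. For a change of basis, the orthogonality of two rows of the matrix is the side condition of
  \<open>sum_sum\<close> with all three index sets equal.\<close>

lemma ONBe_orth: "ONBe Q S \<Longrightarrow> e \<in> S \<Longrightarrow> e' \<in> S \<Longrightarrow> e \<noteq> e' \<Longrightarrow> e \<bottom>\<bottom> e'"
proof (induction arbitrary: e e' rule: ONBe.induct)
  case (plus Q\<^sub>1 S Q\<^sub>2 T)
  then show ?case by (auto intro: orth.intros)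
next
  case (nat S)
  then show ?case by (auto intro: orth.intros)
next
  case (tensor2 S Q\<^sub>2 Q\<^sub>1)
  obtain a b c d where e: "e = TPair a b" "e' = TPair c d"
    using tensor2.prems tensor2.hyps(2) by (auto simp: pair_set_def) metis
  show ?case
  proof (cases "b = d")
    case True
    then show ?thesis using tensor2.IH(2)[of b a c] tensor2.prems e
      by (auto simp: proj2_def fibre2_def intro: orth.pair_left)
  next
    case False
    then show ?thesis using tensor2.IH(1)[of b d] tensor2.prems e
      by (auto simp: proj2_def intro: orth.pair_right)
  qed
next
  case (tensor1 S Q\<^sub>1 Q\<^sub>2)
  obtain a b c d where e: "e = TPair a b" "e' = TPair c d"
    using tensor1.prems tensor1.hyps(2) by (auto simp: pair_set_def) metis
  show ?case
  proof (cases "a = c")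
    case True
    then show ?thesis using tensor1.IH(2)[of a b d] tensor1.prems e
      by (auto simp: proj1_def fibre1_def intro: orth.pair_right)
  next
    case False
    then show ?thesis using tensor1.IH(1)[of a c] tensor1.prems e
      by (auto simp: proj1_def intro: orth.pair_left)
  qed
next
  case (unitary Q S A)
  obtain a b where ab: "a \<in> S" "b \<in> S" "e = LC S (A a) (\<lambda>e'. e')" "e' = LC S (A b) (\<lambda>e'. e')"
    using unitary.prems by blast
  have neq: "a \<noteq> b" using ab unitary.prems by auto
  have fin: "finite S" by (rule ONBe_finite[OF unitary.hyps(1)])
  \<comment> \<open>The orthogonality rules use natural numbers as indices, so the set of terms is
    enumerated first.\<close>
  obtain h where h: "bij_betw h {..<card S} S"
    using ex_bij_betw_nat_finite[OF fin] by (auto simp: atLeast0LessThan)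
  have LC: "LC S \<alpha> (\<lambda>e'. e') = LC {..<card S} (\<lambda>i. \<alpha> (h i)) h" for \<alpha>
  proof -
    have "mset_set S = image_mset h (mset_set {..<card S})"
      using h by (simp add: bij_betw_def image_mset_mset_set)
    then show ?thesis by (simp add: image_mset.compositionality o_def)
  qed
  have "(\<Sum>k\<in>S. A b k * cnj (A a k)) = 0"
    using unitary.hyps(2) ab neq by (auto simp: unitary_matrix_def)
  then have 0: "(\<Sum>i<card S. cnj (A a (h i)) * A b (h i)) = 0"
    using sum.reindex_bij_betw[OF h, of "\<lambda>k. A b k * cnj (A a k)"] by (simp add: mult.commute)
  have hne: "h i \<noteq> h j" if "i < card S" "j < card S" "i \<noteq> j" for i j
    using h that by (auto simp: bij_betw_def inj_on_def)
  have hS: "h i \<in> S" if "i < card S" for i using h that by (auto simp: bij_betw_def)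
  show ?case
    unfolding ab LC
    by (rule orth.sum_sum[of "{..<card S}"]) (use unitary.IH hS hne 0 in auto)
qed auto


subsection \<open>Orthogonal families of isometries\<close>

text \<open>The domains vary with the index because the elements of a basis may live in different
  contexts.\<close>

locale orth_isoms =
  fixes I :: "'i set" and C :: "'i \<Rightarrow> 'c set" and A :: "'a set"
    and f :: "'i \<Rightarrow> ('c \<Rightarrow> complex) \<Rightarrow> ('a \<Rightarrow> complex)"
  assumes fin: "finite I"
    and iso: "\<And>i. i \<in> I \<Longrightarrow> isom (ell2 (C i)) (ell2 A) (f i)"
    and orth: "\<And>i j x y. i \<in> I \<Longrightarrow> j \<in> I \<Longrightarrow> i \<noteq> j \<Longrightarrow> x \<in> ell2 (C i) \<Longrightarrow> y \<in> ell2 (C j)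
      \<Longrightarrow> inner2 (f i x) (f j y) = 0"
begin

abbreviation "coord i \<equiv> adj (ell2 (C i)) (ell2 A) (f i)"

lemma f_in: "i \<in> I \<Longrightarrow> x \<in> ell2 (C i) \<Longrightarrow> f i x \<in> ell2 A"
  by (rule bop_in[OF isom_bop[OF iso]])

lemma coord_bop: "i \<in> I \<Longrightarrow> coord i \<in> bop (ell2 A) (ell2 (C i))"
  by (rule adj_bop[OF isom_bop[OF iso]])

lemma coord_in: "i \<in> I \<Longrightarrow> v \<in> ell2 A \<Longrightarrow> coord i v \<in> ell2 (C i)"
  by (rule bop_in[OF coord_bop])

lemma sum_in: "(\<And>i. i \<in> I \<Longrightarrow> x i \<in> ell2 (C i)) \<Longrightarrow> (\<lambda>l. \<Sum>i\<in>I. f i (x i) l) \<in> ell2 A"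
  by (intro ell2_sum f_in)

lemma coord_sum:
  assumes x: "\<And>i. i \<in> I \<Longrightarrow> x i \<in> ell2 (C i)" and j: "j \<in> I"
  shows "coord j (\<lambda>l. \<Sum>i\<in>I. f i (x i) l) = x j"
proof (rule adj_eqI[OF isom_bop[OF iso[OF j]] sum_in[OF x] x[OF j]])
  fix v assume v: "v \<in> ell2 (C j)"
  have "inner2 (f j v) (\<lambda>l. \<Sum>i\<in>I. f i (x i) l) = (\<Sum>i\<in>I. inner2 (f j v) (f i (x i)))"
    by (rule inner2_sum_right[OF f_in[OF j v] f_in[OF _ x]])
  also have "\<dots> = (\<Sum>i\<in>I. if i = j then inner2 v (x j) else 0)"
    by (intro sum.cong refl) (auto simp: isom_inner[OF iso[OF j] v x[OF j]] orth[OF j _ _ v x])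
  also have "\<dots> = inner2 v (x j)" using fin j by simp
  finally show "inner2 (f j v) (\<lambda>l. \<Sum>i\<in>I. f i (x i) l) = inner2 v (x j)" .
qed

lemma norm2_sum:
  assumes x: "\<And>i. i \<in> I \<Longrightarrow> x i \<in> ell2 (C i)"
  shows "(norm2 (\<lambda>l. \<Sum>i\<in>I. f i (x i) l))\<^sup>2 = (\<Sum>i\<in>I. (norm2 (x i))\<^sup>2)"
proof -
  let ?s = "\<lambda>l. \<Sum>i\<in>I. f i (x i) l"
  have "inner2 ?s ?s = (\<Sum>i\<in>I. inner2 (f i (x i)) ?s)"
    by (rule inner2_sum_left[OF sum_in[OF x] f_in[OF _ x]])
  also have "\<dots> = (\<Sum>i\<in>I. inner2 (x i) (coord i ?s))"
    by (intro sum.cong refl adj_inner[symmetric] isom_bop iso x sum_in)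
  also have "\<dots> = (\<Sum>i\<in>I. inner2 (x i) (x i))"
    by (simp add: coord_sum[OF x])
  also have "\<dots> = of_real (\<Sum>i\<in>I. (norm2 (x i))\<^sup>2)"
    using inner2_self[OF x] by simp
  finally have eq: "inner2 ?s ?s = of_real (\<Sum>i\<in>I. (norm2 (x i))\<^sup>2)" .
  have "complex_of_real ((norm2 ?s)\<^sup>2) = inner2 ?s ?s"
    by (rule inner2_self[symmetric], rule sum_in, rule x)
  with eq show ?thesis by (simp only: of_real_eq_iff)
qed

text \<open>The coordinate maps recover the summands of any decomposition, so mere spanning already
  yields a formula that is linear in \<open>v\<close>.\<close>

lemma resolution:
  assumes "\<And>i. i \<in> I \<Longrightarrow> x i \<in> ell2 (C i)" "v = (\<lambda>l. \<Sum>i\<in>I. f i (x i) l)"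
  shows "v = (\<lambda>l. \<Sum>i\<in>I. f i (coord i v) l)"
  using assms by (auto simp: coord_sum[OF assms(1)])

text \<open>Once each coefficient is absorbed into the argument of its operator, Pythagoras
  multiplies the squared norm of \<open>v\<close> by the sum of the squared moduli, which is
  1.\<close>

lemma linear_combination_isom:
  assumes C: "\<And>i. i \<in> I \<Longrightarrow> C i = D" and a: "(\<Sum>i\<in>I. (cmod (\<alpha> i))\<^sup>2) = 1"
  shows "isom (ell2 D) (ell2 A) (\<lambda>v\<in>ell2 D. \<lambda>l. \<Sum>i\<in>I. \<alpha> i * f i v l)"
proof (rule isomI)
  have *: "(\<lambda>l. \<Sum>i\<in>I. \<alpha> i * f i v l) = (\<lambda>l. \<Sum>i\<in>I. f i (\<lambda>x. \<alpha> i * v x) l)" if "v \<in> ell2 D" for v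
    using that by (intro ext sum.cong refl) (simp add: bop_scale[OF isom_bop[OF iso]] C)
  have s: "(\<lambda>x. \<alpha> i * v x) \<in> ell2 (C i)" if "v \<in> ell2 D" "i \<in> I" for v i
    using that by (simp add: C ell2_scale)
  show "(\<lambda>v\<in>ell2 D. \<lambda>l. \<Sum>i\<in>I. \<alpha> i * f i v l) \<in> ell2 D \<rightarrow>\<^sub>E ell2 A"
    using sum_in[OF s] by (intro PiE_I) (auto simp: *)
  fix v assume v: "v \<in> ell2 D"
  have "(norm2 (\<lambda>l. \<Sum>i\<in>I. \<alpha> i * f i v l))\<^sup>2 = (norm2 v)\<^sup>2"
    unfolding *[OF v] using a norm2_sum[of "\<lambda>i x. \<alpha> i * v x", OF s[OF v]]
    by (simp add: norm2_scale power_mult_distrib sum_distrib_right[symmetric] del: power2_eq_iff_nonneg)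
  then show "norm2 ((\<lambda>v\<in>ell2 D. \<lambda>l. \<Sum>i\<in>I. \<alpha> i * f i v l) v) = norm2 v"
    using v by (simp add: power2_eq_iff_nonneg)
next
  fix v w a b assume v: "v \<in> ell2 D" and w: "w \<in> ell2 D"
  have "f i (\<lambda>x. a * v x + b * w x) = (\<lambda>y. a * f i v y + b * f i w y)" if "i \<in> I" for i
    using bop_lin[OF isom_bop[OF iso[OF that]], of v w a b] v w C[OF that] by simp
  then have "(\<Sum>i\<in>I. \<alpha> i * f i (\<lambda>x. a * v x + b * w x) l)
      = a * (\<Sum>i\<in>I. \<alpha> i * f i v l) + b * (\<Sum>i\<in>I. \<alpha> i * f i w l)" for l
    by (simp add: sum_distrib_left sum.distrib[symmetric] algebra_simps)
  then show "(\<lambda>v\<in>ell2 D. \<lambda>l. \<Sum>i\<in>I. \<alpha> i * f i v l) (\<lambda>x. a * v x + b * w x)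
      = (\<lambda>y. a * (\<lambda>v\<in>ell2 D. \<lambda>l. \<Sum>i\<in>I. \<alpha> i * f i v l) v y
        + b * (\<lambda>v\<in>ell2 D. \<lambda>l. \<Sum>i\<in>I. \<alpha> i * f i v l) w y)"
    using v w ell2_lin[OF v w] by simp
qed

end

text \<open>Coordinates with respect to \<open>f\<close> are reused as coordinates with respect to
  \<open>g\<close>. The resolution for \<open>f\<close> gives norm preservation, the one for
  \<open>g\<close> gives surjectivity.\<close>

lemma change_of_basis_unitary:
  assumes f: "orth_isoms I C A f" and g: "orth_isoms I C B g"
    and res_f: "\<And>v. v \<in> ell2 A \<Longrightarrow> v = (\<lambda>l. \<Sum>i\<in>I. f i (adj (ell2 (C i)) (ell2 A) (f i) v) l)"
    and res_g: "\<And>v. v \<in> ell2 B \<Longrightarrow> v = (\<lambda>l. \<Sum>i\<in>I. g i (adj (ell2 (C i)) (ell2 B) (g i) v) l)"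
  shows "unitary_op (ell2 A) (ell2 B)
    (\<lambda>v\<in>ell2 A. \<lambda>l. \<Sum>i\<in>I. g i (adj (ell2 (C i)) (ell2 A) (f i) v) l)" (is "unitary_op _ _ ?U")
proof -
  interpret F: orth_isoms I C A f by (rule f)
  interpret G: orth_isoms I C B g by (rule g)
  have "isom (ell2 A) (ell2 B) ?U"
  proof (rule isomI)
    show "?U \<in> ell2 A \<rightarrow>\<^sub>E ell2 B"
      using G.sum_in F.coord_in by (intro PiE_I) auto
    fix v assume v: "v \<in> ell2 A"
    have "(norm2 (\<lambda>l. \<Sum>i\<in>I. g i (F.coord i v) l))\<^sup>2 = (\<Sum>i\<in>I. (norm2 (F.coord i v))\<^sup>2)"
      by (rule G.norm2_sum[OF F.coord_in[OF _ v]])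
    also have "\<dots> = (norm2 (\<lambda>l. \<Sum>i\<in>I. f i (F.coord i v) l))\<^sup>2"
      by (rule F.norm2_sum[OF F.coord_in[OF _ v], symmetric])
    also have "(\<lambda>l. \<Sum>i\<in>I. f i (F.coord i v) l) = v" by (rule res_f[OF v, symmetric])
    finally show "norm2 (?U v) = norm2 v" using v by (simp add: power2_eq_iff_nonneg)
  next
    fix v w a b assume v: "v \<in> ell2 A" and w: "w \<in> ell2 A"
    have "g i (F.coord i (\<lambda>x. a * v x + b * w x))
        = (\<lambda>y. a * g i (F.coord i v) y + b * g i (F.coord i w) y)" if i: "i \<in> I" for i
      unfolding bop_lin[OF F.coord_bop[OF i] v w]
      by (rule bop_lin[OF isom_bop[OF G.iso[OF i]] F.coord_in[OF i v] F.coord_in[OF i w]])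
    then show "?U (\<lambda>x. a * v x + b * w x) = (\<lambda>y. a * ?U v y + b * ?U w y)"
      using v w ell2_lin[OF v w] by (simp add: sum.distrib sum_distrib_left)
  qed
  moreover have "w \<in> ?U ` ell2 A" if w: "w \<in> ell2 B" for w
  proof (rule image_eqI)
    let ?v = "\<lambda>l. \<Sum>i\<in>I. f i (G.coord i w) l"
    show v: "?v \<in> ell2 A" by (rule F.sum_in[OF G.coord_in[OF _ w]])
    show "w = ?U ?v"
      using v res_g[OF w] by (simp add: F.coord_sum[OF G.coord_in[OF _ w]])
  qed
  ultimately show ?thesis unfolding unitary_op_def by blast
qed


subsection \<open>Completeness of orthonormal bases\<close>

text \<open>A choice that uniqueness makes canonical, see \<open>sem_den\<close>. It allows families
  of interpretations to be indexed by the terms of a basis.\<close>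

definition den :: "tm \<Rightarrow> ty \<Rightarrow> evec \<Rightarrow> vec" where
  "den t Q = (SOME f. \<exists>\<Gamma>. sem \<Gamma> t Q f)"

definition ctx_of :: "tm \<Rightarrow> ty \<Rightarrow> ctx" where
  "ctx_of t Q = (SOME \<Gamma>. \<exists>f. sem \<Gamma> t Q f)"

lemma sem_den: "sem \<Gamma> t Q f \<Longrightarrow> ctx_of t Q = \<Gamma>" "sem \<Gamma> t Q f \<Longrightarrow> den t Q = f"
proof -
  assume s: "sem \<Gamma> t Q f"
  have u: "\<Delta> = \<Gamma>" if "sem \<Delta> t Q g" for \<Delta> g
    using typed_ctx_unique[OF sem_typed[OF s] sem_typed[OF that]] .
  show "ctx_of t Q = \<Gamma>" unfolding ctx_of_def using s u by (blast intro: some_equality)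
  have "g = f" if "sem \<Delta> t Q g" for \<Delta> g
    using u[OF that] sem_unique[OF s] that by simp
  then show "den t Q = f" unfolding den_def using s by (blast intro: some_equality)
qed

lemma rng_TInl_I: "y \<in> rng s Q\<^sub>1 \<Longrightarrow> inj_left Q\<^sub>1 y \<in> rng (TInl s) (Plus Q\<^sub>1 Q\<^sub>2)"
proof -
  assume "y \<in> rng s Q\<^sub>1"
  then obtain \<Gamma> f v where f: "sem \<Gamma> s Q\<^sub>1 f" "v \<in> hctx \<Gamma>" "y = f v" by (auto simp: rng_def)
  then show ?thesis using rngI[OF sem_usem.inl[OF f(1)] f(2), of Q\<^sub>2] by (simp add: compose_eq)
qed

lemma rng_TInr_I: "y \<in> rng s Q\<^sub>2 \<Longrightarrow> inj_right Q\<^sub>2 y \<in> rng (TInr s) (Plus Q\<^sub>1 Q\<^sub>2)"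
proof -
  assume "y \<in> rng s Q\<^sub>2"
  then obtain \<Gamma> f v where f: "sem \<Gamma> s Q\<^sub>2 f" "v \<in> hctx \<Gamma>" "y = f v" by (auto simp: rng_def)
  then show ?thesis using rngI[OF sem_usem.inr[OF f(1)] f(2), of Q\<^sub>1] by (simp add: compose_eq)
qed

lemma rng_TSucc_I: "y \<in> rng s Qnat \<Longrightarrow> succ_op y \<in> rng (TSucc s) Qnat"
proof -
  assume "y \<in> rng s Qnat"
  then obtain \<Gamma> f v where f: "sem \<Gamma> s Qnat f" "v \<in> hctx \<Gamma>" "y = f v" by (auto simp: rng_def)
  then show ?thesis using rngI[OF sem_usem.succ[OF f(1)] f(2)] by (simp add: compose_eq)
qed

lemma hctx_empty: "(\<lambda>\<rho>. c * ket Map.empty \<rho>) \<in> hctx Map.empty"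
  unfolding hctx_def by (intro ell2_scale ell2_ket) (simp add: basis_ctx_empty)

lemma rng_TStar_I: "(\<lambda>l. c * ket LStar l) \<in> rng TStar One"
  using rngI[OF sem_usem.star hctx_empty[of c]] hctx_empty[of c] by (simp add: ket_def[of Map.empty])

lemma rng_TZero_I: "(\<lambda>l. c * ket (LNat 0) l) \<in> rng TZero Qnat"
  using rngI[OF sem_usem.zero hctx_empty[of c]] hctx_empty[of c] by (simp add: ket_def[of Map.empty])

text \<open>The vectors without a component at 0 are the values of \<open>succ_op\<close>;
  \<open>y\<close> is the remainder of \<open>v\<close> shifted down by one.\<close>

lemma hty_Qnat_split:
  assumes v: "v \<in> hty Qnat"
  shows "\<exists>y\<in>hty Qnat. v = (\<lambda>l. v (LNat 0) * ket (LNat 0) l + succ_op y l)"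
proof -
  let ?\<psi> = "\<lambda>l. case l of LNat n \<Rightarrow> LNat (Suc n) | _ \<Rightarrow> l"
  let ?C = "range (\<lambda>n. LNat (Suc n))"
  have b: "bij_betw ?\<psi> (basis Qnat) ?C"
    by (auto simp: bij_betw_def inj_on_def image_image)
  define v' where "v' = (\<lambda>l. v l - v (LNat 0) * ket (LNat 0) l)"
  have "v' \<in> ell2 (basis Qnat)"
    unfolding v'_def using v by (intro ell2_diff ell2_scale ell2_ket) (auto simp: hty_def)
  moreover have "v' l = 0" if "l \<notin> ?C" for l
  proof (cases "l \<in> range LNat")
    case True
    then obtain m where "l = LNat m" by blast
    then show ?thesis using that by (cases m) (auto simp: v'_def ket_def)
  next
    case False
    then show ?thesis using ell2_outside[OF \<open>v' \<in> ell2 (basis Qnat)\<close>, of l] by simp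
  qed
  ultimately have v': "v' \<in> ell2 ?C" by (simp add: ell2_def)
  let ?y = "reindex_op ?\<psi> ?C (basis Qnat) v'"
  have y: "?y \<in> hty Qnat" unfolding hty_def by (rule bop_in[OF isom_bop[OF reindex_op_isom[OF b]] v'])
  have "v l = v (LNat 0) * ket (LNat 0) l + succ_op ?y l" for l
  proof (cases l)
    case (LNat m)
    then show ?thesis using y v' by (cases m) (auto simp: succ_op_def reindex_op_def v'_def ket_def)
  qed (use v y in \<open>auto simp: succ_op_def hty_def ell2_def ket_def\<close>)
  then show ?thesis using y by blast
qed

text \<open>When \<open>den t Q\<close> is an isometry, this is the orthogonal projection onto
  \<open>rng t Q\<close>.\<close>

definition proj :: "tm \<Rightarrow> ty \<Rightarrow> vec \<Rightarrow> vec" where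
  "proj t Q = compose (hty Q) (den t Q) (adj (hctx (ctx_of t Q)) (hty Q) (den t Q))"

context isometric_below
begin

lemma orth_isoms_den:
  assumes "finite S" "\<And>e e'. e \<in> S \<Longrightarrow> e' \<in> S \<Longrightarrow> e \<noteq> e' \<Longrightarrow> e \<bottom>\<bottom> e'"
    and S: "\<And>e. e \<in> S \<Longrightarrow> size e < n" and sem: "\<And>e. e \<in> S \<Longrightarrow> \<exists>\<Gamma> f. sem \<Gamma> e Q f"
  shows "orth_isoms S (\<lambda>e. basis_ctx (ctx_of e Q)) (basis Q) (\<lambda>e. den e Q)"
proof
  have s: "sem (ctx_of e Q) e Q (den e Q)" if e: "e \<in> S" for e
  proof -
    from sem[OF e] obtain \<Gamma> f where "sem \<Gamma> e Q f" by blast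
    then show ?thesis using sem_den[of \<Gamma> e Q f] by simp
  qed
  show "isom (ell2 (basis_ctx (ctx_of e Q))) (ell2 (basis Q)) (den e Q)" if "e \<in> S" for e
    using below_isom[OF S[OF that] s[OF that]] by (simp add: hctx_def hty_def)
  show "inner2 (den i Q x) (den j Q y) = 0"
    if "i \<in> S" "j \<in> S" "i \<noteq> j" "x \<in> ell2 (basis_ctx (ctx_of i Q))" "y \<in> ell2 (basis_ctx (ctx_of j Q))"
    for i j x y
    using orth_sound[OF assms(2)[OF that(1-3)] S S rngI[OF s] rngI[OF s]] that by (simp add: hctx_def)
qed (rule assms(1))

text \<open>Orthogonality turns an arbitrary decomposition into the one by projections. The
  induction for completeness establishes only the former, but its tensor cases apply the latter to
  the components.\<close>

lemma span_resolution:
  assumes ob: "ONBe Q S" and S: "\<And>e. e \<in> S \<Longrightarrow> size e < n" and sem: "\<And>e. e \<in> S \<Longrightarrow> \<exists>\<Gamma> f. sem \<Gamma> e Q f"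
    and v: "v \<in> hty Q" and span: "\<exists>w. (\<forall>e\<in>S. w e \<in> rng e Q) \<and> v = (\<lambda>l. \<Sum>e\<in>S. w e l)"
  shows "v = (\<lambda>l. \<Sum>e\<in>S. proj e Q v l)"
proof -
  interpret orth_isoms S "\<lambda>e. basis_ctx (ctx_of e Q)" "basis Q" "\<lambda>e. den e Q"
    by (rule orth_isoms_den[OF ONBe_finite[OF ob] ONBe_orth[OF ob] S sem])
  from span obtain w where w: "\<And>e. e \<in> S \<Longrightarrow> w e \<in> rng e Q" "v = (\<lambda>l. \<Sum>e\<in>S. w e l)" by blast
  have "\<exists>x. x \<in> ell2 (basis_ctx (ctx_of e Q)) \<and> w e = den e Q x" if "e \<in> S" for e
    using w(1)[OF that] sem_den unfolding rng_def hctx_def by blast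
  then obtain x where x: "\<And>e. e \<in> S \<Longrightarrow> x e \<in> ell2 (basis_ctx (ctx_of e Q))" "\<And>e. e \<in> S \<Longrightarrow> w e = den e Q (x e)"
    by metis
  have "v = (\<lambda>l. \<Sum>e\<in>S. den e Q (x e) l)" unfolding w(2) using x(2) by simp
  from resolution[OF x(1) this] show ?thesis
    using v by (simp add: proj_def compose_eq hctx_def hty_def)
qed

lemma proj_bop: "size t < n \<Longrightarrow> sem \<Gamma> t Q f \<Longrightarrow> proj t Q \<in> bop (hty Q) (hty Q)"
proof -
  assume t: "size t < n" "sem \<Gamma> t Q f"
  note b = isom_bop[OF below_isom[OF t], unfolded hty_def hctx_def]
  show ?thesis
    unfolding proj_def sem_den[OF t(2)] hty_def hctx_def by (rule bop_compose[OF adj_bop[OF b] b])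
qed

text \<open>The tensor product of the projections factors through the context as the product of the
  adjoints followed by the product of the interpretations, and the second factor is the
  interpretation of the pair.\<close>

lemma tensor_proj_rng:
  assumes h: "sem \<Gamma> (TPair t s) (Tensor Q\<^sub>1 Q\<^sub>2) h" and sz: "size t < n" "size s < n" and v: "v \<in> hty (Tensor Q\<^sub>1 Q\<^sub>2)"
  shows "pairing2.tensor (basis Q\<^sub>1) (basis Q\<^sub>2) (basis (Tensor Q\<^sub>1 Q\<^sub>2)) LPair
      (basis Q\<^sub>1) (basis Q\<^sub>2) (basis (Tensor Q\<^sub>1 Q\<^sub>2)) LPair (proj t Q\<^sub>1) (proj s Q\<^sub>2) v
    \<in> rng (TPair t s) (Tensor Q\<^sub>1 Q\<^sub>2)"
proof -
  obtain \<Gamma>\<^sub>1 \<Gamma>\<^sub>2 R\<^sub>1 R\<^sub>2 f g where 1: "Tensor Q\<^sub>1 Q\<^sub>2 = Tensor R\<^sub>1 R\<^sub>2" "\<Gamma> = \<Gamma>\<^sub>1 ++ \<Gamma>\<^sub>2" "dom \<Gamma>\<^sub>1 \<inter> dom \<Gamma>\<^sub>2 = {}"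
    "sem \<Gamma>\<^sub>1 t R\<^sub>1 f" "sem \<Gamma>\<^sub>2 s R\<^sub>2 g"
    "isom (ell2 (basis_ctx \<Gamma>\<^sub>1)) (ell2 (basis R\<^sub>1)) f" "isom (ell2 (basis_ctx \<Gamma>\<^sub>2)) (ell2 (basis R\<^sub>2)) g"
    "pairing2 (basis_ctx \<Gamma>\<^sub>1) (basis_ctx \<Gamma>\<^sub>2) (basis_ctx \<Gamma>) (++) (etensor \<Gamma>\<^sub>1 \<Gamma>\<^sub>2)
       (basis R\<^sub>1) (basis R\<^sub>2) (basis (Tensor Q\<^sub>1 Q\<^sub>2)) LPair vtensor"
    "h = pairing2.tensor (basis_ctx \<Gamma>\<^sub>1) (basis_ctx \<Gamma>\<^sub>2) (basis_ctx \<Gamma>) (++) (basis R\<^sub>1) (basis R\<^sub>2) (basis (Tensor Q\<^sub>1 Q\<^sub>2)) LPair f g"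
    by (rule sem_TPair[OF h sz])
  have R: "R\<^sub>1 = Q\<^sub>1" "R\<^sub>2 = Q\<^sub>2" using 1(1) by simp_all
  note s = 1(4-9)[unfolded R]
  note fb = isom_bop[OF s(3)] and gb = isom_bop[OF s(4)]
  let ?f' = "adj (ell2 (basis_ctx \<Gamma>\<^sub>1)) (ell2 (basis Q\<^sub>1)) f" and ?g' = "adj (ell2 (basis_ctx \<Gamma>\<^sub>2)) (ell2 (basis Q\<^sub>2)) g"
  note v' = v[unfolded hty_def]
  have pc: "pairing2 (basis Q\<^sub>1) (basis Q\<^sub>2) (basis (Tensor Q\<^sub>1 Q\<^sub>2)) LPair vtensor
      (basis_ctx \<Gamma>\<^sub>1) (basis_ctx \<Gamma>\<^sub>2) (basis_ctx \<Gamma>) (++) (etensor \<Gamma>\<^sub>1 \<Gamma>\<^sub>2)"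
    unfolding 1(2) by (intro pairing2.intro pairing_ctx 1 pairing_ty)
  have "proj t Q\<^sub>1 = compose (ell2 (basis Q\<^sub>1)) f ?f'" "proj s Q\<^sub>2 = compose (ell2 (basis Q\<^sub>2)) g ?g'"
    using sem_den[OF s(1)] sem_den[OF s(2)] by (simp_all add: proj_def hty_def hctx_def)
  moreover have "pairing2.tensor (basis Q\<^sub>1) (basis Q\<^sub>2) (basis (Tensor Q\<^sub>1 Q\<^sub>2)) LPair
      (basis_ctx \<Gamma>\<^sub>1) (basis_ctx \<Gamma>\<^sub>2) (basis_ctx \<Gamma>) (++) ?f' ?g' v \<in> hctx \<Gamma>"
    unfolding hctx_def by (rule bop_in[OF pairing2.tensor_bop[OF pc adj_bop[OF fb] adj_bop[OF gb]] v'])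
  ultimately show ?thesis
    using rngI[OF h, unfolded s(6)] tensor_compose[OF pc s(5) adj_bop[OF fb] adj_bop[OF gb] fb gb v'] by metis
qed

lemma TPair_components:
  assumes "\<And>e. e \<in> S \<Longrightarrow> size e < n" "\<And>e. e \<in> S \<Longrightarrow> \<exists>\<Gamma> f. sem \<Gamma> e (Tensor Q\<^sub>1 Q\<^sub>2) f" "TPair t s \<in> S"
  shows "size t < n \<and> size s < n \<and> (\<exists>\<Gamma> f. sem \<Gamma> t Q\<^sub>1 f) \<and> (\<exists>\<Gamma> f. sem \<Gamma> s Q\<^sub>2 f)"
  using assms(1)[OF assms(3)] assms(2)[OF assms(3)] by (auto elim!: sem_TPairE)

context
  fixes t s Q\<^sub>1 Q\<^sub>2 v
  assumes t: "size t < n" "\<exists>\<Gamma> f. sem \<Gamma> t Q\<^sub>1 f" and s: "size s < n" "\<exists>\<Gamma> f. sem \<Gamma> s Q\<^sub>2 f"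
    and v: "v \<in> hty (Tensor Q\<^sub>1 Q\<^sub>2)"
begin

interpretation T: pairing2 "basis Q\<^sub>1" "basis Q\<^sub>2" "basis (Tensor Q\<^sub>1 Q\<^sub>2)" LPair vtensor
    "basis Q\<^sub>1" "basis Q\<^sub>2" "basis (Tensor Q\<^sub>1 Q\<^sub>2)" LPair vtensor
  by (intro pairing2.intro pairing_ty)

lemma tensor_proj_in: "T.tensor (proj t Q\<^sub>1) (proj s Q\<^sub>2) v \<in> hty (Tensor Q\<^sub>1 Q\<^sub>2)"
  using t s proj_bop bop_in[OF T.tensor_bop] v unfolding hty_def by blast

text \<open>Both orders are recorded: a basis fibred over second components is summed over first
  components innermost, and conversely.\<close>

lemma tensor_proj_apply:
  assumes "a \<in> basis Q\<^sub>1" "c \<in> basis Q\<^sub>2"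
  shows "T.tensor (proj t Q\<^sub>1) (proj s Q\<^sub>2) v (LPair a c) = proj t Q\<^sub>1 (\<lambda>x. proj s Q\<^sub>2 (\<lambda>y. v (LPair x y)) c) a"
    and "T.tensor (proj t Q\<^sub>1) (proj s Q\<^sub>2) v (LPair a c) = proj s Q\<^sub>2 (\<lambda>y. proj t Q\<^sub>1 (\<lambda>x. v (LPair x y)) a) c"
proof -
  have b: "proj t Q\<^sub>1 \<in> bop (ell2 (basis Q\<^sub>1)) (ell2 (basis Q\<^sub>1))" "proj s Q\<^sub>2 \<in> bop (ell2 (basis Q\<^sub>2)) (ell2 (basis Q\<^sub>2))"
    using t s proj_bop unfolding hty_def by blast+
  show "T.tensor (proj t Q\<^sub>1) (proj s Q\<^sub>2) v (LPair a c) = proj t Q\<^sub>1 (\<lambda>x. proj s Q\<^sub>2 (\<lambda>y. v (LPair x y)) c) a"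
    unfolding T.tensor_apply[OF b v[unfolded hty_def] assms] ty_row[OF v] ..
  show "T.tensor (proj t Q\<^sub>1) (proj s Q\<^sub>2) v (LPair a c) = proj s Q\<^sub>2 (\<lambda>y. proj t Q\<^sub>1 (\<lambda>x. v (LPair x y)) a) c"
    unfolding T.tensor_apply_flip[OF b v[unfolded hty_def] assms] ty_row[OF v] ..
qed

end

lemma proj_row_in:
  assumes "size s < n" "sem \<Gamma> s Q\<^sub>2 f" and v: "v \<in> hty (Tensor Q\<^sub>1 Q\<^sub>2)"
  shows "(\<lambda>x. proj s Q\<^sub>2 (\<lambda>y. v (LPair x y)) c) \<in> hty Q\<^sub>1"
  using pairing2.row_image_in[OF pairing2.intro[OF pairing_ty pairing_ty]
      proj_bop[OF assms(1,2), unfolded hty_def] v[unfolded hty_def], where b' = c]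
  by (simp add: ty_row[OF v] hty_def)

lemma proj_col_in:
  assumes "size t < n" "sem \<Gamma> t Q\<^sub>1 f" and v: "v \<in> hty (Tensor Q\<^sub>1 Q\<^sub>2)"
  shows "(\<lambda>y. proj t Q\<^sub>1 (\<lambda>x. v (LPair x y)) a) \<in> hty Q\<^sub>2"
  using pairing2.col_image_in[OF pairing2.intro[OF pairing_ty pairing_ty]
      proj_bop[OF assms(1,2), unfolded hty_def] v[unfolded hty_def], where a' = a]
  by (simp add: ty_row[OF v] hty_def)

lemma ty_eqI:
  assumes "v \<in> hty (Tensor Q\<^sub>1 Q\<^sub>2)" "w \<in> hty (Tensor Q\<^sub>1 Q\<^sub>2)"
    "\<And>a c. a \<in> basis Q\<^sub>1 \<Longrightarrow> c \<in> basis Q\<^sub>2 \<Longrightarrow> v (LPair a c) = w (LPair a c)"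
  shows "v = w"
  using pairing.ell2_D_eqI[OF pairing_ty, of v Q\<^sub>1 Q\<^sub>2 w] assms by (simp add: hty_def)

lemma tensor_proj_rng_pairs:
  assumes "pair_set S" "\<And>e. e \<in> S \<Longrightarrow> size e < n" "\<And>e. e \<in> S \<Longrightarrow> \<exists>\<Gamma> f. sem \<Gamma> e (Tensor Q\<^sub>1 Q\<^sub>2) f"
    "v \<in> hty (Tensor Q\<^sub>1 Q\<^sub>2)" "e \<in> S"
  shows "(case e of TPair t s \<Rightarrow> pairing2.tensor (basis Q\<^sub>1) (basis Q\<^sub>2) (basis (Tensor Q\<^sub>1 Q\<^sub>2)) LPair
      (basis Q\<^sub>1) (basis Q\<^sub>2) (basis (Tensor Q\<^sub>1 Q\<^sub>2)) LPair (proj t Q\<^sub>1) (proj s Q\<^sub>2) v)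
    \<in> rng e (Tensor Q\<^sub>1 Q\<^sub>2)"
proof -
  obtain t s where e: "e = TPair t s" using assms(1,5) by (auto simp: pair_set_def)
  obtain \<Gamma> h where "sem \<Gamma> (TPair t s) (Tensor Q\<^sub>1 Q\<^sub>2) h" using assms(3)[OF assms(5)] e by blast
  from tensor_proj_rng[OF this _ _ assms(4)] show ?thesis using assms(2)[OF assms(5)] e by simp
qed

text \<open>For tensors, the components of \<open>v\<close> are its images under products of
  projections. Summing over one fibre collapses one factor to the identity, and summing over the
  base collapses the other.\<close>

lemma ONBe_span:
  assumes "ONBe Q S" "\<And>e. e \<in> S \<Longrightarrow> size e < n" "\<And>e. e \<in> S \<Longrightarrow> \<exists>\<Gamma> f. sem \<Gamma> e Q f" "v \<in> hty Q"
  shows "\<exists>w. (\<forall>e\<in>S. w e \<in> rng e Q) \<and> v = (\<lambda>l. \<Sum>e\<in>S. w e l)"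
  using assms
proof (induction arbitrary: v rule: ONBe.induct)
  case (var Q x)
  have "v \<in> rng (TVar x) Q"
    using var_surj[OF var.prems(3), of x] rngI[OF sem_usem.var, of _ x Q] by auto
  then show ?case by (intro exI[of _ "\<lambda>_. v"]) simp
next
  case star
  have "v = (\<lambda>l. v LStar * ket LStar l)"
    using star.prems(3) by (auto simp: hty_def ell2_def ket_def)
  then have "v \<in> rng TStar One" using rng_TStar_I by metis
  then show ?case by (intro exI[of _ "\<lambda>_. v"]) simp
next
  case (plus Q\<^sub>1 S Q\<^sub>2 T)
  note c = hty_Plus_components[OF plus.prems(3)]
  have S: "\<exists>w. (\<forall>e\<in>S. w e \<in> rng e Q\<^sub>1) \<and> (\<lambda>b. v (LInl b)) = (\<lambda>l. \<Sum>e\<in>S. w e l)"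
  proof (rule plus.IH(1)[OF _ _ c(1)])
    fix e assume "e \<in> S"
    then show "size e < n" "\<exists>\<Gamma> f. sem \<Gamma> e Q\<^sub>1 f"
      using plus.prems(1)[of "TInl e"] plus.prems(2)[of "TInl e"] by (auto elim!: sem_TInlE)
  qed
  have T: "\<exists>w. (\<forall>e\<in>T. w e \<in> rng e Q\<^sub>2) \<and> (\<lambda>b. v (LInr b)) = (\<lambda>l. \<Sum>e\<in>T. w e l)"
  proof (rule plus.IH(2)[OF _ _ c(2)])
    fix e assume "e \<in> T"
    then show "size e < n" "\<exists>\<Gamma> f. sem \<Gamma> e Q\<^sub>2 f"
      using plus.prems(1)[of "TInr e"] plus.prems(2)[of "TInr e"] by (auto elim!: sem_TInrE)
  qed
  from S obtain w\<^sub>1 where w1: "\<And>e. e \<in> S \<Longrightarrow> w\<^sub>1 e \<in> rng e Q\<^sub>1" "(\<lambda>b. v (LInl b)) = (\<lambda>l. \<Sum>e\<in>S. w\<^sub>1 e l)" by blast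
  from T obtain w\<^sub>2 where w2: "\<And>e. e \<in> T \<Longrightarrow> w\<^sub>2 e \<in> rng e Q\<^sub>2" "(\<lambda>b. v (LInr b)) = (\<lambda>l. \<Sum>e\<in>T. w\<^sub>2 e l)" by blast
  have h1: "w\<^sub>1 e \<in> hty Q\<^sub>1" if "e \<in> S" for e
    using rng_hty[OF _ w1(1)[OF that]] plus.prems(1)[of "TInl e"] that by simp
  have h2: "w\<^sub>2 e \<in> hty Q\<^sub>2" if "e \<in> T" for e
    using rng_hty[OF _ w2(1)[OF that]] plus.prems(1)[of "TInr e"] that by simp
  define w where "w t = (case t of TInl s \<Rightarrow> inj_left Q\<^sub>1 (w\<^sub>1 s) | TInr s \<Rightarrow> inj_right Q\<^sub>2 (w\<^sub>2 s) | _ \<Rightarrow> \<lambda>_. 0)" for t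
  have "\<forall>e\<in>TInl ` S \<union> TInr ` T. w e \<in> rng e (Plus Q\<^sub>1 Q\<^sub>2)"
    using w1(1) w2(1) by (auto simp: w_def intro!: rng_TInl_I rng_TInr_I)
  moreover have "v = (\<lambda>l. \<Sum>e\<in>TInl ` S \<union> TInr ` T. w e l)"
  proof
    fix l
    have fin: "finite S" "finite T" using ONBe_finite plus.hyps by blast+
    have "(\<Sum>e\<in>TInl ` S \<union> TInr ` T. w e l) = (\<Sum>e\<in>TInl ` S. w e l) + (\<Sum>e\<in>TInr ` T. w e l)"
      using fin by (intro sum.union_disjoint) auto
    also have "\<dots> = (\<Sum>e\<in>S. inj_left Q\<^sub>1 (w\<^sub>1 e) l) + (\<Sum>e\<in>T. inj_right Q\<^sub>2 (w\<^sub>2 e) l)"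
      by (simp add: sum.reindex inj_on_def w_def)
    also have "\<dots> = inj_left Q\<^sub>1 (\<lambda>b. v (LInl b)) l + inj_right Q\<^sub>2 (\<lambda>b. v (LInr b)) l"
      unfolding w1(2) w2(2)
      using bop_sum[OF isom_bop[OF inj_left_isom[unfolded hty_def]], of S w\<^sub>1]
        bop_sum[OF isom_bop[OF inj_right_isom[unfolded hty_def]], of T w\<^sub>2] h1 h2 by (simp add: hty_def)
    also have "\<dots> = v l" by (rule fun_cong[OF c(3), symmetric])
    finally show "v l = (\<Sum>e\<in>TInl ` S \<union> TInr ` T. w e l)" ..
  qed
  ultimately show ?case by blast
next
  case (nat S)
  obtain y where y: "y \<in> hty Qnat" "v = (\<lambda>l. v (LNat 0) * ket (LNat 0) l + succ_op y l)"
    using hty_Qnat_split[OF nat.prems(3)] by blast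
  have "\<exists>w. (\<forall>e\<in>S. w e \<in> rng e Qnat) \<and> y = (\<lambda>l. \<Sum>e\<in>S. w e l)"
  proof (rule nat.IH[OF _ _ y(1)])
    fix e assume "e \<in> S"
    then show "size e < n" "\<exists>\<Gamma> f. sem \<Gamma> e Qnat f"
      using nat.prems(1)[of "TSucc e"] nat.prems(2)[of "TSucc e"] by (auto elim!: sem_TSuccE)
  qed
  then obtain w' where w': "\<And>e. e \<in> S \<Longrightarrow> w' e \<in> rng e Qnat" "y = (\<lambda>l. \<Sum>e\<in>S. w' e l)" by blast
  have h: "w' e \<in> hty Qnat" if "e \<in> S" for e
    using rng_hty[OF _ w'(1)[OF that]] nat.prems(1)[of "TSucc e"] that by simp
  define w where "w t = (case t of TSucc s \<Rightarrow> succ_op (w' s) | _ \<Rightarrow> \<lambda>l. v (LNat 0) * ket (LNat 0) l)" for t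
  have "\<forall>e\<in>{TZero} \<union> TSucc ` S. w e \<in> rng e Qnat"
    using w'(1) by (auto simp: w_def intro: rng_TSucc_I rng_TZero_I)
  moreover have "v = (\<lambda>l. \<Sum>e\<in>{TZero} \<union> TSucc ` S. w e l)"
  proof
    fix l
    have fin: "finite S" using ONBe_finite nat.hyps by blast
    have "(\<Sum>e\<in>{TZero} \<union> TSucc ` S. w e l) = w TZero l + (\<Sum>e\<in>TSucc ` S. w e l)"
      using fin by (subst sum.union_disjoint) auto
    also have "\<dots> = v (LNat 0) * ket (LNat 0) l + (\<Sum>e\<in>S. succ_op (w' e) l)"
      by (simp add: sum.reindex inj_on_def w_def)
    also have "\<dots> = v (LNat 0) * ket (LNat 0) l + succ_op y l"
      unfolding w'(2) using bop_sum[OF isom_bop[OF succ_op_isom[unfolded hty_def]], of S w'] h by (simp add: hty_def)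
    also have "\<dots> = v l" by (rule fun_cong[OF y(2), symmetric])
    finally show "v l = (\<Sum>e\<in>{TZero} \<union> TSucc ` S. w e l)" ..
  qed
  ultimately show ?case by blast
next
  case (tensor2 S Q\<^sub>2 Q\<^sub>1)
  let ?T = "\<lambda>b b'. pairing2.tensor (basis Q\<^sub>1) (basis Q\<^sub>2) (basis (Tensor Q\<^sub>1 Q\<^sub>2)) LPair
      (basis Q\<^sub>1) (basis Q\<^sub>2) (basis (Tensor Q\<^sub>1 Q\<^sub>2)) LPair (proj b Q\<^sub>1) (proj b' Q\<^sub>2) v"
  have comp: "size b < n \<and> size b' < n \<and> (\<exists>\<Gamma> f. sem \<Gamma> b Q\<^sub>1 f) \<and> (\<exists>\<Gamma> f. sem \<Gamma> b' Q\<^sub>2 f)"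
    if "TPair b b' \<in> S" for b b'
    by (rule TPair_components[OF tensor2.prems(1,2) that])
  \<comment> \<open>A set of pairs is the disjoint union of its fibres over the second
    projection.\<close>
  have sum_pairs: "(\<Sum>e\<in>S. g e) = (\<Sum>b'\<in>proj2 S. \<Sum>b\<in>fibre2 S b'. g (TPair b b'))" for g :: "tm \<Rightarrow> complex"
  proof -
    have fin: "finite (proj2 S)" "\<And>b'. b' \<in> proj2 S \<Longrightarrow> finite (fibre2 S b')"
      using ONBe_finite tensor2.hyps by blast+
    have "x \<in> (\<lambda>(b', b). TPair b b') ` Sigma (proj2 S) (fibre2 S)" if x: "x \<in> S" for x
    proof -
      obtain b b' where "x = TPair b b'" using tensor2.hyps(2) x by (auto simp: pair_set_def)
      then show ?thesis using x by (intro image_eqI[where x = "(b', b)"]) (auto simp: proj2_def fibre2_def)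
    qed
    then have "bij_betw (\<lambda>(b', b). TPair b b') (Sigma (proj2 S) (fibre2 S)) S"
      by (auto simp: bij_betw_def inj_on_def fibre2_def)
    from sum.reindex_bij_betw[OF this, of g, symmetric]
    show ?thesis using fin by (simp add: sum.Sigma case_prod_unfold)
  qed
  have "v = (\<lambda>l. \<Sum>b'\<in>proj2 S. \<Sum>b\<in>fibre2 S b'. ?T b b' l)"
  proof (rule ty_eqI[OF tensor2.prems(3)])
    have "?T b b' \<in> hty (Tensor Q\<^sub>1 Q\<^sub>2)" if "b' \<in> proj2 S" "b \<in> fibre2 S b'" for b b'
      using comp[of b b'] that tensor_proj_in[OF _ _ _ _ tensor2.prems(3)] by (auto simp: fibre2_def)
    then show "(\<lambda>l. \<Sum>b'\<in>proj2 S. \<Sum>b\<in>fibre2 S b'. ?T b b' l) \<in> hty (Tensor Q\<^sub>1 Q\<^sub>2)"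
      unfolding hty_def by (intro ell2_sum) auto
    fix a c assume ac: "a \<in> basis Q\<^sub>1" "c \<in> basis Q\<^sub>2"
    \<comment> \<open>For fixed \<open>b'\<close> and \<open>c\<close> the projected rows form one
      vector of the first factor. Completeness of the fibre over \<open>b'\<close>, applied to that
      vector, removes the projections onto the first components.\<close>
    have inner: "(\<Sum>b\<in>fibre2 S b'. ?T b b' (LPair a c)) = proj b' Q\<^sub>2 (\<lambda>y. v (LPair a y)) c"
      if b': "b' \<in> proj2 S" for b'
    proof -
      let ?u = "\<lambda>x. proj b' Q\<^sub>2 (\<lambda>y. v (LPair x y)) c"
      obtain b0 where b0: "b0 \<in> fibre2 S b'" using b' by (auto simp: proj2_def fibre2_def)
      then have c': "size b' < n" "\<exists>\<Gamma> f. sem \<Gamma> b' Q\<^sub>2 f" using comp[of b0 b'] by (auto simp: fibre2_def)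
      have u: "?u \<in> hty Q\<^sub>1" using proj_row_in[OF _ _ tensor2.prems(3)] c' by blast
      have "(\<Sum>b\<in>fibre2 S b'. ?T b b' (LPair a c)) = (\<Sum>b\<in>fibre2 S b'. proj b Q\<^sub>1 ?u a)"
        using comp[of _ b'] tensor_proj_apply(1)[OF _ _ _ _ tensor2.prems(3) ac]
        by (intro sum.cong refl) (auto simp: fibre2_def)
      also have "\<dots> = ?u a"
        by (rule fun_cong[OF span_resolution[OF tensor2.hyps(4)[OF b'] _ _ u
              tensor2.IH(2)[OF b' _ _ u]], symmetric])
           (use comp[of _ b'] in \<open>auto simp: fibre2_def\<close>)
      finally show ?thesis .
    qed
    have row: "(\<lambda>y. v (LPair a y)) \<in> hty Q\<^sub>2" by (rule ty_row_in[OF tensor2.prems(3)])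
    have "v (LPair a c) = (\<Sum>b'\<in>proj2 S. proj b' Q\<^sub>2 (\<lambda>y. v (LPair a y)) c)"
      by (rule fun_cong[OF span_resolution[OF tensor2.hyps(3) _ _ row tensor2.IH(1)[OF _ _ row]]])
         (use comp in \<open>auto simp: proj2_def\<close>)
    then show "v (LPair a c) = (\<Sum>b'\<in>proj2 S. \<Sum>b\<in>fibre2 S b'. ?T b b' (LPair a c))"
      using inner by simp
  qed
  then have "v = (\<lambda>l. \<Sum>e\<in>S. (case e of TPair b b' \<Rightarrow> ?T b b') l)"
    unfolding sum_pairs by simp
  moreover have "\<forall>e\<in>S. (case e of TPair b b' \<Rightarrow> ?T b b') \<in> rng e (Tensor Q\<^sub>1 Q\<^sub>2)"
    using tensor_proj_rng_pairs[OF tensor2.hyps(2) tensor2.prems] by blast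
  ultimately show ?case by blast
next
  case (tensor1 S Q\<^sub>1 Q\<^sub>2)
  let ?T = "\<lambda>b b'. pairing2.tensor (basis Q\<^sub>1) (basis Q\<^sub>2) (basis (Tensor Q\<^sub>1 Q\<^sub>2)) LPair
      (basis Q\<^sub>1) (basis Q\<^sub>2) (basis (Tensor Q\<^sub>1 Q\<^sub>2)) LPair (proj b Q\<^sub>1) (proj b' Q\<^sub>2) v"
  have comp: "size b < n \<and> size b' < n \<and> (\<exists>\<Gamma> f. sem \<Gamma> b Q\<^sub>1 f) \<and> (\<exists>\<Gamma> f. sem \<Gamma> b' Q\<^sub>2 f)"
    if "TPair b b' \<in> S" for b b'
    by (rule TPair_components[OF tensor1.prems(1,2) that])
  have sum_pairs: "(\<Sum>e\<in>S. g e) = (\<Sum>b\<in>proj1 S. \<Sum>b'\<in>fibre1 S b. g (TPair b b'))" for g :: "tm \<Rightarrow> complex"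
  proof -
    have fin: "finite (proj1 S)" "\<And>b. b \<in> proj1 S \<Longrightarrow> finite (fibre1 S b)"
      using ONBe_finite tensor1.hyps by blast+
    have "x \<in> (\<lambda>(b, b'). TPair b b') ` Sigma (proj1 S) (fibre1 S)" if x: "x \<in> S" for x
    proof -
      obtain b b' where "x = TPair b b'" using tensor1.hyps(2) x by (auto simp: pair_set_def)
      then show ?thesis using x by (intro image_eqI[where x = "(b, b')"]) (auto simp: proj1_def fibre1_def)
    qed
    then have "bij_betw (\<lambda>(b, b'). TPair b b') (Sigma (proj1 S) (fibre1 S)) S"
      by (auto simp: bij_betw_def inj_on_def fibre1_def)
    from sum.reindex_bij_betw[OF this, of g, symmetric]
    show ?thesis using fin by (simp add: sum.Sigma case_prod_unfold)
  qed
  have "v = (\<lambda>l. \<Sum>b\<in>proj1 S. \<Sum>b'\<in>fibre1 S b. ?T b b' l)"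
  proof (rule ty_eqI[OF tensor1.prems(3)])
    have "?T b b' \<in> hty (Tensor Q\<^sub>1 Q\<^sub>2)" if "b \<in> proj1 S" "b' \<in> fibre1 S b" for b b'
      using comp[of b b'] that tensor_proj_in[OF _ _ _ _ tensor1.prems(3)] by (auto simp: fibre1_def)
    then show "(\<lambda>l. \<Sum>b\<in>proj1 S. \<Sum>b'\<in>fibre1 S b. ?T b b' l) \<in> hty (Tensor Q\<^sub>1 Q\<^sub>2)"
      unfolding hty_def by (intro ell2_sum) auto
    fix a c assume ac: "a \<in> basis Q\<^sub>1" "c \<in> basis Q\<^sub>2"
    \<comment> \<open>The roles of the factors are exchanged: the fibre over \<open>b\<close>
      consists of second components, so the formula with the second projection outermost is
      used.\<close>
    have inner: "(\<Sum>b'\<in>fibre1 S b. ?T b b' (LPair a c)) = proj b Q\<^sub>1 (\<lambda>x. v (LPair x c)) a"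
      if b: "b \<in> proj1 S" for b
    proof -
      let ?u = "\<lambda>y. proj b Q\<^sub>1 (\<lambda>x. v (LPair x y)) a"
      obtain b0 where b0: "b0 \<in> fibre1 S b" using b by (auto simp: proj1_def fibre1_def)
      then have c': "size b < n" "\<exists>\<Gamma> f. sem \<Gamma> b Q\<^sub>1 f" using comp[of b b0] by (auto simp: fibre1_def)
      have u: "?u \<in> hty Q\<^sub>2" using proj_col_in[OF _ _ tensor1.prems(3)] c' by blast
      have "(\<Sum>b'\<in>fibre1 S b. ?T b b' (LPair a c)) = (\<Sum>b'\<in>fibre1 S b. proj b' Q\<^sub>2 ?u c)"
        using comp[of b] tensor_proj_apply(2)[OF _ _ _ _ tensor1.prems(3) ac]
        by (intro sum.cong refl) (auto simp: fibre1_def)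
      also have "\<dots> = ?u c"
        by (rule fun_cong[OF span_resolution[OF tensor1.hyps(4)[OF b] _ _ u
              tensor1.IH(2)[OF b _ _ u]], symmetric])
           (use comp[of b] in \<open>auto simp: fibre1_def\<close>)
      finally show ?thesis .
    qed
    have col: "(\<lambda>x. v (LPair x c)) \<in> hty Q\<^sub>1" by (rule ty_col_in[OF tensor1.prems(3)])
    have "v (LPair a c) = (\<Sum>b\<in>proj1 S. proj b Q\<^sub>1 (\<lambda>x. v (LPair x c)) a)"
      by (rule fun_cong[OF span_resolution[OF tensor1.hyps(3) _ _ col tensor1.IH(1)[OF _ _ col]]])
         (use comp in \<open>auto simp: proj1_def\<close>)
    then show "v (LPair a c) = (\<Sum>b\<in>proj1 S. \<Sum>b'\<in>fibre1 S b. ?T b b' (LPair a c))"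
      using inner by simp
  qed
  then have "v = (\<lambda>l. \<Sum>e\<in>S. (case e of TPair b b' \<Rightarrow> ?T b b') l)"
    unfolding sum_pairs by simp
  moreover have "\<forall>e\<in>S. (case e of TPair b b' \<Rightarrow> ?T b b') \<in> rng e (Tensor Q\<^sub>1 Q\<^sub>2)"
    using tensor_proj_rng_pairs[OF tensor1.hyps(2) tensor1.prems] by blast
  ultimately show ?case by blast
next
  case (unitary Q S A)
  define \<phi> where "\<phi> = (\<lambda>e. LC S (A e) (\<lambda>e'. e'))"
  have fin: "finite S" and ne: "S \<noteq> {}"
    using ONBe_finite ONBe_nonempty unitary.hyps(1) by blast+
  have U1: "\<And>i j. i \<in> S \<Longrightarrow> j \<in> S \<Longrightarrow> (\<Sum>k\<in>S. A i k * cnj (A j k)) = (if i = j then 1 else 0)"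
    and U2: "\<And>i j. i \<in> S \<Longrightarrow> j \<in> S \<Longrightarrow> (\<Sum>k\<in>S. cnj (A k i) * A k j) = (if i = j then 1 else 0)"
    using unitary.hyps(2) unfolding unitary_matrix_def by blast+
  \<comment> \<open>Each element of \<open>S\<close> occurs once in every combination, so equal
    combinations have equal rows of coefficients, whereas distinct rows of \<open>A\<close> are
    orthogonal unit vectors.\<close>
  have inj: "inj_on \<phi> S"
  proof (rule inj_onI, rule ccontr)
    fix a b assume ab: "a \<in> S" "b \<in> S" "\<phi> a = \<phi> b" "a \<noteq> b"
    have "A b k = A a k" if "k \<in> S" for k
      using LC_memD[OF ab(3)[unfolded \<phi>_def] fin fin that] by auto
    then have "(\<Sum>k\<in>S. A a k * cnj (A b k)) = (\<Sum>k\<in>S. A a k * cnj (A a k))" by simp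
    then show False using U1[OF ab(1,2)] U1[OF ab(1,1)] ab(4) by simp
  qed
  obtain e0 where e0: "e0 \<in> S" using ne by blast
  have sz: "size j < n" if "j \<in> S" for j
    by (rule size_LC[OF unitary.prems(1)[OF imageI[OF e0]] fin that])
  \<comment> \<open>All elements of \<open>S\<close> occur in one typable combination and so share
    its context.\<close>
  obtain \<Gamma> h0 where h0: "sem \<Gamma> (\<phi> e0) Q h0" using unitary.prems(2)[of "\<phi> e0"] e0 by (auto simp: \<phi>_def)
  have sem0: "sem \<Gamma> j Q (den j Q)" if "j \<in> S" for j
  proof -
    from sem_LC[OF h0[unfolded \<phi>_def] fin] obtain F where "\<forall>j\<in>S. sem \<Gamma> j Q (F j)" by blast
    then have "sem \<Gamma> j Q (F j)" using that by blast
    then show ?thesis using sem_den(2) by simp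
  qed
  have semA: "sem \<Gamma> (\<phi> e) Q (\<lambda>v\<in>hctx \<Gamma>. \<lambda>l. \<Sum>j\<in>S. A e j * den j Q v l)" if e: "e \<in> S" for e
  proof -
    obtain \<Delta> h where h: "sem \<Delta> (\<phi> e) Q h" using unitary.prems(2)[of "\<phi> e"] e by (auto simp: \<phi>_def)
    obtain F where F: "\<forall>j\<in>S. sem \<Delta> j Q (F j)" "h = (\<lambda>v\<in>hctx \<Delta>. \<lambda>l. \<Sum>j\<in>S. A e j * F j v l)"
      using sem_LC[OF h[unfolded \<phi>_def] fin] by blast
    have "\<Delta> = \<Gamma>" using typed_ctx_unique[OF sem_typed[OF sem0[OF e0]] sem_typed] F(1) e0 by blast
    moreover have "F j = den j Q" if "j \<in> S" for j using F(1) that sem_den(2) by metis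
    ultimately show ?thesis using h F(2) by (simp cong: restrict_cong)
  qed
  obtain w where w: "\<And>j. j \<in> S \<Longrightarrow> w j \<in> rng j Q" "v = (\<lambda>l. \<Sum>j\<in>S. w j l)"
    using unitary.IH[OF sz _ unitary.prems(3)] sem0 by blast
  have "\<exists>x. x \<in> hctx \<Gamma> \<and> w j = den j Q x" if j: "j \<in> S" for j
  proof -
    obtain \<Delta> f x where D: "sem \<Delta> j Q f" "x \<in> hctx \<Delta>" "w j = f x" using w(1)[OF j] by (auto simp: rng_def)
    then show ?thesis using sem_den(1)[OF sem0[OF j]] sem_den[OF D(1)] by auto
  qed
  then obtain x where x: "\<And>j. j \<in> S \<Longrightarrow> x j \<in> hctx \<Gamma>" "\<And>j. j \<in> S \<Longrightarrow> w j = den j Q (x j)" by metis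
  \<comment> \<open>The coordinates change by the conjugated matrix. The vectors \<open>x i\<close>
    are the coordinates of \<open>v\<close> in the old basis, and orthonormality of the columns
    (\<open>U2\<close>) makes the new expansion sum to \<open>v\<close> again.\<close>
  define y where "y e = (\<lambda>\<rho>. \<Sum>i\<in>S. cnj (A e i) * x i \<rho>)" for e
  have y: "y e \<in> hctx \<Gamma>" for e
    unfolding y_def hctx_def by (intro ell2_sum ell2_scale) (use x in \<open>simp add: hctx_def\<close>)
  have den_y: "den j Q (y e) = (\<lambda>l. \<Sum>i\<in>S. cnj (A e i) * den j Q (x i) l)" if j: "j \<in> S" for e j
  proof -
    have b: "den j Q \<in> bop (ell2 (basis_ctx \<Gamma>)) (hty Q)"
      using isom_bop[OF below_isom[OF sz[OF j] sem0[OF j]]] by (simp add: hctx_def)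
    have xi: "x i \<in> ell2 (basis_ctx \<Gamma>)" if "i \<in> S" for i using x(1)[OF that] by (simp add: hctx_def)
    have "den j Q (y e) = (\<lambda>l. \<Sum>i\<in>S. den j Q (\<lambda>\<rho>. cnj (A e i) * x i \<rho>) l)"
      unfolding y_def by (rule bop_sum[OF b ell2_scale[OF xi]])
    also have "\<dots> = (\<lambda>l. \<Sum>i\<in>S. cnj (A e i) * den j Q (x i) l)"
      by (intro ext sum.cong refl) (simp add: bop_scale[OF b xi])
    finally show ?thesis .
  qed
  define W where "W t = (\<lambda>l. \<Sum>j\<in>S. A (inv_into S \<phi> t) j * den j Q (y (inv_into S \<phi> t)) l)" for t
  have W: "W (\<phi> e) = (\<lambda>l. \<Sum>j\<in>S. A e j * den j Q (y e) l)" if "e \<in> S" for e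
    unfolding W_def using inv_into_f_f[OF inj that] by simp
  have "\<forall>t\<in>\<phi> ` S. W t \<in> rng t Q"
    using rngI[OF semA y] y by (auto simp: W)
  moreover have "v = (\<lambda>l. \<Sum>t\<in>\<phi> ` S. W t l)"
  proof
    fix l
    have "(\<Sum>t\<in>\<phi> ` S. W t l) = (\<Sum>e\<in>S. W (\<phi> e) l)" by (simp add: sum.reindex[OF inj])
    also have "\<dots> = (\<Sum>e\<in>S. \<Sum>j\<in>S. \<Sum>i\<in>S. cnj (A e i) * A e j * den j Q (x i) l)"
      by (simp add: W den_y sum_distrib_left mult_ac)
    also have "\<dots> = (\<Sum>j\<in>S. \<Sum>e\<in>S. \<Sum>i\<in>S. cnj (A e i) * A e j * den j Q (x i) l)"
      by (rule sum.swap)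
    also have "\<dots> = (\<Sum>j\<in>S. \<Sum>i\<in>S. \<Sum>e\<in>S. cnj (A e i) * A e j * den j Q (x i) l)"
      by (intro sum.cong refl sum.swap)
    also have "\<dots> = (\<Sum>j\<in>S. \<Sum>i\<in>S. if i = j then den j Q (x i) l else 0)"
      by (intro sum.cong refl) (auto simp: sum_distrib_right[symmetric] U2)
    also have "\<dots> = (\<Sum>j\<in>S. den j Q (x j) l)" using fin by simp
    also have "\<dots> = v l" using w(2) x(2) by simp
    finally show "v l = (\<Sum>t\<in>\<phi> ` S. W t l)" ..
  qed
  ultimately show ?case unfolding \<phi>_def by blast
qed

section \<open>Lists of clauses as orthogonal decompositions\<close>

lemma sum_image_nth:
  assumes "distinct (map h cs)"
  shows "(\<Sum>e\<in>h ` set cs. g e) = (\<Sum>i<length cs. g (h (cs ! i)))"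
proof -
  have "bij_betw (\<lambda>i. map h cs ! i) {..<length (map h cs)} (set (map h cs))"
    by (rule bij_betw_nth[OF assms]) auto
  then have "bij_betw (\<lambda>i. h (cs ! i)) {..<length cs} (h ` set cs)"
    by (subst bij_betw_cong[of _ _ "\<lambda>i. map h cs ! i"]) auto
  from sum.reindex_bij_betw[OF this, of g] show ?thesis by simp
qed

text \<open>Meant for both sides of a list of clauses with the same contexts, so that the two
  orthogonal families have the same coordinate spaces and \<open>change_of_basis_unitary\<close>
  applies.\<close>

lemma match_family:
  assumes "distinct (map h cs)" "ONBe Q (h ` set cs)"
    and sz: "\<And>c. c \<in> set cs \<Longrightarrow> size (h c) < n"
    and sem: "\<And>i. i < length cs \<Longrightarrow> sem (\<Gamma> i) (h (cs ! i)) Q (f i)"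
  shows "orth_isoms {..<length cs} (\<lambda>i. basis_ctx (\<Gamma> i)) (basis Q) f"
    and "\<And>v. v \<in> ell2 (basis Q) \<Longrightarrow>
      v = (\<lambda>l. \<Sum>i<length cs. f i (adj (ell2 (basis_ctx (\<Gamma> i))) (ell2 (basis Q)) (f i) v) l)"
proof -
  show "orth_isoms {..<length cs} (\<lambda>i. basis_ctx (\<Gamma> i)) (basis Q) f"
  proof
    fix i assume i: "i \<in> {..<length cs}"
    then show "isom (ell2 (basis_ctx (\<Gamma> i))) (ell2 (basis Q)) (f i)"
      using below_isom[OF sz sem, of i] by (simp add: hctx_def hty_def)
  next
    fix i j x y assume i: "i \<in> {..<length cs}" and j: "j \<in> {..<length cs}" and ij: "i \<noteq> j"
      and x: "x \<in> ell2 (basis_ctx (\<Gamma> i))" and y: "y \<in> ell2 (basis_ctx (\<Gamma> j))"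
    have "h (cs ! i) \<noteq> h (cs ! j)"
      using assms(1) i j ij nth_eq_iff_index_eq[OF assms(1), of i j] by simp
    then have "h (cs ! i) \<bottom>\<bottom> h (cs ! j)" using i j by (intro ONBe_orth[OF assms(2)]) auto
    from orth_sound[OF this sz sz rngI[OF sem] rngI[OF sem]] show "inner2 (f i x) (f j y) = 0"
      using i j x y by (simp add: hctx_def)
  qed simp
  fix v assume v: "v \<in> ell2 (basis Q)"
  then have v': "v \<in> hty Q" by (simp add: hty_def)
  have semS: "\<exists>\<Gamma> f. sem \<Gamma> e Q f" if "e \<in> h ` set cs" for e
  proof -
    from that obtain c where c: "c \<in> set cs" "e = h c" by auto
    from c(1) obtain i where "i < length cs" "c = cs ! i" by (auto simp: in_set_conv_nth)
    with c(2) have "i < length cs" "e = h (cs ! i)" by simp_all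
    then show ?thesis using sem by blast
  qed
  have szS: "size e < n" if "e \<in> h ` set cs" for e using that sz by auto
  have "v = (\<lambda>l. \<Sum>e\<in>h ` set cs. proj e Q v l)"
    by (rule span_resolution[OF assms(2) szS semS v' ONBe_span[OF assms(2) szS semS v']])
  also have "\<dots> = (\<lambda>l. \<Sum>i<length cs. f i (adj (ell2 (basis_ctx (\<Gamma> i))) (ell2 (basis Q)) (f i) v) l)"
    unfolding sum_image_nth[OF assms(1)]
    by (intro ext sum.cong refl) (simp add: proj_def sem_den[OF sem] compose_eq v' hctx_def hty_def[symmetric])
  finally show "v = (\<lambda>l. \<Sum>i<length cs. f i (adj (ell2 (basis_ctx (\<Gamma> i))) (ell2 (basis Q)) (f i) v) l)" .
qed

section \<open>The induction on size\<close>

lemma size_UMatch_le: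
  assumes "size (UMatch cs) \<le> n" "c \<in> set cs"
  shows "size (fst c) < n" "size (snd c) < n"
proof -
  obtain xs ys where "cs = xs @ c # ys" using split_list[OF assms(2)] by blast
  then show "size (fst c) < n" "size (snd c) < n" using assms(1) by (cases c; simp)+
qed

text \<open>Every constructor increases the size, so the components of a term of size at most
  \<open>n\<close> are covered by the locale. The bound is weak because
  \<open>isometric_below (Suc n)\<close> concerns sizes below \<open>Suc n\<close>.\<close>

lemma isom_step:
  assumes f: "sem \<Gamma> t Q f" and sz: "size t \<le> n"
  shows "isom (hctx \<Gamma>) (hty Q) f"
  using f
proof (cases rule: sem.cases)
  case star
  then show ?thesis using unit_ket_isom[of LStar One] by simp
next
  case (var x)
  then show ?thesis using var_isom by simp
next
  case (pair \<Gamma>\<^sub>1 t\<^sub>1 Q\<^sub>1 f\<^sub>1 \<Gamma>\<^sub>2 t\<^sub>2 Q\<^sub>2 f\<^sub>2)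
  have s: "size t\<^sub>1 < n" "size t\<^sub>2 < n" using sz pair by simp_all
  from f[unfolded pair(2)] show ?thesis
  proof (rule sem_TPair[OF _ s])
    fix \<Gamma>\<^sub>1 \<Gamma>\<^sub>2 Q\<^sub>1 Q\<^sub>2 f' g'
    assume "isom (ell2 (basis_ctx \<Gamma>\<^sub>1)) (ell2 (basis Q\<^sub>1)) f'" "isom (ell2 (basis_ctx \<Gamma>\<^sub>2)) (ell2 (basis Q\<^sub>2)) g'"
      and p: "pairing2 (basis_ctx \<Gamma>\<^sub>1) (basis_ctx \<Gamma>\<^sub>2) (basis_ctx \<Gamma>) (++) (etensor \<Gamma>\<^sub>1 \<Gamma>\<^sub>2)
       (basis Q\<^sub>1) (basis Q\<^sub>2) (basis Q) LPair vtensor"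
      and f: "f = pairing2.tensor (basis_ctx \<Gamma>\<^sub>1) (basis_ctx \<Gamma>\<^sub>2) (basis_ctx \<Gamma>) (++) (basis Q\<^sub>1) (basis Q\<^sub>2) (basis Q) LPair f' g'"
    then show ?thesis unfolding f hctx_def hty_def by (intro pairing2.tensor_isom[OF p])
  qed
next
  case (inl t' Q\<^sub>1 f' Q\<^sub>2)
  have s: "size t' < n" using sz inl by simp
  show ?thesis
    using isom_compose[OF below_isom[OF s inl(4), unfolded hctx_def] inj_left_isom] inl by (simp add: hctx_def)
next
  case (inr t' Q\<^sub>2 f' Q\<^sub>1)
  have s: "size t' < n" using sz inr by simp
  show ?thesis
    using isom_compose[OF below_isom[OF s inr(4), unfolded hctx_def] inj_right_isom] inr by (simp add: hctx_def)
next
  case zero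
  then show ?thesis using unit_ket_isom[of "LNat 0" Qnat] by simp
next
  case (succ t' f')
  have s: "size t' < n" using sz succ by simp
  show ?thesis
    using isom_compose[OF below_isom[OF s succ(4), unfolded hctx_def] succ_op_isom] succ by (simp add: hctx_def)
next
  case (sum I t' f' \<alpha>)
  have s: "size (t' i) < n" if "i \<in> I" for i
  proof -
    have "(\<alpha> i, t' i) \<in># image_mset (\<lambda>i. (\<alpha> i, t' i)) (mset_set I)" using sum(3) that by auto
    from size_TSum[OF this] sz sum(1) show ?thesis by simp
  qed
  interpret orth_isoms I "\<lambda>_. basis_ctx \<Gamma>" "basis Q" f'
  proof
    show "isom (ell2 (basis_ctx \<Gamma>)) (ell2 (basis Q)) (f' i)" if "i \<in> I" for i
      using below_isom[OF s[OF that] sum(4)[OF that]] by (simp add: hctx_def hty_def)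
    show "inner2 (f' i x) (f' j y) = 0"
      if "i \<in> I" "j \<in> I" "i \<noteq> j" "x \<in> ell2 (basis_ctx \<Gamma>)" "y \<in> ell2 (basis_ctx \<Gamma>)" for i j x y
      using orth_sound[OF sum(6)[OF that(1-3)] s s rngI[OF sum(4)] rngI[OF sum(4)]] that by (simp add: hctx_def)
  qed (rule sum(3))
  show ?thesis
    using linear_combination_isom[OF refl sum(5)] sum(2) by (simp add: hctx_def hty_def)
next
  case (app u Q\<^sub>1 g t' f')
  have s: "size u < n" "size t' < n" using sz app by simp_all
  show ?thesis
    using isom_compose[OF below_isom[OF s(2) app(4), unfolded hctx_def] unitary_op_isom[OF below_unitary[OF s(1) app(3)]]]
      app by (simp add: hctx_def)
qed

lemma unitary_step:
  assumes g: "usem u Q\<^sub>1 Q\<^sub>2 g" and sz: "size u \<le> n"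
  shows "unitary_op (hty Q\<^sub>1) (hty Q\<^sub>2) g"
  using g
proof (cases rule: usem.cases)
  case (umatch cs \<Gamma> f h)
  note s = size_UMatch_le[OF sz[unfolded umatch(1)]]
  note F = match_family[where h = fst, OF umatch(6) ONB_ONBe[OF umatch(8)] s(1) umatch(4)]
  note G = match_family[where h = snd, OF umatch(7) umatch(9) s(2) umatch(5)]
  show ?thesis
    using change_of_basis_unitary[OF F(1) G(1) F(2) G(2)] umatch(2) by (simp add: hctx_def hty_def)
next
  case (uadj u' f)
  have s: "size u' < n" using sz uadj by simp
  show ?thesis
    using unitary_op_adj[OF below_unitary[OF s uadj(3), unfolded hty_def]] uadj(2) by (simp add: hty_def)
next
  case (ucomp u\<^sub>1 R f u\<^sub>2 k)
  have s: "size u\<^sub>1 < n" "size u\<^sub>2 < n" using sz ucomp by simp_all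
  show ?thesis
    using unitary_op_compose[OF below_unitary[OF s(1) ucomp(3), unfolded hty_def] below_unitary[OF s(2) ucomp(4), unfolded hty_def]]
      ucomp(2) by (simp add: hty_def)
next
  case (utensor u\<^sub>1 P\<^sub>1 P\<^sub>2 f u\<^sub>2 P\<^sub>3 P\<^sub>4 k)
  have s: "size u\<^sub>1 < n" "size u\<^sub>2 < n" using sz utensor by simp_all
  show ?thesis
    unfolding utensor(2-4) by (rule op_tensor_unitary[OF below_unitary[OF s(1) utensor(5)] below_unitary[OF s(2) utensor(6)]])
next
  case (uplus u\<^sub>1 P\<^sub>1 P\<^sub>2 f u\<^sub>2 P\<^sub>3 P\<^sub>4 k)
  have s: "size u\<^sub>1 < n" "size u\<^sub>2 < n" using sz uplus by simp_all
  show ?thesis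
    unfolding uplus(2-4) by (rule op_plus_unitary[OF below_unitary[OF s(1) uplus(5)] below_unitary[OF s(2) uplus(6)]])
next
  case (uctrl u' P f)
  have s: "size u' < n" using sz uctrl by simp
  show ?thesis
    unfolding uctrl(2-4) by (rule ctrl_op_unitary[OF below_unitary[OF s uctrl(5)]])
qed

end

lemma isometric_below_all: "isometric_below n"
proof (induction n)
  case 0
  show ?case by standard simp_all
next
  case (Suc n)
  then interpret isometric_below n .
  show ?case by standard (simp_all add: isom_step unitary_step)
qed

theorem lemma2p63:
  fixes \<Gamma> :: ctx and t :: tm and Q :: ty
  assumes "typed \<Gamma> t Q"
  shows "(\<exists>f. sem \<Gamma> t Q f) \<and> (\<forall>f. sem \<Gamma> t Q f \<longrightarrow> isometry_op (hctx \<Gamma>) (hty Q) f)"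
proof (intro conjI allI impI)
  show "\<exists>f. sem \<Gamma> t Q f" by (rule typed_ex_sem[OF assms])
  fix f assume "sem \<Gamma> t Q f"
  then have "isom (hctx \<Gamma>) (hty Q) f"
    \<comment> \<open>Through \<open>lessI\<close> the bound is instantiated to
      \<open>Suc (size t)\<close>.\<close>
    by (rule isometric_below.below_isom[OF isometric_below_all lessI])
  then show "isometry_op (hctx \<Gamma>) (hty Q) f"
    unfolding hctx_def hty_def by (rule isom_isometry_op)
qed

end
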